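(* Let $\alpha,\alpha',\beta,\beta',\gamma,\rho,a\in\mathbb{C}$ with $\operatorname{Re}(\gamma)>0$ and $a\ne0$, put $N=[\operatorname{Re}(\gamma)]+1$, and let $\mu$ be a real number, such that $\mu>0$ and $\operatorname{Re}(\rho)-N>\max\{0,\operatorname{Re}(-\alpha+\beta),\operatorname{Re}(-\alpha-\alpha'-\beta'+\gamma)\}$. Then for every $x>0$, $$\left({}^{c}\mathcal{D}_{0+}^{\alpha,\alpha',\beta,\beta',\gamma}\left(t^{\rho-1}I^{m,n}_{p,q}\left[at^{\mu}\,\middle|\begin{matrix}(a_i,A_i,\alpha_i)_{1,p}\\(b_j,B_j,\beta_j)_{1,q}\end{matrix}\right]\right)\right)(x)=x^{\alpha+\alpha'-\gamma+\rho-1}\,I^{m,n+3}_{p+3,q+3}\left[ax^{\mu}\,\middle|\begin{matrix}U\\L\end{matrix}\right],$$ where the list of upper triples is $$U=(1-\rho,\mu,1),\ (1-\alpha+\beta-\rho+N,\mu,1),\ (1-\alpha-\alpha'-\beta'+\gamma-\rho+N,\mu,1),\ (a_i,A_i,\alpha_i)_{1,p}$$ and the list of lower triples is $$L=(b_j,B_j,\beta_j)_{1,q},\ (1+\beta-\rho+N,\mu,1),\ (1-\alpha-\alpha'+\gamma-\rho,\mu,1),\ (1-\alpha-\beta'+\gamma-\rho+N,\mu,1).$$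
   Context: **$I$-function.** Let $m,n,p,q$ be integers with $0\le m\le q$, $0\le n\le p$; let $a_i\in\mathbb{C}$, $A_i,\alpha_i>0$ $(1\le i\le p)$ and $b_j\in\mathbb{C}$, $B_j,\beta_j>0$ $(1\le j\le q)$. For $z\neq0$ (with a chosen value of $\arg z$; $z^{-s}=e^{-s(\log|z|+i\arg z)}$), $$I^{m,n}_{p,q}\left[z\,\middle|\begin{matrix}(a_i,A_i,\alpha_i)_{1,p}\\(b_j,B_j,\beta_j)_{1,q}\end{matrix}\right]=\frac{1}{2\pi i}\int_{C}\chi(s)z^{-s}\,ds,\qquad \chi(s)=\frac{\prod_{j=1}^{m}\Gamma^{\beta_j}(b_j+B_js)\prod_{i=1}^{n}\Gamma^{\alpha_i}(1-a_i-A_is)}{\prod_{j=m+1}^{q}\Gamma^{\beta_j}(1-b_j-B_js)\prod_{i=n+1}^{p}\Gamma^{\alpha_i}(a_i+A_is)}.$$ Here $(a_i,A_i,\alpha_i)_{1,p}$ is the ordered list of triples for $i=1,\dots,p$ (the first $n$ upper triples and the first $m$ lower triples enter the numerator), $\Gamma^{\kappa}(w)=(\Gamma(w))^{\kappa}$, with the branch of non-integer powers fixed along $C$ and the same for the same triple in all $I$-functions considered; empty products equal $1$. The singularities of $\Gamma^{\beta_j}(b_j+B_js)$, $j\le m$, lie to the left of $C$ and those of $\Gamma^{\alpha_i}(1-a_i-A_is)$, $i\le n$, to the right. **Standing assumptions.** The contour $C$ is the imaginary axis $\operatorname{Re}(s)=0$, traversed upwards, and for each $I$-function occurring the following conditions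 for absolute convergence hold: with (computed from the parameters of that $I$-function) $\mu^*=\sum_{j=1}^q\beta_jB_j-\sum_{i=1}^p\alpha_iA_i$, $\Omega=\sum_{i=1}^p(\frac12-\operatorname{Re}(a_i))\alpha_i-\sum_{j=1}^q(\frac12-\operatorname{Re}(b_j))\beta_j$, $\Delta=\sum_{j=1}^m\beta_jB_j-\sum_{j=m+1}^q\beta_jB_j+\sum_{i=1}^n\alpha_iA_i-\sum_{i=n+1}^p\alpha_iA_i$, either $\Delta>0$ and $|\arg z|<\frac{\pi}{2}\Delta$, or $\Delta\ge0$, $|\arg z|=\frac{\pi}{2}\Delta$ and one of: $\mu^*=0$ and $\Omega<-1$; or $\mu^*\ne0$ and $\Omega+\sigma\mu^*<-1$ where $\sigma=\operatorname{Re}(s)$ on $C$ (so $\sigma=0$). For $t>0$, $\arg(at^{\pm\mu})=\arg a$. **Operators.** For $\operatorname{Re}(\gamma)>0$, $x>0$, the left-sided Marichev–Saigo–Maeda (MSM) fractional integral is $$\left(\mathcal{I}_{0+}^{\alpha,\alpha',\beta,\beta',\gamma}f\right)(x)=\frac{x^{-\alpha}}{\Gamma(\gamma)}\int_0^x(x-t)^{\gamma-1}t^{-\alpha'}F_3\left(\alpha,\alpha',\beta,\beta';\gamma;1-\tfrac{t}{x},1-\tfrac{x}{t}\right)f(t)\,dt ,$$ and the left-sided Caputo-type MSM fractional derivative, applied to functions $f$ that are $N$ times differentiable on $(0,\infty)$, is $$\left({}^{c}\mathcal{D}_{0+}^{\alpha,\alpha',\beta,\beta',\gamma}f\right)(x)=\left(\mathcal{I}_{0+}^{-\alpha',-\alpha,-\beta'+N,-\beta,-\gamma+N}f^{(N)}\right)(x),\qquad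 N=[\operatorname{Re}(\gamma)]+1,$$ with $[\cdot]$ the integer part and $f^{(N)}$ the $N$-th derivative. $F_3(\alpha,\alpha',\beta,\beta';\gamma;u,v)=\sum_{k,l\ge0}\frac{(\alpha)_k(\alpha')_l(\beta)_k(\beta')_l}{(\gamma)_{k+l}}\frac{u^kv^l}{k!\,l!}$ for $\max\{|u|,|v|\}<1$ (third Appell function, $(\cdot)_k$ the Pochhammer symbol), and for $u\in[0,1)$, $v\le0$ it denotes the analytic continuation $\sum_{k\ge0}\frac{(\alpha)_k(\beta)_k}{(\gamma)_k}\frac{u^k}{k!}\,{}_2F_1(\alpha',\beta';\gamma+k;v)$. *)

theory Defs
  imports "HOL-Analysis.Analysis"
begin

text \<open>
  Triples \<open>(c, C, \<kappa>)\<close> stand for the factor \<open>\<Gamma>\<^sup>\<kappa>(c + C s)\<close>.  The factors \<open>\<Gamma>\<^sup>\<kappa>(1 - a - A s)\<close>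
  of an \<open>I\<close>-function belong to the triple \<open>(1 - a, -A, \<kappa>)\<close>.
\<close>

type_synonym triple = "complex \<times> real \<times> real"

text \<open>
  \<open>G (c, C, \<kappa>)\<close> is a choice of the power \<open>\<Gamma>\<^sup>\<kappa>(c + C s) = exp (\<kappa> log \<Gamma>(c + C s))\<close> along the
  imaginary axis, where the logarithm is any one that is continuous on the axis away from the
  poles of \<open>\<Gamma>(c + C s)\<close>.  As \<open>G\<close> is a function of the triple, equal triples get equal branches
  in all \<open>I\<close>-functions built from \<open>G\<close>.  For integer \<open>\<kappa>\<close> the choice is immaterial.
  On the axis itself poles occur only for denominator factors, whose reciprocals vanish there;
  the value 0 produces this because \<open>w / 0 = 0\<close>.
\<close>

definition Gamma_power_branch :: "(triple \<Rightarrow> complex \<Rightarrow> complex) \<Rightarrow> bool" where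
  "Gamma_power_branch G \<longleftrightarrow>
     (\<forall>c C \<kappa>. \<exists>L.
        continuous_on {s. Re s = 0 \<and> c + of_real C * s \<notin> \<int>\<^sub>\<le>\<^sub>0} L \<and>
        (\<forall>s. Re s = 0 \<longrightarrow>
           (if c + of_real C * s \<in> \<int>\<^sub>\<le>\<^sub>0 then G (c, C, \<kappa>) s = 0
            else exp (L s) = Gamma (c + of_real C * s) \<and>
                 G (c, C, \<kappa>) s = exp (of_real \<kappa> * L s))))"

definition I_chi ::
  "(triple \<Rightarrow> complex \<Rightarrow> complex) \<Rightarrow> nat \<Rightarrow> nat \<Rightarrow> triple list \<Rightarrow> triple list \<Rightarrow> complex \<Rightarrow> complex" where
  "I_chi G m n up lo s =
     ((\<Prod>(b, B, \<kappa>)\<leftarrow>take m lo. G (b, B, \<kappa>) s) * (\<Prod>(a, A, \<kappa>)\<leftarrow>take n up. G (1 - a, -A, \<kappa>) s)) /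
     ((\<Prod>(b, B, \<kappa>)\<leftarrow>drop m lo. G (1 - b, -B, \<kappa>) s) * (\<Prod>(a, A, \<kappa>)\<leftarrow>drop n up. G (a, A, \<kappa>) s))"

text \<open>
  \<open>up\<close> and \<open>lo\<close> are the upper and lower parameter lists, so \<open>p = length up\<close>, \<open>q = length lo\<close>.
  \<open>\<theta>\<close> is the chosen value of \<open>arg z\<close>.  The contour is \<open>s = \<i> y\<close> with \<open>ds = \<i> dy\<close>.
\<close>

definition I_fun ::
  "(triple \<Rightarrow> complex \<Rightarrow> complex) \<Rightarrow> nat \<Rightarrow> nat \<Rightarrow> triple list \<Rightarrow> triple list \<Rightarrow> complex \<Rightarrow> real \<Rightarrow> complex" where
  "I_fun G m n up lo z \<theta> =
     1 / (2 * of_real pi * \<i>) *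
     (\<integral>y. I_chi G m n up lo (\<i> * of_real y) *
          exp (- (\<i> * of_real y) * (of_real (ln (cmod z)) + \<i> * of_real \<theta>)) * \<i> \<partial>lborel)"

definition I_params :: "nat \<Rightarrow> nat \<Rightarrow> triple list \<Rightarrow> triple list \<Rightarrow> bool" where
  "I_params m n up lo \<longleftrightarrow>
     m \<le> length lo \<and> n \<le> length up \<and>
     (\<forall>(a, A, \<kappa>)\<in>set up. A > 0 \<and> \<kappa> > 0) \<and>
     (\<forall>(b, B, \<kappa>)\<in>set lo. B > 0 \<and> \<kappa> > 0)"

text \<open>The contour separates the singularities of the two kinds of numerator factors.\<close>

definition I_separated :: "nat \<Rightarrow> nat \<Rightarrow> triple list \<Rightarrow> triple list \<Rightarrow> bool" where
  "I_separated m n up lo \<longleftrightarrow>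
     (\<forall>(b, B, \<kappa>)\<in>set (take m lo). \<forall>s. b + of_real B * s \<in> \<int>\<^sub>\<le>\<^sub>0 \<longrightarrow> Re s < 0) \<and>
     (\<forall>(a, A, \<kappa>)\<in>set (take n up). \<forall>s. 1 - a - of_real A * s \<in> \<int>\<^sub>\<le>\<^sub>0 \<longrightarrow> Re s > 0)"

definition I_mu :: "triple list \<Rightarrow> triple list \<Rightarrow> real" where
  "I_mu up lo = (\<Sum>(b, B, \<kappa>)\<leftarrow>lo. \<kappa> * B) - (\<Sum>(a, A, \<kappa>)\<leftarrow>up. \<kappa> * A)"

definition I_Omega :: "triple list \<Rightarrow> triple list \<Rightarrow> real" where
  "I_Omega up lo = (\<Sum>(a, A, \<kappa>)\<leftarrow>up. (1/2 - Re a) * \<kappa>) - (\<Sum>(b, B, \<kappa>)\<leftarrow>lo. (1/2 - Re b) * \<kappa>)"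

definition I_Delta :: "nat \<Rightarrow> nat \<Rightarrow> triple list \<Rightarrow> triple list \<Rightarrow> real" where
  "I_Delta m n up lo =
     (\<Sum>(b, B, \<kappa>)\<leftarrow>take m lo. \<kappa> * B) - (\<Sum>(b, B, \<kappa>)\<leftarrow>drop m lo. \<kappa> * B) +
     (\<Sum>(a, A, \<kappa>)\<leftarrow>take n up. \<kappa> * A) - (\<Sum>(a, A, \<kappa>)\<leftarrow>drop n up. \<kappa> * A)"

definition I_conv_interior :: "nat \<Rightarrow> nat \<Rightarrow> triple list \<Rightarrow> triple list \<Rightarrow> real \<Rightarrow> bool" where
  "I_conv_interior m n up lo \<theta> \<longleftrightarrow>
     I_Delta m n up lo > 0 \<and> \<bar>\<theta>\<bar> < pi / 2 * I_Delta m n up lo"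

text \<open>\<open>\<sigma>\<close> is the real part of \<open>s\<close> on the contour.\<close>

definition I_conv_boundary :: "nat \<Rightarrow> nat \<Rightarrow> triple list \<Rightarrow> triple list \<Rightarrow> real \<Rightarrow> bool" where
  "I_conv_boundary m n up lo \<theta> \<longleftrightarrow>
     I_Delta m n up lo \<ge> 0 \<and> \<bar>\<theta>\<bar> = pi / 2 * I_Delta m n up lo \<and>
     (let \<sigma> = 0 in
        I_mu up lo = 0 \<and> I_Omega up lo < -1 \<or>
        I_mu up lo \<noteq> 0 \<and> I_Omega up lo + \<sigma> * I_mu up lo < -1)"

definition I_conv :: "nat \<Rightarrow> nat \<Rightarrow> triple list \<Rightarrow> triple list \<Rightarrow> real \<Rightarrow> bool" where
  "I_conv m n up lo \<theta> \<longleftrightarrow> I_conv_interior m n up lo \<theta> \<or> I_conv_boundary m n up lo \<theta>"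

text \<open>
  Gauss' function, continued analytically from the disc of convergence along the segment from
  0 to \<open>z\<close>: this is the principal branch on the plane cut along \<open>[1, \<infinity>)\<close>.  Two convex domains
  containing 0 and \<open>z\<close> meet in a convex, hence connected, set, so the value is unique.
\<close>

definition hyp_2F1 :: "complex \<Rightarrow> complex \<Rightarrow> complex \<Rightarrow> complex \<Rightarrow> complex" where
  "hyp_2F1 a b c z =
     (THE w. \<exists>S f. open S \<and> convex S \<and> 0 \<in> S \<and> z \<in> S \<and> f holomorphic_on S \<and>
        (\<forall>\<^sub>F u in nhds 0.
           f u = (\<Sum>l. pochhammer a l * pochhammer b l / pochhammer c l * u ^ l / fact l)) \<and>
        w = f z)"

text \<open>
  Third Appell function in the form valid for \<open>u \<in> [0, 1)\<close>, \<open>v \<le> 0\<close>, the only arguments at which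
  it is used; for \<open>|u|, |v| < 1\<close> it is the iterated form of the double series.
\<close>

definition appell_F3 ::
  "complex \<Rightarrow> complex \<Rightarrow> complex \<Rightarrow> complex \<Rightarrow> complex \<Rightarrow> complex \<Rightarrow> complex \<Rightarrow> complex" where
  "appell_F3 \<alpha> \<alpha>' \<beta> \<beta>' \<gamma> u v =
     (\<Sum>k. pochhammer \<alpha> k * pochhammer \<beta> k / pochhammer \<gamma> k * u ^ k / fact k *
          hyp_2F1 \<alpha>' \<beta>' (\<gamma> + of_nat k) v)"

definition MSM_integrand ::
  "complex \<Rightarrow> complex \<Rightarrow> complex \<Rightarrow> complex \<Rightarrow> complex \<Rightarrow> (real \<Rightarrow> complex) \<Rightarrow> real \<Rightarrow> real \<Rightarrow> complex" where
  "MSM_integrand \<alpha> \<alpha>' \<beta> \<beta>' \<gamma> f x t =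
     of_real (x - t) powr (\<gamma> - 1) * of_real t powr (- \<alpha>') *
     appell_F3 \<alpha> \<alpha>' \<beta> \<beta>' \<gamma> (of_real (1 - t / x)) (of_real (1 - x / t)) * f t"

text \<open>
  The integral is the Henstock--Kurzweil one, which covers both Lebesgue integrals and integrals
  that are only improper at the end points.
\<close>

definition MSM_integral ::
  "complex \<Rightarrow> complex \<Rightarrow> complex \<Rightarrow> complex \<Rightarrow> complex \<Rightarrow> (real \<Rightarrow> complex) \<Rightarrow> real \<Rightarrow> complex" where
  "MSM_integral \<alpha> \<alpha>' \<beta> \<beta>' \<gamma> f x =
     of_real x powr (- \<alpha>) / Gamma \<gamma> * integral {0<..<x} (MSM_integrand \<alpha> \<alpha>' \<beta> \<beta>' \<gamma> f x)"

definition nth_deriv :: "nat \<Rightarrow> (real \<Rightarrow> complex) \<Rightarrow> real \<Rightarrow> complex" where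
  "nth_deriv k f = ((\<lambda>g t. vector_derivative g (at t)) ^^ k) f"

definition times_differentiable_pos :: "nat \<Rightarrow> (real \<Rightarrow> complex) \<Rightarrow> bool" where
  "times_differentiable_pos N f \<longleftrightarrow> (\<forall>k<N. \<forall>t>0. nth_deriv k f differentiable (at t))"

definition caputo_order :: "complex \<Rightarrow> nat" where
  "caputo_order \<gamma> = nat \<lfloor>Re \<gamma>\<rfloor> + 1"

definition caputo_MSM ::
  "complex \<Rightarrow> complex \<Rightarrow> complex \<Rightarrow> complex \<Rightarrow> complex \<Rightarrow> (real \<Rightarrow> complex) \<Rightarrow> real \<Rightarrow> complex" where
  "caputo_MSM \<alpha> \<alpha>' \<beta> \<beta>' \<gamma> f =
     (let N = caputo_order \<gamma> in
      MSM_integral (- \<alpha>') (- \<alpha>) (- \<beta>' + of_nat N) (- \<beta>) (- \<gamma> + of_nat N) (nth_deriv N f))"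

text \<open>\<open>f\<close> is in the domain of the operator and the integral defining its value at \<open>x\<close> converges.\<close>

definition caputo_MSM_exists ::
  "complex \<Rightarrow> complex \<Rightarrow> complex \<Rightarrow> complex \<Rightarrow> complex \<Rightarrow> (real \<Rightarrow> complex) \<Rightarrow> real \<Rightarrow> bool" where
  "caputo_MSM_exists \<alpha> \<alpha>' \<beta> \<beta>' \<gamma> f x \<longleftrightarrow>
     (let N = caputo_order \<gamma> in
      times_differentiable_pos N f \<and>
      MSM_integrand (- \<alpha>') (- \<alpha>) (- \<beta>' + of_nat N) (- \<beta>) (- \<gamma> + of_nat N) (nth_deriv N f) x
        integrable_on {0<..<x})"

end

theory Submission
  imports Defs "HOL-Complex_Analysis.Complex_Analysis" "HOL-Real_Asymp.Real_Asymp"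
begin

text \<open>
  On the contour \<open>s = \<i> y\<close> the function \<open>f t = t\<^sup>\<rho>\<^sup>-\<^sup>1 I[a t\<^sup>\<mu>]\<close> is a superposition
  \<open>\<integral> H(y) t powr (\<rho> - 1 - \<i> \<mu> y) dy\<close> of powers, with a weight \<open>H\<close> that does not depend on \<open>t\<close>
  (\<open>I_fun_power\<close>).  Differentiating \<open>N\<close> times turns the exponent into \<open>\<rho> - N - 1 - \<i> \<mu> y\<close> and produces
  \<open>\<Gamma>(\<rho> - \<mu> s) / \<Gamma>(\<rho> - N - \<mu> s)\<close>.  The integral operator has a homogeneous kernel, so it multiplies
  every power by the Mellin transform of that kernel, which is a product of three Gamma functions
  divided by another three.  One numerator factor cancels \<open>\<Gamma>(\<rho> - N - \<mu> s)\<close>, and what remains are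
  the six factors contributed to \<open>\<chi>\<close> by the additional triples of \<open>U\<close> and \<open>L\<close>.  Three points carry
  the proof.

  \<^emph>\<open>The Mellin transform of the kernel.\<close>  Pfaff's transformation (\<open>hyp_2F1_negative_real\<close>) rewrites
  the kernel, as a function of \<open>u = t / x\<close>, as \<open>(1 - u) powr (g - 1)\<close> times a power series in \<open>1 - u\<close>
  whose coefficients are the diagonal sums of a double series.  Integrating term by term and applying
  Gauss' theorem \<open>gauss_summation\<close> in each of the two directions gives the transform
  (\<open>f3_kernel_Mellin\<close>).  The double series converges absolutely down to the sharp abscissa
  only under a sign condition on the parameters.  The transform
  \<open>\<Prod> \<Gamma>(\<rho> + e\<^sub>i) / \<Prod> \<Gamma>(\<rho> + d\<^sub>i)\<close> is symmetric in the \<open>e\<^sub>i\<close> and in the \<open>d\<^sub>i\<close>, whereas the series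
  is not.  Kernels whose transforms agree far to the right are equal (\<open>ser_kernel_unique\<close>), so every
  arrangement of the \<open>e\<^sub>i\<close> and \<open>d\<^sub>i\<close> gives a series for the same kernel.  As \<open>\<Sum> d\<^sub>i - \<Sum> e\<^sub>i = g\<close> has
  positive real part, the largest \<open>Re d\<^sub>i\<close> exceeds the smallest \<open>Re e\<^sub>j\<close>, and this is the condition
  that one of the arrangements needs (\<open>f3_kernel_representation\<close>).

  \<^emph>\<open>The size of the weight.\<close>  A form of Stirling's formula with constant factors
  (\<open>norm_Gamma_vertical\<close>) bounds \<open>H(y)\<close> by
  \<open>(1 + \<bar>y\<bar>) powr \<Omega> * exp ((\<bar>\<theta>\<bar> - \<pi> \<Delta> / 2) \<bar>y\<bar>)\<close>.  The additional triples leave \<open>\<Delta>\<close> unchanged and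
  increase \<open>\<Omega>\<close> by \<open>Re \<gamma>\<close>.  Hence the convergence condition of the right-hand side says that
  \<open>H(y) (1 + \<bar>y\<bar>) powr (Re \<gamma> + \<epsilon>)\<close> is integrable for some \<open>\<epsilon> > 0\<close>.

  \<^emph>\<open>The last derivative.\<close>  This weight suffices for \<open>N - 1\<close> differentiations under the integral
  sign, while on the boundary of the sector the \<open>N\<close>-th derivative may not be given by an
  absolutely convergent integral.  It is therefore integrated by parts (\<open>kernel_integral_of_derivative\<close>).
  The kernel behaves like \<open>(1 - u) powr (g - 1)\<close> at \<open>u = 1\<close>, so the power of the same exponent
  \<open>\<rho> - N\<close> that agrees with the \<open>(N - 1)\<close>-st derivative at \<open>u = 1\<close> is subtracted first.  The difference
  is \<open>O((1 - u) powr \<delta>)\<close> with \<open>\<delta> = 1 - Re g + \<epsilon>\<close>, because \<open>u powr (- \<i> \<mu> y) - 1\<close> is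
  \<open>O(\<bar>y\<bar> powr \<delta> (1 - u) powr \<delta>)\<close>; this makes the differentiated kernel times the difference
  absolutely integrable in \<open>u\<close> and \<open>y\<close> jointly.  Fubini's theorem applies to it, and integrating by
  parts backwards for each \<open>y\<close> recovers the Mellin transform.
\<close>

section \<open>Growth of the Gamma function on vertical lines\<close>

lemma ln_norm_plus_one_le:
  fixes w :: complex
  assumes "1 + w \<noteq> 0"
  shows "ln (norm (1 + w)) \<le> Re w + (norm w)\<^sup>2 / 2"
proof -
  have "2 * ln (norm (1 + w)) = ln ((norm (1 + w))\<^sup>2)" using assms by (simp add: ln_realpow)
  also have "(norm (1 + w))\<^sup>2 = 1 + (2 * Re w + (norm w)\<^sup>2)"
    unfolding cmod_power2 by (simp add: power2_eq_square algebra_simps)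
  also have "ln \<dots> \<le> 2 * Re w + (norm w)\<^sup>2"
  proof (rule ln_add_one_self_le_self2)
    have "(norm (1 + w))\<^sup>2 > 0" using assms by simp
    thus "- 1 < 2 * Re w + (norm w)\<^sup>2"
      unfolding cmod_power2 by (simp add: power2_eq_square algebra_simps)
  qed
  finally show ?thesis by simp
qed

text \<open>
  The logarithm of the modulus telescopes against the terms \<open>Re (1 / (z + n))\<close> of the Digamma
  series up to a quadratic error.  The upper estimate is \<open>ln_norm_plus_one_le\<close> at \<open>1 / z\<close>; the lower one
  is the same lemma at \<open>- 1 / (z + 1)\<close>, since \<open>(1 + 1 / z) (1 - 1 / (z + 1)) = 1\<close>.
\<close>

lemma ln_norm_step:
  fixes z :: complex
  assumes z: "Re z \<ge> 1"
  shows "\<bar>ln (norm (z + 1)) - ln (norm z) - Re (1 / z)\<bar> \<le> 2 / (norm z)\<^sup>2"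
proof -
  have z0: "z \<noteq> 0" "z + 1 \<noteq> 0" using z by (auto simp: complex_eq_iff)
  have nle: "norm z \<le> norm (z + 1)"
    using z by (auto simp: cmod_def intro!: real_sqrt_le_mono power_mono)
  have nz: "norm z > 0" "norm (z + 1) > 0" using z0 by auto
  have up: "ln (norm (z + 1)) - ln (norm z) \<le> Re (1 / z) + 1 / (2 * (norm z)\<^sup>2)"
  proof -
    have "ln (norm (z + 1)) - ln (norm z) = ln (norm (1 + 1 / z))"
      using z0 nz by (subst ln_divide_pos [symmetric]) (auto simp: norm_divide[symmetric] add_divide_distrib add.commute)
    also have "\<dots> \<le> Re (1 / z) + (norm (1 / z))\<^sup>2 / 2"
      using z0 by (intro ln_norm_plus_one_le) (auto simp: field_simps)
    finally show ?thesis by (simp add: norm_divide power_divide)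
  qed
  have lo: "ln (norm z) - ln (norm (z + 1)) \<le> - Re (1 / (z + 1)) + 1 / (2 * (norm (z + 1))\<^sup>2)"
  proof -
    have "ln (norm z) - ln (norm (z + 1)) = ln (norm (1 + (- 1 / (z + 1))))"
      using z0 nz by (subst ln_divide_pos [symmetric]) (auto simp: norm_divide[symmetric] field_simps)
    also have "\<dots> \<le> Re (- 1 / (z + 1)) + (norm (- 1 / (z + 1)))\<^sup>2 / 2"
      using z0 by (intro ln_norm_plus_one_le) (auto simp: field_simps)
    finally show ?thesis by (simp add: norm_divide power_divide)
  qed
  have "\<bar>Re (1 / z) - Re (1 / (z + 1))\<bar> \<le> norm (1 / z - 1 / (z + 1))"
    using abs_Re_le_cmod[of "1 / z - 1 / (z + 1)"] by simp
  also have "1 / z - 1 / (z + 1) = 1 / (z * (z + 1))" using z0 by (simp add: field_simps)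
  also have "norm \<dots> \<le> 1 / (norm z)\<^sup>2"
    unfolding norm_divide norm_mult power2_eq_square norm_one using nz nle
    by (intro divide_left_mono mult_left_mono mult_pos_pos) auto
  finally have diff: "\<bar>Re (1 / z) - Re (1 / (z + 1))\<bar> \<le> 1 / (norm z)\<^sup>2" .
  have "1 / (2 * (norm (z + 1))\<^sup>2) \<le> 1 / (2 * (norm z)\<^sup>2)"
    using nz nle by (intro divide_left_mono mult_left_mono power_mono) auto
  hence "ln (norm z) - ln (norm (z + 1)) + Re (1 / z) \<le> (3/2) * (1 / (norm z)\<^sup>2)" using lo diff by (simp add: abs_le_iff)
  moreover have "1 / (norm z)\<^sup>2 > 0" using nz by simp
  ultimately have "ln (norm z) - ln (norm (z + 1)) + Re (1 / z) \<le> 2 * (1 / (norm z)\<^sup>2)" by linarith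
  moreover have "ln (norm (z + 1)) - ln (norm z) - Re (1 / z) \<le> 2 * (1 / (norm z)\<^sup>2)"
  proof -
    have "1 / (2 * (norm z)\<^sup>2) = (1 / 2) * (1 / (norm z)\<^sup>2)" by simp
    thus ?thesis using up \<open>1 / (norm z)\<^sup>2 > 0\<close> by linarith
  qed
  ultimately show ?thesis by (simp add: abs_le_iff)
qed

text \<open>
  \<open>Re (Digamma z)\<close> is the slope of \<open>ln \<bar>\<Gamma>\<bar>\<close> in the horizontal direction.  Away from the left half
  plane the errors of \<open>ln_norm_step\<close> at \<open>z, z + 1, z + 2, \<dots>\<close> add up to a constant independent of \<open>z\<close>.
\<close>

lemma Re_Digamma_bound:
  obtains C :: real where "\<And>z. Re z \<ge> 1 \<Longrightarrow> \<bar>Re (Digamma z) - ln (norm z)\<bar> \<le> C"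
proof -
  define e where "e = (\<lambda>n. 2 * inverse ((real (Suc n))\<^sup>2))"
  have se: "summable e" unfolding e_def
    using inverse_power_summable[of 2] by (intro summable_mult) (subst summable_Suc_iff, auto)
  have "\<bar>Re (Digamma z) - ln (norm z)\<bar> \<le> suminf e" if z: "Re z \<ge> 1" for z
  proof -
    have z0: "z \<noteq> 0" using z by auto
    define P where "P = (\<lambda>m. of_real (ln (real m)) - (\<Sum>n<m. inverse (z + of_nat n)))"
    have lim: "(\<lambda>m. Re (P m)) \<longlonglongrightarrow> Re (Digamma z)"
      unfolding P_def using Digamma_LIMSEQ[OF z0] by (intro tendsto_Re) simp
    have limln: "(\<lambda>m. ln (norm (z + of_nat m)) - ln (real m)) \<longlonglongrightarrow> 0"
    proof -
      have "(\<lambda>m. z / of_nat m) \<longlonglongrightarrow> 0" by (rule lim_const_over_n)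
      hence "(\<lambda>m. ln (norm (1 + z / of_nat m))) \<longlonglongrightarrow> ln (norm (1 + 0 :: complex))"
        by (intro tendsto_intros) auto
      hence "(\<lambda>m. ln (norm (1 + z / of_nat m))) \<longlonglongrightarrow> 0" by simp
      thus ?thesis
      proof (rule Lim_transform_eventually)
        show "eventually (\<lambda>m. ln (norm (1 + z / of_nat m)) = ln (norm (z + of_nat m)) - ln (real m)) sequentially"
          using eventually_gt_at_top[of 0]
        proof eventually_elim
          case (elim m)
          have "z + of_nat m \<noteq> 0" using z by (auto simp: complex_eq_iff)
          hence "ln (norm (z + of_nat m)) - ln (real m) = ln (norm (z + of_nat m) / norm (of_nat m :: complex))"
            using elim by (subst ln_divide_pos) auto
          also have "norm (z + of_nat m) / norm (of_nat m :: complex) = norm (1 + z / of_nat m)"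
            using elim by (subst norm_divide[symmetric]) (simp add: add_divide_distrib add.commute)
          finally show ?case by simp
        qed
      qed
    qed
    have bd: "\<bar>Re (P m) - ln (norm z) + (ln (norm (z + of_nat m)) - ln (real m))\<bar> \<le> suminf e" for m
    proof -
      define D where "D = (\<lambda>n. ln (norm (z + of_nat n + 1)) - ln (norm (z + of_nat n)) - Re (1 / (z + of_nat n)))"
      have "(\<Sum>n<m. D n) = ln (norm (z + of_nat m)) - ln (norm z) - (\<Sum>n<m. Re (1 / (z + of_nat n)))"
        unfolding D_def sum_subtractf[of "\<lambda>n. ln (norm (z + of_nat n + 1)) - ln (norm (z + of_nat n))"]
        using sum_lessThan_telescope[of "\<lambda>n. ln (norm (z + of_nat n))" m]
        by (simp add: add_ac)
      hence "Re (P m) - ln (norm z) + (ln (norm (z + of_nat m)) - ln (real m)) = (\<Sum>n<m. D n)"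
        unfolding P_def by (simp add: inverse_eq_divide)
      also have "\<bar>\<dots>\<bar> \<le> (\<Sum>n<m. \<bar>D n\<bar>)" by (rule sum_abs)
      also have "\<dots> \<le> (\<Sum>n<m. e n)"
      proof (rule sum_mono)
        fix n
        have "\<bar>D n\<bar> \<le> 2 / (norm (z + of_nat n))\<^sup>2" unfolding D_def by (rule ln_norm_step) (use z in simp)
        also have "\<dots> \<le> 2 / (real (Suc n))\<^sup>2"
        proof -
          have "real (Suc n) \<le> norm (z + of_nat n)"
            using complex_Re_le_cmod[of "z + of_nat n"] z by simp
          thus ?thesis by (intro divide_left_mono power_mono mult_pos_pos) (auto intro: power2_eq_square zero_less_power)
        qed
        finally show "\<bar>D n\<bar> \<le> e n" by (simp add: e_def divide_inverse)
      qed
      also have "\<dots> \<le> suminf e" by (intro sum_le_suminf se) (auto simp: e_def)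
      finally show ?thesis .
    qed
    have "(\<lambda>m. \<bar>Re (P m) - ln (norm z) + (ln (norm (z + of_nat m)) - ln (real m))\<bar>) \<longlonglongrightarrow> \<bar>Re (Digamma z) - ln (norm z) + 0\<bar>"
      by (intro tendsto_intros lim limln)
    from LIMSEQ_le_const2[OF this] show ?thesis using bd by auto
  qed
  thus ?thesis using that by blast
qed

text \<open>
  On the line \<open>Re z = 1\<close> the reflection formula gives the exact value
  \<open>\<bar>\<Gamma>(1 + \<i> t)\<bar>\<^sup>2 = \<pi> t / sinh (\<pi> t)\<close>.
\<close>

lemma norm_Gamma_one_plus_imaginary:
  assumes t: "\<bar>t\<bar> \<ge> 1"
  shows "norm (Gamma (Complex 1 t)) \<le> sqrt (4 * pi) * \<bar>t\<bar> powr (1/2) * exp (- pi / 2 * \<bar>t\<bar>)" (is "_ \<le> ?R")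
    and "\<bar>t\<bar> powr (1/2) * exp (- pi / 2 * \<bar>t\<bar>) \<le> norm (Gamma (Complex 1 t))"
proof -
  define E where "E = exp (pi * \<bar>t\<bar>)"
  have E: "E > 2"
  proof -
    have "1 + pi * \<bar>t\<bar> \<le> E" unfolding E_def by (rule exp_ge_add_one_self)
    moreover have "pi * \<bar>t\<bar> \<ge> 3 * 1" by (intro mult_mono) (use t pi_gt3 in auto)
    ultimately show ?thesis by linarith
  qed
  have iE2: "inverse E \<le> 1 / 2" "inverse E > 0"
    using E le_imp_inverse_le[of 2 E] by (auto simp: inverse_eq_divide)
  have nn: "\<i> * of_real t \<notin> \<int>\<^sub>\<le>\<^sub>0" using t by (auto elim!: nonpos_Ints_cases simp: complex_eq_iff)
  have c1: "Complex 1 t = \<i> * of_real t + 1" "cnj (Complex 1 t) = 1 - \<i> * of_real t"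
    by (auto simp: complex_eq_iff)
  have "Gamma (Complex 1 t) * cnj (Gamma (Complex 1 t)) = Gamma (\<i> * of_real t + 1) * Gamma (1 - \<i> * of_real t)"
    unfolding cnj_Gamma c1(2) by (simp only: c1(1))
  also have "\<dots> = \<i> * of_real t * (of_real pi / sin (of_real pi * (\<i> * of_real t)))"
    by (simp add: Gamma_plus1[OF nn] Gamma_reflection_complex[symmetric])
  finally have "norm (Gamma (Complex 1 t) * cnj (Gamma (Complex 1 t))) = norm (\<i> * of_real t * (of_real pi / sin (of_real pi * (\<i> * of_real t))))"
    by simp
  hence "(norm (Gamma (Complex 1 t)))\<^sup>2 = \<bar>t\<bar> * (pi / norm (sin (of_real pi * (\<i> * of_real t))))"
    by (simp add: norm_mult norm_divide power2_eq_square)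
  also have "norm (sin (of_real pi * (\<i> * of_real t))) = (E - inverse E) / 2"
  proof -
    have "norm (sin (of_real pi * (\<i> * of_real t))) = \<bar>exp (pi * t) - inverse (exp (pi * t))\<bar> / 2"
    proof -
      have "sin (of_real pi * (\<i> * of_real t)) = \<i> * of_real ((exp (pi * t) - inverse (exp (pi * t))) / 2)"
        using sin_i_times[of "of_real (pi * t)"] by (simp add: exp_minus mult_ac flip: exp_of_real)
      thus ?thesis by (simp only: norm_mult norm_ii norm_of_real) (simp add: abs_divide)
    qed
    also have "\<dots> = (E - inverse E) / 2"
    proof (cases "t \<ge> 0")
      case True
      hence "exp (pi * t) = E" by (simp add: E_def)
      moreover have "inverse E \<le> E" using iE2 E by linarith
      ultimately show ?thesis by simp
    next
      case False
      hence "exp (pi * t) = inverse E" by (simp add: E_def exp_minus[symmetric])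
      moreover have "inverse E \<le> E" using iE2 E by linarith
      ultimately show ?thesis by simp
    qed
    finally show ?thesis .
  qed
  finally have sq: "(norm (Gamma (Complex 1 t)))\<^sup>2 = 2 * pi * \<bar>t\<bar> / (E - inverse E)" by simp
  have iE: "inverse E \<le> E / 2" "inverse E > 0" using iE2 E by linarith+
  have tp: "\<bar>t\<bar> powr (1/2) = sqrt \<bar>t\<bar>" by (simp add: powr_half_sqrt)
  have eh: "(exp (- pi / 2 * \<bar>t\<bar>))\<^sup>2 = inverse E"
    by (simp add: E_def exp_minus[symmetric] flip: exp_double)
  have "2 * pi * \<bar>t\<bar> / (E - inverse E) \<le> 2 * pi * \<bar>t\<bar> / (E / 2)"
  proof (rule divide_left_mono)
    show "E / 2 \<le> E - inverse E" using iE by linarith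
    show "0 \<le> 2 * pi * \<bar>t\<bar>" by simp
    have "0 < E - inverse E" "0 < E / 2" using iE E by linarith+
    thus "0 < (E - inverse E) * (E / 2)" by (rule mult_pos_pos)
  qed
  also have "\<dots> = 4 * pi * \<bar>t\<bar> * inverse E" by (simp add: inverse_eq_divide)
  also have "\<dots> = ?R\<^sup>2" unfolding power_mult_distrib tp eh by simp
  finally show "norm (Gamma (Complex 1 t)) \<le> ?R"
    unfolding sq[symmetric] by (rule power2_le_imp_le) simp
  have "(\<bar>t\<bar> powr (1/2) * exp (- pi / 2 * \<bar>t\<bar>))\<^sup>2 = \<bar>t\<bar> * inverse E" unfolding power_mult_distrib tp eh by simp
  also have "\<dots> \<le> (2 * pi * \<bar>t\<bar>) * inverse E"
  proof (rule mult_right_mono)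
    have "1 * \<bar>t\<bar> \<le> (2 * pi) * \<bar>t\<bar>" using pi_gt3 by (intro mult_right_mono) linarith+
    thus "\<bar>t\<bar> \<le> 2 * pi * \<bar>t\<bar>" by simp
  qed (use E in simp)
  also have "\<dots> \<le> 2 * pi * \<bar>t\<bar> / (E - inverse E)"
    unfolding divide_inverse
  proof (rule mult_left_mono)
    show "inverse E \<le> inverse (E - inverse E)" using iE E by (intro le_imp_inverse_le) linarith+
    show "0 \<le> 2 * pi * \<bar>t\<bar>" by simp
  qed
  finally show "\<bar>t\<bar> powr (1/2) * exp (- pi / 2 * \<bar>t\<bar>) \<le> norm (Gamma (Complex 1 t))"
    unfolding sq[symmetric] by (rule power2_le_imp_le) simp
qed

text \<open>
  The mean value theorem transports the exact value on the line \<open>Re z = 1\<close> to the line \<open>Re z = s\<close>: on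
  the segment between them the slope of \<open>ln \<bar>\<Gamma>\<bar>\<close> is \<open>ln \<bar>t\<bar>\<close> up to a bounded error.
\<close>

lemma ln_norm_Gamma_right:
  assumes s: "s \<ge> 1"
  obtains K where "\<And>t. \<bar>t\<bar> \<ge> 1 \<Longrightarrow>
    \<bar>ln (norm (Gamma (Complex s t))) - ln (norm (Gamma (Complex 1 t))) - (s - 1) * ln \<bar>t\<bar>\<bar> \<le> K"
proof -
  obtain C where C: "\<And>z. Re z \<ge> 1 \<Longrightarrow> \<bar>Re (Digamma z) - ln (norm z)\<bar> \<le> C"
    using Re_Digamma_bound by blast
  have "\<bar>ln (norm (Gamma (Complex s t))) - ln (norm (Gamma (Complex 1 t))) - (s - 1) * ln \<bar>t\<bar>\<bar> \<le> (C + s) * (s - 1)"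
    if t: "\<bar>t\<bar> \<ge> 1" for t
  proof (cases "s = 1")
    case False
    with s have s1: "1 < s" by simp
    define q where "q = (\<lambda>r. Re (ln_Gamma (Complex r t)) - r * ln \<bar>t\<bar>)"
    have notin: "Complex r t \<notin> \<real>\<^sub>\<le>\<^sub>0" for r using t by (auto simp: complex_nonpos_Reals_iff)
    have lnG: "ln (norm (Gamma (Complex r t))) = Re (ln_Gamma (Complex r t))" for r
    proof -
      have "Complex r t \<notin> \<int>\<^sub>\<le>\<^sub>0" using notin nonpos_Ints_subset_nonpos_Reals by blast
      thus ?thesis by (simp add: Gamma_complex_altdef)
    qed
    have deriv: "(q has_real_derivative (Re (Digamma (Complex r t)) - ln \<bar>t\<bar>)) (at r)" for r
    proof -
      have "((\<lambda>r. Complex r t) has_vector_derivative 1) (at r)"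
        unfolding complex_of_real_def[symmetric] Complex_eq by (auto intro!: derivative_eq_intros)
      moreover have "(ln_Gamma has_field_derivative Digamma (Complex r t)) (at (Complex r t))"
        by (rule has_field_derivative_ln_Gamma_complex[OF notin])
      ultimately have "((ln_Gamma \<circ> (\<lambda>r. Complex r t)) has_vector_derivative 1 * Digamma (Complex r t)) (at r)"
        by (rule field_vector_diff_chain_at)
      hence "((\<lambda>r. Re (ln_Gamma (Complex r t))) has_real_derivative Re (Digamma (Complex r t))) (at r)"
        by (auto dest!: has_field_derivative_Re simp: o_def)
      moreover have "((\<lambda>r. r * ln \<bar>t\<bar>) has_real_derivative ln \<bar>t\<bar>) (at r)"
        by (auto intro!: derivative_eq_intros)
      ultimately show ?thesis unfolding q_def by (rule DERIV_diff)
    qed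
    obtain r where r: "1 < r" "r < s" "q s - q 1 = (s - 1) * (Re (Digamma (Complex r t)) - ln \<bar>t\<bar>)"
    proof -
      have "\<exists>r>1. r < s \<and> q s - q 1 = (s - 1) * (Re (Digamma (Complex r t)) - ln \<bar>t\<bar>)"
        by (rule MVT2[OF s1]) (rule deriv)
      thus ?thesis using that by blast
    qed
    have "\<bar>Re (Digamma (Complex r t)) - ln \<bar>t\<bar>\<bar> \<le> C + s"
    proof -
      have "\<bar>t\<bar> \<le> norm (Complex r t)" using abs_Im_le_cmod[of "Complex r t"] by simp
      moreover have "norm (Complex r t) \<le> \<bar>t\<bar> * (1 + s)"
      proof -
        have "norm (Complex r t) \<le> r + \<bar>t\<bar>" using cmod_le[of "Complex r t"] r by simp
        also have "r \<le> s * \<bar>t\<bar>" using r s t mult_mono[of r s 1 "\<bar>t\<bar>"] by simp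
        finally show ?thesis by (simp add: algebra_simps)
      qed
      ultimately have "ln \<bar>t\<bar> \<le> ln (norm (Complex r t))" "ln (norm (Complex r t)) \<le> ln (\<bar>t\<bar> * (1 + s))"
        using t s by (intro ln_mono; linarith)+
      moreover have "ln (\<bar>t\<bar> * (1 + s)) = ln \<bar>t\<bar> + ln (1 + s)" using t s by (subst ln_mult) auto
      moreover have "ln (1 + s) \<le> s" using s by (intro ln_add_one_self_le_self) auto
      moreover have "\<bar>Re (Digamma (Complex r t)) - ln (norm (Complex r t))\<bar> \<le> C" by (rule C) (use r in simp)
      ultimately show ?thesis by linarith
    qed
    hence "\<bar>q s - q 1\<bar> \<le> (C + s) * (s - 1)" unfolding r(3) abs_mult
      using s1 by (simp add: mult.commute mult_left_mono)
    thus ?thesis unfolding lnG q_def by (simp add: algebra_simps)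
  qed simp
  thus ?thesis using that by blast
qed

lemma norm_Gamma_vertical_right:
  assumes s: "s \<ge> 1"
  obtains K where "K > 0"
    "\<And>t. \<bar>t\<bar> \<ge> 1 \<Longrightarrow> norm (Gamma (Complex s t)) \<le> K * \<bar>t\<bar> powr (s - 1/2) * exp (- pi / 2 * \<bar>t\<bar>)"
    "\<And>t. \<bar>t\<bar> \<ge> 1 \<Longrightarrow> \<bar>t\<bar> powr (s - 1/2) * exp (- pi / 2 * \<bar>t\<bar>) \<le> K * norm (Gamma (Complex s t))"
proof -
  obtain K where K: "\<And>t. \<bar>t\<bar> \<ge> 1 \<Longrightarrow>
    \<bar>ln (norm (Gamma (Complex s t))) - ln (norm (Gamma (Complex 1 t))) - (s - 1) * ln \<bar>t\<bar>\<bar> \<le> K"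
    using ln_norm_Gamma_right[OF s] by blast
  define M where "M = exp K * sqrt (4 * pi)"
  have sq1: "sqrt (4 * pi) \<ge> 1" using pi_gt3 by simp
  have M: "M > 0" by (simp add: M_def)
  have main: "norm (Gamma (Complex s t)) \<le> M * \<bar>t\<bar> powr (s - 1/2) * exp (- pi / 2 * \<bar>t\<bar>) \<and>
     \<bar>t\<bar> powr (s - 1/2) * exp (- pi / 2 * \<bar>t\<bar>) \<le> M * norm (Gamma (Complex s t))" if t: "\<bar>t\<bar> \<ge> 1" for t
  proof -
    define G where "G = norm (Gamma (Complex s t))"
    define G1 where "G1 = norm (Gamma (Complex 1 t))"
    have notin: "Complex r t \<notin> \<int>\<^sub>\<le>\<^sub>0" for r using t by (auto elim!: nonpos_Ints_cases simp: complex_eq_iff)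
    have pos: "G > 0" "G1 > 0" unfolding G_def G1_def using notin by (auto simp: Gamma_eq_zero_iff)
    have tp: "\<bar>t\<bar> powr (s - 1) = exp ((s - 1) * ln \<bar>t\<bar>)" "\<bar>t\<bar> powr (s - 1) > 0" using t by (auto simp: powr_def)
    have tq: "\<bar>t\<bar> powr (s - 1/2) = \<bar>t\<bar> powr (s - 1) * \<bar>t\<bar> powr (1/2)" by (simp flip: powr_add)
    have Kt: "\<bar>ln G - ln G1 - (s - 1) * ln \<bar>t\<bar>\<bar> \<le> K" using K[OF t] by (simp add: G_def G1_def)
    have a: "exp (ln G) \<le> exp (K + (s - 1) * ln \<bar>t\<bar> + ln G1)" using Kt by (subst exp_le_cancel_iff) linarith
    hence a: "G \<le> exp K * \<bar>t\<bar> powr (s - 1) * G1" using pos by (simp add: exp_add tp)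
    have b: "exp ((s - 1) * ln \<bar>t\<bar> + ln G1) \<le> exp (K + ln G)" using Kt by (subst exp_le_cancel_iff) linarith
    hence b: "\<bar>t\<bar> powr (s - 1) * G1 \<le> exp K * G" using pos by (simp add: exp_add tp)
    have "G \<le> exp K * \<bar>t\<bar> powr (s - 1) * (sqrt (4 * pi) * \<bar>t\<bar> powr (1/2) * exp (- pi / 2 * \<bar>t\<bar>))"
      using norm_Gamma_one_plus_imaginary(1)[OF t] by (intro order_trans[OF a] mult_left_mono) (simp_all add: G1_def)
    hence 1: "G \<le> M * \<bar>t\<bar> powr (s - 1/2) * exp (- pi / 2 * \<bar>t\<bar>)" by (simp add: M_def tq mult_ac)
    have "\<bar>t\<bar> powr (s - 1) * (\<bar>t\<bar> powr (1/2) * exp (- pi / 2 * \<bar>t\<bar>)) \<le> \<bar>t\<bar> powr (s - 1) * G1"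
      using norm_Gamma_one_plus_imaginary(2)[OF t] by (intro mult_left_mono) (simp_all add: G1_def)
    also note b
    also have "exp K * G \<le> M * G" using pos sq1 by (simp add: M_def)
    finally have 2: "\<bar>t\<bar> powr (s - 1/2) * exp (- pi / 2 * \<bar>t\<bar>) \<le> M * G" by (simp add: tq mult_ac)
    show ?thesis using 1 2 by (simp add: G_def)
  qed
  show ?thesis by (rule that[OF M]) (use main in auto)
qed

text \<open>
  Stirling's formula up to constant factors.  The functional equation carries the estimate from the
  lines \<open>Re z \<ge> 1\<close> to all others, because a product of \<open>k\<close> factors \<open>z + i\<close> has modulus comparable with
  \<open>\<bar>t\<bar> ^ k\<close>.
\<close>

theorem norm_Gamma_vertical:
  obtains K where "K > 0"
    "\<And>t. \<bar>t\<bar> \<ge> 1 \<Longrightarrow> norm (Gamma (Complex s t)) \<le> K * \<bar>t\<bar> powr (s - 1/2) * exp (- pi / 2 * \<bar>t\<bar>)"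
    "\<And>t. \<bar>t\<bar> \<ge> 1 \<Longrightarrow> \<bar>t\<bar> powr (s - 1/2) * exp (- pi / 2 * \<bar>t\<bar>) \<le> K * norm (Gamma (Complex s t))"
proof -
  obtain k :: nat where k: "real k \<ge> 1 - s" using real_arch_simple by blast
  obtain K where K: "K > 0"
    "\<And>t. \<bar>t\<bar> \<ge> 1 \<Longrightarrow> norm (Gamma (Complex (s + k) t)) \<le> K * \<bar>t\<bar> powr (s + k - 1/2) * exp (- pi / 2 * \<bar>t\<bar>)"
    "\<And>t. \<bar>t\<bar> \<ge> 1 \<Longrightarrow> \<bar>t\<bar> powr (s + k - 1/2) * exp (- pi / 2 * \<bar>t\<bar>) \<le> K * norm (Gamma (Complex (s + k) t))"
    using norm_Gamma_vertical_right[of "s + k"] k by auto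
  define B where "B = (1 + \<bar>s\<bar> + real k) ^ k"
  have B: "B \<ge> 1" unfolding B_def by (rule one_le_power) simp
  have main: "norm (Gamma (Complex s t)) \<le> (K * B) * \<bar>t\<bar> powr (s - 1/2) * exp (- pi / 2 * \<bar>t\<bar>) \<and>
     \<bar>t\<bar> powr (s - 1/2) * exp (- pi / 2 * \<bar>t\<bar>) \<le> (K * B) * norm (Gamma (Complex s t))" if t: "\<bar>t\<bar> \<ge> 1" for t
  proof -
    define p where "p = norm (pochhammer (Complex s t) k)"
    have notin: "Complex s t \<notin> \<int>\<^sub>\<le>\<^sub>0" using t by (auto elim!: nonpos_Ints_cases simp: complex_eq_iff)
    have "Complex (s + k) t = Complex s t + of_nat k" by (simp add: complex_eq_iff)
    hence "Gamma (Complex (s + k) t) = pochhammer (Complex s t) k * Gamma (Complex s t)"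
      using pochhammer_Gamma[OF notin, of k] notin by (simp add: Gamma_eq_zero_iff)
    hence G: "norm (Gamma (Complex (s + k) t)) = p * norm (Gamma (Complex s t))" by (simp add: p_def norm_mult)
    have pprod: "p = (\<Prod>i<k. norm (Complex s t + of_nat i))"
      by (simp add: p_def pochhammer_prod lessThan_atLeast0 flip: prod_norm)
    have "(\<Prod>i<k. \<bar>t\<bar>) \<le> p" unfolding pprod
    proof (intro prod_mono conjI)
      fix i show "\<bar>t\<bar> \<le> norm (Complex s t + of_nat i)" using abs_Im_le_cmod[of "Complex s t + of_nat i"] by simp
    qed simp
    hence p1: "\<bar>t\<bar> ^ k \<le> p" by simp
    have "p \<le> (\<Prod>i<k. (1 + \<bar>s\<bar> + real k) * \<bar>t\<bar>)" unfolding pprod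
    proof (intro prod_mono conjI norm_ge_zero)
      fix i assume i: "i \<in> {..<k}"
      have "norm (Complex s t + of_nat i) \<le> \<bar>s + i\<bar> + \<bar>t\<bar>" using cmod_le[of "Complex s t + of_nat i"] by simp
      also have "\<dots> \<le> (\<bar>s\<bar> + k) * 1 + \<bar>t\<bar>" using i by auto
      also have "\<dots> \<le> (\<bar>s\<bar> + k) * \<bar>t\<bar> + \<bar>t\<bar>" using t by (intro add_mono mult_left_mono) auto
      finally show "norm (Complex s t + of_nat i) \<le> (1 + \<bar>s\<bar> + real k) * \<bar>t\<bar>" by (simp add: algebra_simps)
    qed
    hence p2: "p \<le> B * \<bar>t\<bar> ^ k" by (simp add: B_def power_mult_distrib)
    have tk: "\<bar>t\<bar> powr (s + k - 1/2) = \<bar>t\<bar> powr (s - 1/2) * \<bar>t\<bar> ^ k" "\<bar>t\<bar> ^ k > 0"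
      using t powr_add[of "\<bar>t\<bar>" "s - 1/2" k] by (auto simp: powr_realpow algebra_simps)
    define E where "E = exp (- pi / 2 * \<bar>t\<bar>)"
    have E: "E > 0" by (simp add: E_def)
    have "\<bar>t\<bar> ^ k * norm (Gamma (Complex s t)) \<le> p * norm (Gamma (Complex s t))"
      by (intro mult_right_mono p1) auto
    also have "\<dots> \<le> K * (\<bar>t\<bar> powr (s - 1/2) * \<bar>t\<bar> ^ k) * E" using K(2)[OF t] unfolding G tk E_def .
    finally have "\<bar>t\<bar> ^ k * norm (Gamma (Complex s t)) \<le> \<bar>t\<bar> ^ k * (K * \<bar>t\<bar> powr (s - 1/2) * E)" by (simp add: mult_ac)
    hence "norm (Gamma (Complex s t)) \<le> K * \<bar>t\<bar> powr (s - 1/2) * E" using tk(2) by (simp only: mult_le_cancel_left_pos)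
    also have "\<dots> \<le> (K * B) * \<bar>t\<bar> powr (s - 1/2) * E"
      using K(1) B E by (intro mult_right_mono) auto
    finally have 1: "norm (Gamma (Complex s t)) \<le> (K * B) * \<bar>t\<bar> powr (s - 1/2) * E" .
    have "\<bar>t\<bar> powr (s - 1/2) * \<bar>t\<bar> ^ k * E \<le> K * (p * norm (Gamma (Complex s t)))"
      using K(3)[OF t] unfolding G tk E_def .
    also have "\<dots> \<le> K * (B * \<bar>t\<bar> ^ k * norm (Gamma (Complex s t)))"
      using K(1) by (intro mult_left_mono mult_right_mono p2) auto
    finally have "\<bar>t\<bar> ^ k * (\<bar>t\<bar> powr (s - 1/2) * E) \<le> \<bar>t\<bar> ^ k * ((K * B) * norm (Gamma (Complex s t)))"
      by (simp add: mult_ac)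
    hence "\<bar>t\<bar> powr (s - 1/2) * E \<le> (K * B) * norm (Gamma (Complex s t))" using tk(2) by (simp only: mult_le_cancel_left_pos)
    with 1 show ?thesis by (simp add: E_def)
  qed
  have KB: "K * B > 0" using K B by simp
  show ?thesis by (rule that[OF KB]) (use main in auto)
qed

section \<open>Absolute convergence of the contour integral\<close>

text \<open>
  Products of functions add both exponents, so the exponents of \<open>\<chi>\<close> are sums over the triples.  These
  sums are \<open>\<Omega>\<close> and \<open>- \<pi> \<Delta> / 2\<close>.
\<close>

definition growth_bound :: "(real \<Rightarrow> complex) \<Rightarrow> real \<Rightarrow> real \<Rightarrow> bool" where
  "growth_bound h p q \<longleftrightarrow> (\<exists>M>0. \<forall>y. norm (h y) \<le> M * ((1 + \<bar>y\<bar>) powr p * exp (q * \<bar>y\<bar>)))"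

lemma growth_bound_mult:
  assumes "growth_bound h p q" "growth_bound k r s"
  shows "growth_bound (\<lambda>y. h y * k y) (p + r) (q + s)"
proof -
  obtain M where M: "M > 0" "\<And>y. norm (h y) \<le> M * ((1 + \<bar>y\<bar>) powr p * exp (q * \<bar>y\<bar>))"
    using assms(1) unfolding growth_bound_def by blast
  obtain N where N: "N > 0" "\<And>y. norm (k y) \<le> N * ((1 + \<bar>y\<bar>) powr r * exp (s * \<bar>y\<bar>))"
    using assms(2) unfolding growth_bound_def by blast
  have "norm (h y * k y) \<le> (M * N) * ((1 + \<bar>y\<bar>) powr (p + r) * exp ((q + s) * \<bar>y\<bar>))" for y
  proof -
    have "norm (h y * k y) \<le> (M * ((1 + \<bar>y\<bar>) powr p * exp (q * \<bar>y\<bar>))) * (N * ((1 + \<bar>y\<bar>) powr r * exp (s * \<bar>y\<bar>)))"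
      unfolding norm_mult using M N(1) by (intro mult_mono M N) auto
    also have "\<dots> = (M * N) * ((1 + \<bar>y\<bar>) powr (p + r) * exp ((q + s) * \<bar>y\<bar>))"
      by (simp add: powr_add mult_ac mult_exp_exp distrib_left)
    finally show ?thesis .
  qed
  thus ?thesis unfolding growth_bound_def using M N by (intro exI[of _ "M * N"]) auto
qed

lemma growth_bound_one: "growth_bound (\<lambda>_. 1) 0 0"
  unfolding growth_bound_def by (intro exI[of _ 1]) auto

lemma growth_bound_prod_list:
  assumes "\<And>x. x \<in> set xs \<Longrightarrow> growth_bound (F x) (p x) (q x)"
  shows "growth_bound (\<lambda>y. \<Prod>x\<leftarrow>xs. F x y) (\<Sum>x\<leftarrow>xs. p x) (\<Sum>x\<leftarrow>xs. q x)"
  using assms by (induction xs) (auto intro!: growth_bound_mult growth_bound_one)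

text \<open>
  Stirling's estimate is available only at distance at least 1 from the real axis; on the remaining
  compact part of the contour continuity takes its place.
\<close>

lemma growth_bound_compact_complement:
  assumes cont: "continuous_on UNIV h" and A: "compact A"
    and M: "\<And>y. y \<notin> A \<Longrightarrow> norm (h y) \<le> M * ((1 + \<bar>y\<bar>) powr p * exp (q * \<bar>y\<bar>))"
  shows "growth_bound h p q"
proof -
  define Q where "Q = (\<lambda>y. norm (h y) * ((1 + \<bar>y\<bar>) powr (-p) * exp (- q * \<bar>y\<bar>)))"
  have "continuous_on A Q" unfolding Q_def
    by (intro continuous_intros continuous_on_subset[OF cont]) auto
  hence "bounded (Q ` A)" using A compact_continuous_image compact_imp_bounded by blast
  then obtain B where B: "\<And>y. y \<in> A \<Longrightarrow> norm (Q y) \<le> B" unfolding bounded_iff by blast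
  have "norm (h y) \<le> (\<bar>M\<bar> + \<bar>B\<bar> + 1) * ((1 + \<bar>y\<bar>) powr p * exp (q * \<bar>y\<bar>))" for y
  proof -
    define w where "w = (1 + \<bar>y\<bar>) powr p * exp (q * \<bar>y\<bar>)"
    have w: "w > 0" by (simp add: w_def)
    have Qw: "norm (h y) = Q y * w" unfolding Q_def w_def by (simp add: powr_minus exp_minus field_simps)
    have "norm (h y) \<le> max M B * w"
    proof (cases "y \<in> A")
      case True
      thus ?thesis unfolding Qw using B[OF True] w by (intro mult_right_mono) auto
    next
      case False
      have "norm (h y) \<le> M * w" using M[OF False] by (simp add: w_def)
      also have "\<dots> \<le> max M B * w" using w by (intro mult_right_mono) auto
      finally show ?thesis .
    qed
    also have "\<dots> \<le> (\<bar>M\<bar> + \<bar>B\<bar> + 1) * w" using w by (intro mult_right_mono) auto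
    finally show ?thesis by (simp add: w_def)
  qed
  thus ?thesis unfolding growth_bound_def by (intro exI[of _ "\<bar>M\<bar> + \<bar>B\<bar> + 1"]) auto
qed

lemma powr_comparison:
  fixes a b K :: real
  assumes "K > 0" "a > 0" "b > 0" "a \<le> K * b" "b \<le> K * a"
  shows "a powr p \<le> K powr \<bar>p\<bar> * b powr p"
proof (cases "p \<ge> 0")
  case True
  hence "a powr p \<le> (K * b) powr p" using assms by (intro powr_mono2) auto
  thus ?thesis using True assms by (simp add: powr_mult)
next
  case False
  have "a powr p \<le> (b / K) powr p"
    using False assms by (intro powr_mono2') (auto simp: field_simps)
  also have "\<dots> = K powr \<bar>p\<bar> * b powr p" using False assms by (simp add: powr_divide powr_minus field_simps)
  finally show ?thesis .
qed

text \<open>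
  The argument \<open>c + C \<i> y\<close> of a Gamma factor has imaginary part \<open>Im c + C y\<close>, which has to be traded
  for \<open>y\<close>: by a factor in powers, but by an additive constant in the exponential.
\<close>

lemma axis_comparison:
  assumes C: "C \<noteq> 0"
  obtains K where "K \<ge> (1::real)"
    "\<And>y. \<bar>d + C * y\<bar> \<ge> 1 \<Longrightarrow> \<bar>d + C * y\<bar> \<le> K * (1 + \<bar>y\<bar>)"
    "\<And>y. \<bar>d + C * y\<bar> \<ge> 1 \<Longrightarrow> 1 + \<bar>y\<bar> \<le> K * \<bar>d + C * y\<bar>"
    "\<And>y. \<bar>C\<bar> * \<bar>y\<bar> \<le> \<bar>d + C * y\<bar> + K"
    "\<And>y. \<bar>d + C * y\<bar> \<le> \<bar>C\<bar> * \<bar>y\<bar> + K"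
proof -
  define K where "K = 1 + \<bar>d\<bar> + \<bar>C\<bar> + (1 + \<bar>d\<bar>) / \<bar>C\<bar>"
  have p: "(1 + \<bar>d\<bar>) / \<bar>C\<bar> \<ge> 0" by simp
  have K1: "K \<ge> 1" using p by (simp add: K_def)
  have tri: "\<bar>d + C * y\<bar> \<le> \<bar>d\<bar> + \<bar>C\<bar> * \<bar>y\<bar>" "\<bar>C\<bar> * \<bar>y\<bar> \<le> \<bar>d + C * y\<bar> + \<bar>d\<bar>" for y
    using abs_mult[of C y] by linarith+
  have Kd: "\<bar>d\<bar> \<le> K" using p by (simp add: K_def)
  show ?thesis
  proof (rule that[OF K1])
    fix y
    show "\<bar>C\<bar> * \<bar>y\<bar> \<le> \<bar>d + C * y\<bar> + K" "\<bar>d + C * y\<bar> \<le> \<bar>C\<bar> * \<bar>y\<bar> + K"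
      using tri[of y] Kd by linarith+
    have "\<bar>d\<bar> + \<bar>C\<bar> * \<bar>y\<bar> \<le> (\<bar>d\<bar> + \<bar>C\<bar>) * (1 + \<bar>y\<bar>)" by (simp add: algebra_simps)
    also have "\<dots> \<le> K * (1 + \<bar>y\<bar>)" using p by (intro mult_right_mono) (auto simp: K_def)
    finally show "\<bar>d + C * y\<bar> \<le> K * (1 + \<bar>y\<bar>)" using tri[of y] by linarith
    assume t: "\<bar>d + C * y\<bar> \<ge> 1"
    have "\<bar>y\<bar> = \<bar>C\<bar> * \<bar>y\<bar> / \<bar>C\<bar>" using C by simp
    also have "\<dots> \<le> (\<bar>d + C * y\<bar> + \<bar>d\<bar>) / \<bar>C\<bar>" using tri by (intro divide_right_mono) auto
    also have "\<dots> \<le> ((1 + \<bar>d\<bar>) * \<bar>d + C * y\<bar>) / \<bar>C\<bar>"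
    proof (intro divide_right_mono)
      have "\<bar>d\<bar> * 1 \<le> \<bar>d\<bar> * \<bar>d + C * y\<bar>" using t by (intro mult_left_mono) auto
      thus "\<bar>d + C * y\<bar> + \<bar>d\<bar> \<le> (1 + \<bar>d\<bar>) * \<bar>d + C * y\<bar>" by (simp add: algebra_simps)
    qed simp
    finally have "1 + \<bar>y\<bar> \<le> 1 * \<bar>d + C * y\<bar> + ((1 + \<bar>d\<bar>) / \<bar>C\<bar>) * \<bar>d + C * y\<bar>" using t by simp
    also have "\<dots> = (1 + (1 + \<bar>d\<bar>) / \<bar>C\<bar>) * \<bar>d + C * y\<bar>" by (simp only: distrib_right)
    also have "\<dots> \<le> K * \<bar>d + C * y\<bar>" by (intro mult_right_mono) (auto simp: K_def)
    finally show "1 + \<bar>y\<bar> \<le> K * \<bar>d + C * y\<bar>" .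
  qed
qed

lemma compact_near_axis_zero:
  assumes "C \<noteq> 0"
  shows "compact {y. \<bar>d + C * y\<bar> \<le> (1::real)}"
proof -
  obtain K where K: "\<And>y. \<bar>C\<bar> * \<bar>y\<bar> \<le> \<bar>d + C * y\<bar> + K" using axis_comparison[OF assms, of d] by metis
  have "\<bar>y\<bar> \<le> (1 + K) / \<bar>C\<bar>" if "\<bar>d + C * y\<bar> \<le> 1" for y
    using K[of y] that assms by (simp add: field_simps)
  hence "bounded {y. \<bar>d + C * y\<bar> \<le> 1}" unfolding bounded_iff by auto
  moreover have "closed {y. \<bar>d + C * y\<bar> \<le> 1}"
    by (intro closed_Collect_le continuous_intros)
  ultimately show ?thesis by (simp add: compact_eq_bounded_closed)
qed

lemma growth_bound_Gamma:
  assumes C: "C \<noteq> 0" and np: "\<And>y. c + of_real C * (\<i> * of_real y) \<notin> \<int>\<^sub>\<le>\<^sub>0"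
  shows "growth_bound (\<lambda>y. Gamma (c + of_real C * (\<i> * of_real y))) (Re c - 1/2) (- (pi / 2 * \<bar>C\<bar>))"
proof -
  obtain M where M: "M > 0"
    "\<And>t. \<bar>t\<bar> \<ge> 1 \<Longrightarrow> norm (Gamma (Complex (Re c) t)) \<le> M * \<bar>t\<bar> powr (Re c - 1/2) * exp (- pi / 2 * \<bar>t\<bar>)"
    using norm_Gamma_vertical[of "Re c"] by metis
  obtain K where K: "K \<ge> (1::real)"
    "\<And>y. \<bar>Im c + C * y\<bar> \<ge> 1 \<Longrightarrow> \<bar>Im c + C * y\<bar> \<le> K * (1 + \<bar>y\<bar>)"
    "\<And>y. \<bar>Im c + C * y\<bar> \<ge> 1 \<Longrightarrow> 1 + \<bar>y\<bar> \<le> K * \<bar>Im c + C * y\<bar>"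
    "\<And>y. \<bar>C\<bar> * \<bar>y\<bar> \<le> \<bar>Im c + C * y\<bar> + K"
    using axis_comparison[OF C, of "Im c"] by metis
  show ?thesis
  proof (rule growth_bound_compact_complement[OF _ compact_near_axis_zero[OF C, of "Im c"]])
    show "continuous_on UNIV (\<lambda>y. Gamma (c + of_real C * (\<i> * of_real y)))"
      using np by (intro continuous_on_Gamma[THEN continuous_on_compose2[where s = UNIV and t = "- \<int>\<^sub>\<le>\<^sub>0"]] continuous_intros) auto
    fix y assume "y \<notin> {y. \<bar>Im c + C * y\<bar> \<le> 1}"
    hence t: "\<bar>Im c + C * y\<bar> \<ge> 1" by simp
    define t where "t = Im c + C * y"
    have eq: "c + of_real C * (\<i> * of_real y) = Complex (Re c) t" by (simp add: complex_eq_iff t_def)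
    have "norm (Gamma (Complex (Re c) t)) \<le> M * \<bar>t\<bar> powr (Re c - 1/2) * exp (- pi / 2 * \<bar>t\<bar>)"
      by (rule M) (use t in \<open>simp add: t_def\<close>)
    also have "\<dots> \<le> M * (K powr \<bar>Re c - 1/2\<bar> * (1 + \<bar>y\<bar>) powr (Re c - 1/2)) * exp (pi / 2 * K + (- (pi / 2 * \<bar>C\<bar>)) * \<bar>y\<bar>)"
    proof (intro mult_mono mult_left_mono powr_comparison)
      have "pi / 2 * (\<bar>C\<bar> * \<bar>y\<bar>) \<le> pi / 2 * (\<bar>t\<bar> + K)" using K(4)[of y] by (intro mult_left_mono) (auto simp: t_def)
      thus "exp (- pi / 2 * \<bar>t\<bar>) \<le> exp (pi / 2 * K + (- (pi / 2 * \<bar>C\<bar>)) * \<bar>y\<bar>)" by (simp add: algebra_simps)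
    qed (use t K M in \<open>auto simp: t_def\<close>)
    also have "\<dots> = (M * K powr \<bar>Re c - 1/2\<bar> * exp (pi / 2 * K)) * ((1 + \<bar>y\<bar>) powr (Re c - 1/2) * exp (- (pi / 2 * \<bar>C\<bar>) * \<bar>y\<bar>))"
      by (simp only: exp_add mult_ac)
    finally show "norm (Gamma (c + of_real C * (\<i> * of_real y))) \<le> (M * K powr \<bar>Re c - 1/2\<bar> * exp (pi / 2 * K)) * ((1 + \<bar>y\<bar>) powr (Re c - 1/2) * exp (- (pi / 2 * \<bar>C\<bar>) * \<bar>y\<bar>))"
      unfolding eq .
  qed
qed

lemma growth_bound_rGamma:
  assumes C: "C \<noteq> 0"
  shows "growth_bound (\<lambda>y. rGamma (c + of_real C * (\<i> * of_real y))) (- (Re c - 1/2)) (pi / 2 * \<bar>C\<bar>)"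
proof -
  obtain M where M: "M > 0"
    "\<And>t. \<bar>t\<bar> \<ge> 1 \<Longrightarrow> \<bar>t\<bar> powr (Re c - 1/2) * exp (- pi / 2 * \<bar>t\<bar>) \<le> M * norm (Gamma (Complex (Re c) t))"
    using norm_Gamma_vertical[of "Re c"] by metis
  obtain K where K: "K \<ge> (1::real)"
    "\<And>y. \<bar>Im c + C * y\<bar> \<ge> 1 \<Longrightarrow> \<bar>Im c + C * y\<bar> \<le> K * (1 + \<bar>y\<bar>)"
    "\<And>y. \<bar>Im c + C * y\<bar> \<ge> 1 \<Longrightarrow> 1 + \<bar>y\<bar> \<le> K * \<bar>Im c + C * y\<bar>"
    "\<And>y. \<bar>Im c + C * y\<bar> \<le> \<bar>C\<bar> * \<bar>y\<bar> + K"
    using axis_comparison[OF C, of "Im c"] by metis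
  let ?p = "- (Re c - 1/2)"
  show ?thesis
  proof (rule growth_bound_compact_complement[OF _ compact_near_axis_zero[OF C, of "Im c"]])
    show "continuous_on UNIV (\<lambda>y. rGamma (c + of_real C * (\<i> * of_real y)))"
      by (intro continuous_on_rGamma[THEN continuous_on_compose2[where s = UNIV and t = UNIV]] continuous_intros) auto
    fix y assume "y \<notin> {y. \<bar>Im c + C * y\<bar> \<le> 1}"
    hence t: "\<bar>Im c + C * y\<bar> \<ge> 1" by simp
    define t where "t = Im c + C * y"
    have t1: "\<bar>t\<bar> \<ge> 1" using t by (simp add: t_def)
    have eq: "c + of_real C * (\<i> * of_real y) = Complex (Re c) t" by (simp add: complex_eq_iff t_def)
    have "Complex (Re c) t \<notin> \<int>\<^sub>\<le>\<^sub>0" using t1 by (auto elim!: nonpos_Ints_cases simp: complex_eq_iff)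
    hence nz: "norm (Gamma (Complex (Re c) t)) > 0" by (simp add: Gamma_eq_zero_iff)
    have "norm (rGamma (Complex (Re c) t)) = 1 / norm (Gamma (Complex (Re c) t))"
      by (simp only: rGamma_inverse_Gamma norm_inverse) (simp only: inverse_eq_divide)
    also have "\<dots> \<le> M / (\<bar>t\<bar> powr (Re c - 1/2) * exp (- pi / 2 * \<bar>t\<bar>))"
    proof -
      have "0 < \<bar>t\<bar> powr (Re c - 1/2) * exp (- pi / 2 * \<bar>t\<bar>)" using t1 by simp
      thus ?thesis using M(2)[OF t1] nz by (simp add: divide_simps mult.commute)
    qed
    also have "\<dots> = M * \<bar>t\<bar> powr ?p * exp (pi / 2 * \<bar>t\<bar>)"
      by (simp only: powr_minus exp_minus minus_mult_left[symmetric] minus_divide_left[symmetric] divide_inverse inverse_mult_distrib inverse_inverse_eq mult.assoc)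
    also have "\<dots> \<le> M * (K powr \<bar>?p\<bar> * (1 + \<bar>y\<bar>) powr ?p) * exp (pi / 2 * K + (pi / 2 * \<bar>C\<bar>) * \<bar>y\<bar>)"
    proof (intro mult_mono mult_left_mono powr_comparison)
      have "pi / 2 * \<bar>t\<bar> \<le> pi / 2 * (\<bar>C\<bar> * \<bar>y\<bar> + K)" using K(4)[of y] by (intro mult_left_mono) (auto simp: t_def)
      thus "exp (pi / 2 * \<bar>t\<bar>) \<le> exp (pi / 2 * K + (pi / 2 * \<bar>C\<bar>) * \<bar>y\<bar>)" by (simp add: algebra_simps)
    qed (use t K M in \<open>auto simp: t_def\<close>)
    also have "\<dots> = (M * K powr \<bar>?p\<bar> * exp (pi / 2 * K)) * ((1 + \<bar>y\<bar>) powr ?p * exp ((pi / 2 * \<bar>C\<bar>) * \<bar>y\<bar>))"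
      by (simp only: exp_add mult_ac)
    finally show "norm (rGamma (c + of_real C * (\<i> * of_real y))) \<le> (M * K powr \<bar>?p\<bar> * exp (pi / 2 * K)) * ((1 + \<bar>y\<bar>) powr ?p * exp ((pi / 2 * \<bar>C\<bar>) * \<bar>y\<bar>))"
      unfolding eq .
  qed
qed

lemma growth_bound_powr:
  assumes "growth_bound h p q" "\<kappa> > 0" "\<And>y. norm (k y) \<le> norm (h y) powr \<kappa>"
  shows "growth_bound k (\<kappa> * p) (\<kappa> * q)"
proof -
  obtain M where M: "M > 0" "\<And>y. norm (h y) \<le> M * ((1 + \<bar>y\<bar>) powr p * exp (q * \<bar>y\<bar>))"
    using assms(1) unfolding growth_bound_def by blast
  have "norm (k y) \<le> M powr \<kappa> * ((1 + \<bar>y\<bar>) powr (\<kappa> * p) * exp ((\<kappa> * q) * \<bar>y\<bar>))" for y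
  proof -
    have "norm (k y) \<le> norm (h y) powr \<kappa>" by (rule assms)
    also have "\<dots> \<le> (M * ((1 + \<bar>y\<bar>) powr p * exp (q * \<bar>y\<bar>))) powr \<kappa>"
      using assms(2) by (intro powr_mono2 M) auto
    also have "\<dots> = M powr \<kappa> * ((1 + \<bar>y\<bar>) powr (\<kappa> * p) * exp ((\<kappa> * q) * \<bar>y\<bar>))"
    proof -
      have "exp (q * \<bar>y\<bar>) powr \<kappa> = exp ((\<kappa> * q) * \<bar>y\<bar>)" by (simp add: powr_def mult_ac)
      thus ?thesis using M(1) by (simp add: powr_mult powr_powr mult.commute)
    qed
    finally show ?thesis .
  qed
  thus ?thesis unfolding growth_bound_def using M by (intro exI[of _ "M powr \<kappa>"]) auto
qed

context
  fixes G :: "triple \<Rightarrow> complex \<Rightarrow> complex"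
  assumes branch: "Gamma_power_branch G"
begin

lemma branch_cases:
  obtains L where
    "continuous_on {s. Re s = 0 \<and> c + of_real C * s \<notin> \<int>\<^sub>\<le>\<^sub>0} L"
    "\<And>s. Re s = 0 \<Longrightarrow> c + of_real C * s \<in> \<int>\<^sub>\<le>\<^sub>0 \<Longrightarrow> G (c, C, \<kappa>) s = 0"
    "\<And>s. Re s = 0 \<Longrightarrow> c + of_real C * s \<notin> \<int>\<^sub>\<le>\<^sub>0 \<Longrightarrow> exp (L s) = Gamma (c + of_real C * s)"
    "\<And>s. Re s = 0 \<Longrightarrow> c + of_real C * s \<notin> \<int>\<^sub>\<le>\<^sub>0 \<Longrightarrow> G (c, C, \<kappa>) s = exp (of_real \<kappa> * L s)"
proof -
  obtain L where "continuous_on {s. Re s = 0 \<and> c + of_real C * s \<notin> \<int>\<^sub>\<le>\<^sub>0} L"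
    and L: "\<forall>s. Re s = 0 \<longrightarrow>
           (if c + of_real C * s \<in> \<int>\<^sub>\<le>\<^sub>0 then G (c, C, \<kappa>) s = 0
            else exp (L s) = Gamma (c + of_real C * s) \<and> G (c, C, \<kappa>) s = exp (of_real \<kappa> * L s))"
    using branch unfolding Gamma_power_branch_def by blast
  thus ?thesis by (intro that[of L]) auto
qed

lemma branch_one:
  assumes "Re s = 0"
  shows "G (c, C, 1) s = Gamma (c + of_real C * s)"
proof -
  obtain L where L: 
    "\<And>s. Re s = 0 \<Longrightarrow> c + of_real C * s \<in> \<int>\<^sub>\<le>\<^sub>0 \<Longrightarrow> G (c, C, 1) s = 0"
    "\<And>s. Re s = 0 \<Longrightarrow> c + of_real C * s \<notin> \<int>\<^sub>\<le>\<^sub>0 \<Longrightarrow> exp (L s) = Gamma (c + of_real C * s)"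
    "\<And>s. Re s = 0 \<Longrightarrow> c + of_real C * s \<notin> \<int>\<^sub>\<le>\<^sub>0 \<Longrightarrow> G (c, C, 1) s = exp (of_real 1 * L s)"
    by (rule branch_cases[of c C 1]) (auto intro: that)
  show ?thesis
  proof (cases "c + of_real C * s \<in> \<int>\<^sub>\<le>\<^sub>0")
    case True
    thus ?thesis using L(1)[OF assms] by (simp add: Gamma_nonpos_Int)
  next
    case False
    thus ?thesis using L(2,3)[OF assms] by simp
  qed
qed

text \<open>
  The modulus of a power does not depend on the branch.  At a pole \<open>Gamma\<close>, its reciprocal and
  \<open>1 / G\<close> all have the value 0, which is \<open>0 powr \<kappa>\<close> for \<open>\<kappa> > 0\<close>; for \<open>1 / G\<close> this is also the
  limit, so the bound for the reciprocal Gamma function applies without exception.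
\<close>

lemma norm_branch:
  assumes "Re s = 0" "\<kappa> > 0"
  shows "norm (G (c, C, \<kappa>) s) = norm (Gamma (c + of_real C * s)) powr \<kappa>"
    and "norm (1 / G (c, C, \<kappa>) s) = norm (rGamma (c + of_real C * s)) powr \<kappa>"
proof -
  obtain L where L: 
    "\<And>s. Re s = 0 \<Longrightarrow> c + of_real C * s \<in> \<int>\<^sub>\<le>\<^sub>0 \<Longrightarrow> G (c, C, \<kappa>) s = 0"
    "\<And>s. Re s = 0 \<Longrightarrow> c + of_real C * s \<notin> \<int>\<^sub>\<le>\<^sub>0 \<Longrightarrow> exp (L s) = Gamma (c + of_real C * s)"
    "\<And>s. Re s = 0 \<Longrightarrow> c + of_real C * s \<notin> \<int>\<^sub>\<le>\<^sub>0 \<Longrightarrow> G (c, C, \<kappa>) s = exp (of_real \<kappa> * L s)"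
    by (rule branch_cases[of c C \<kappa>]) (auto intro: that)
  show n: "norm (G (c, C, \<kappa>) s) = norm (Gamma (c + of_real C * s)) powr \<kappa>"
  proof (cases "c + of_real C * s \<in> \<int>\<^sub>\<le>\<^sub>0")
    case True
    thus ?thesis using L(1)[OF assms(1)] assms by (simp add: Gamma_nonpos_Int)
  next
    case False
    have "norm (Gamma (c + of_real C * s)) = exp (Re (L s))" using L(2)[OF assms(1) False] by (metis norm_exp_eq_Re)
    thus ?thesis using L(3)[OF assms(1) False] by (simp add: powr_def)
  qed
  show "norm (1 / G (c, C, \<kappa>) s) = norm (rGamma (c + of_real C * s)) powr \<kappa>"
    unfolding norm_divide n rGamma_inverse_Gamma norm_inverse
    by (simp add: inverse_eq_divide powr_divide)
qed

text \<open>
  Along the axis \<open>G t\<close> is continuous off the closed set of poles and vanishes on it.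
\<close>

lemma branch_measurable: "(\<lambda>y. G t (\<i> * of_real y)) \<in> borel_measurable borel"
proof -
  obtain c C \<kappa> where t: "t = (c, C, \<kappa>)" by (cases t) auto
  obtain L where L: 
    "continuous_on {s. Re s = 0 \<and> c + of_real C * s \<notin> \<int>\<^sub>\<le>\<^sub>0} L"
    "\<And>s. Re s = 0 \<Longrightarrow> c + of_real C * s \<in> \<int>\<^sub>\<le>\<^sub>0 \<Longrightarrow> G (c, C, \<kappa>) s = 0"
    "\<And>s. Re s = 0 \<Longrightarrow> c + of_real C * s \<notin> \<int>\<^sub>\<le>\<^sub>0 \<Longrightarrow> G (c, C, \<kappa>) s = exp (of_real \<kappa> * L s)"
    by (rule branch_cases[of c C \<kappa>]) (auto intro: that)
  define S where "S = {y::real. c + of_real C * (\<i> * of_real y) \<notin> \<int>\<^sub>\<le>\<^sub>0}"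
  have "open S"
  proof -
    have "S = (\<lambda>y::real. c + of_real C * (\<i> * of_real y)) -` (- \<int>\<^sub>\<le>\<^sub>0)" by (auto simp: S_def)
    thus ?thesis by (simp only:) (intro open_vimage continuous_intros open_Compl closed_nonpos_Ints)
  qed
  moreover have "continuous_on S (\<lambda>y. exp (of_real \<kappa> * L (\<i> * of_real y)))"
    by (intro continuous_intros continuous_on_compose2[OF L(1)]) (auto simp: S_def)
  ultimately have "(\<lambda>y. indicator S y *\<^sub>R exp (of_real \<kappa> * L (\<i> * of_real y))) \<in> borel_measurable borel"
    by (intro borel_measurable_continuous_on_indicator) auto
  also have "(\<lambda>y. indicator S y *\<^sub>R exp (of_real \<kappa> * L (\<i> * of_real y))) = (\<lambda>y. G t (\<i> * of_real y))"
    by (rule ext) (auto simp: t S_def L(2,3) indicator_def)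
  finally show ?thesis .
qed

lemma prod_list_measurable:
  fixes F :: "'a \<Rightarrow> real \<Rightarrow> complex"
  assumes "\<And>x. F x \<in> borel_measurable borel"
  shows "(\<lambda>y. \<Prod>x\<leftarrow>xs. F x y) \<in> borel_measurable borel"
  using assms by (induction xs) auto

lemma I_chi_measurable: "(\<lambda>y. I_chi G m n up lo (\<i> * of_real y)) \<in> borel_measurable borel"
  unfolding I_chi_def
  by (intro borel_measurable_divide borel_measurable_times prod_list_measurable)
     (auto simp: case_prod_unfold intro!: branch_measurable)

lemma prod_list_inverse: "1 / (\<Prod>x\<leftarrow>xs. F x) = (\<Prod>x\<leftarrow>xs. 1 / (F x :: complex))"
proof (induction xs)
  case (Cons a xs)
  show ?case by (simp add: Cons[symmetric])
qed simp

lemma I_chi_growth: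
  assumes params: "I_params m n up lo" and sep: "I_separated m n up lo"
  shows "growth_bound (\<lambda>y. I_chi G m n up lo (\<i> * of_real y)) (I_Omega up lo) (- (pi / 2 * I_Delta m n up lo))"
proof -
  have pu: "A > 0 \<and> \<kappa> > 0" if "(a, A, \<kappa>) \<in> set (take n up) \<union> set (drop n up)" for a A \<kappa>
  proof -
    have "(a, A, \<kappa>) \<in> set up" using that by (auto dest: in_set_takeD in_set_dropD)
    thus ?thesis using params unfolding I_params_def by blast
  qed
  have pl: "A > 0 \<and> \<kappa> > 0" if "(a, A, \<kappa>) \<in> set (take m lo) \<union> set (drop m lo)" for a A \<kappa>
  proof -
    have "(a, A, \<kappa>) \<in> set lo" using that by (auto dest: in_set_takeD in_set_dropD)
    thus ?thesis using params unfolding I_params_def by blast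
  qed
  have axis: "Re (\<i> * of_real y) = 0" for y :: real by simp
  have 1: "growth_bound (\<lambda>y. \<Prod>(b, B, \<kappa>)\<leftarrow>take m lo. G (b, B, \<kappa>) (\<i> * of_real y))
     (\<Sum>(b, B, \<kappa>)\<leftarrow>take m lo. \<kappa> * (Re b - 1/2)) (\<Sum>(b, B, \<kappa>)\<leftarrow>take m lo. \<kappa> * (- (pi / 2 * \<bar>B\<bar>)))"
    unfolding case_prod_unfold
  proof (rule growth_bound_prod_list)
    fix t assume t: "t \<in> set (take m lo)"
    obtain b B \<kappa> where tb: "t = (b, B, \<kappa>)" by (cases t) auto
    have p: "B > 0" "\<kappa> > 0" using pl t tb by auto
    have np: "b + of_real B * (\<i> * of_real y) \<notin> \<int>\<^sub>\<le>\<^sub>0" for y :: real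
      using sep t tb axis[of y] unfolding I_separated_def by fastforce
    show "growth_bound (\<lambda>y. G (fst t, fst (snd t), snd (snd t)) (\<i> * of_real y))
         (snd (snd t) * (Re (fst t) - 1 / 2)) (snd (snd t) * - (pi / 2 * \<bar>fst (snd t)\<bar>))"
      unfolding tb fst_conv snd_conv
      by (rule growth_bound_powr[OF growth_bound_Gamma]) (use p np in \<open>auto simp: norm_branch\<close>)
  qed
  have 2: "growth_bound (\<lambda>y. \<Prod>(a, A, \<kappa>)\<leftarrow>take n up. G (1 - a, -A, \<kappa>) (\<i> * of_real y))
     (\<Sum>(a, A, \<kappa>)\<leftarrow>take n up. \<kappa> * (Re (1 - a) - 1/2)) (\<Sum>(a, A, \<kappa>)\<leftarrow>take n up. \<kappa> * (- (pi / 2 * \<bar>- A\<bar>)))"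
    unfolding case_prod_unfold
  proof (rule growth_bound_prod_list)
    fix t assume t: "t \<in> set (take n up)"
    obtain b B \<kappa> where tb: "t = (b, B, \<kappa>)" by (cases t) auto
    have p: "B > 0" "\<kappa> > 0" using pu t tb by auto
    have "1 - b - of_real B * (\<i> * of_real y) \<notin> \<int>\<^sub>\<le>\<^sub>0" for y :: real
      using sep t tb axis[of y] unfolding I_separated_def by fastforce
    hence np: "1 - b + of_real (- B) * (\<i> * of_real y) \<notin> \<int>\<^sub>\<le>\<^sub>0" for y :: real
      by simp
    show "growth_bound (\<lambda>y. G (1 - fst t, - fst (snd t), snd (snd t)) (\<i> * of_real y))
         (snd (snd t) * (Re (1 - fst t) - 1 / 2)) (snd (snd t) * - (pi / 2 * \<bar>- fst (snd t)\<bar>))"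
      unfolding tb fst_conv snd_conv
      by (rule growth_bound_powr[OF growth_bound_Gamma]) (use p np in \<open>auto simp: norm_branch\<close>)
  qed
  have 3: "growth_bound (\<lambda>y. \<Prod>(b, B, \<kappa>)\<leftarrow>drop m lo. 1 / G (1 - b, - B, \<kappa>) (\<i> * of_real y))
     (\<Sum>(b, B, \<kappa>)\<leftarrow>drop m lo. \<kappa> * (- (Re (1 - b) - 1/2))) (\<Sum>(b, B, \<kappa>)\<leftarrow>drop m lo. \<kappa> * (pi / 2 * \<bar>- B\<bar>))"
    unfolding case_prod_unfold
  proof (rule growth_bound_prod_list)
    fix t assume t: "t \<in> set (drop m lo)"
    obtain b B \<kappa> where tb: "t = (b, B, \<kappa>)" by (cases t) auto
    have p: "B > 0" "\<kappa> > 0" using pl t tb by auto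
    show "growth_bound (\<lambda>y. 1 / G (1 - fst t, - fst (snd t), snd (snd t)) (\<i> * of_real y))
         (snd (snd t) * - (Re (1 - fst t) - 1 / 2)) (snd (snd t) * (pi / 2 * \<bar>- fst (snd t)\<bar>))"
      unfolding tb fst_conv snd_conv
      by (rule growth_bound_powr[OF growth_bound_rGamma]) (use p norm_branch(2)[OF axis] in auto)
  qed
  have 4: "growth_bound (\<lambda>y. \<Prod>(a, A, \<kappa>)\<leftarrow>drop n up. 1 / G (a, A, \<kappa>) (\<i> * of_real y))
     (\<Sum>(a, A, \<kappa>)\<leftarrow>drop n up. \<kappa> * (- (Re a - 1/2))) (\<Sum>(a, A, \<kappa>)\<leftarrow>drop n up. \<kappa> * (pi / 2 * \<bar>A\<bar>))"
    unfolding case_prod_unfold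
  proof (rule growth_bound_prod_list)
    fix t assume t: "t \<in> set (drop n up)"
    obtain b B \<kappa> where tb: "t = (b, B, \<kappa>)" by (cases t) auto
    have p: "B > 0" "\<kappa> > 0" using pu t tb by auto
    show "growth_bound (\<lambda>y. 1 / G (fst t, fst (snd t), snd (snd t)) (\<i> * of_real y))
         (snd (snd t) * - (Re (fst t) - 1 / 2)) (snd (snd t) * (pi / 2 * \<bar>fst (snd t)\<bar>))"
      unfolding tb fst_conv snd_conv
      by (rule growth_bound_powr[OF growth_bound_rGamma]) (use p norm_branch(2)[OF axis] in auto)
  qed
  have chi: "I_chi G m n up lo s = ((\<Prod>(b, B, \<kappa>)\<leftarrow>take m lo. G (b, B, \<kappa>) s) * (\<Prod>(a, A, \<kappa>)\<leftarrow>take n up. G (1 - a, -A, \<kappa>) s)) *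
     ((\<Prod>(b, B, \<kappa>)\<leftarrow>drop m lo. 1 / G (1 - b, -B, \<kappa>) s) * (\<Prod>(a, A, \<kappa>)\<leftarrow>drop n up. 1 / G (a, A, \<kappa>) s))" for s
    unfolding I_chi_def case_prod_unfold prod_list_inverse[symmetric] by simp
  have abs_sum: "(\<Sum>(b, B, \<kappa>)\<leftarrow>xs. \<kappa> * (c * \<bar>B\<bar>)) = c * (\<Sum>(b, B, \<kappa>)\<leftarrow>xs. \<kappa> * B)"
    if "\<And>a A \<kappa>. (a, A, \<kappa>) \<in> set xs \<Longrightarrow> A > 0 \<and> \<kappa> > 0" for xs :: "triple list" and c
    using that by (induction xs) (fastforce simp: algebra_simps)+
  have sum_split: "(\<Sum>x\<leftarrow>take k xs. h x) + (\<Sum>x\<leftarrow>drop k xs. h x) = (\<Sum>x\<leftarrow>xs. h x)"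
    for k and xs :: "triple list" and h :: "triple \<Rightarrow> real"
    by (metis append_take_drop_id map_append sum_list_append)
  have neg: "(\<Sum>(b, B, \<kappa>)\<leftarrow>xs. (1/2 - Re b) * \<kappa>) = - (\<Sum>(b, B, \<kappa>)\<leftarrow>xs. \<kappa> * (Re b - 1/2))" for xs :: "triple list"
    by (induction xs) (auto simp: algebra_simps)
  have p: "(\<Sum>(b, B, \<kappa>)\<leftarrow>take m lo. \<kappa> * (Re b - 1/2)) + (\<Sum>(a, A, \<kappa>)\<leftarrow>take n up. \<kappa> * (Re (1 - a) - 1/2)) +
     ((\<Sum>(b, B, \<kappa>)\<leftarrow>drop m lo. \<kappa> * (- (Re (1 - b) - 1/2))) + (\<Sum>(a, A, \<kappa>)\<leftarrow>drop n up. \<kappa> * (- (Re a - 1/2)))) = I_Omega up lo"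
  proof -
    have a: "(\<Sum>(a, A, \<kappa>)\<leftarrow>xs. \<kappa> * (Re (1 - a) - 1/2)) = (\<Sum>(a, A, \<kappa>)\<leftarrow>xs. (1/2 - Re a) * \<kappa>)"
       "(\<Sum>(a, A, \<kappa>)\<leftarrow>xs. \<kappa> * (- (Re a - 1/2))) = (\<Sum>(a, A, \<kappa>)\<leftarrow>xs. (1/2 - Re a) * \<kappa>)"
       "(\<Sum>(b, B, \<kappa>)\<leftarrow>xs. \<kappa> * (- (Re (1 - b) - 1/2))) = (\<Sum>(b, B, \<kappa>)\<leftarrow>xs. \<kappa> * (Re b - 1/2))"
       for xs :: "triple list"
      by (induction xs) (auto simp: algebra_simps)
    show ?thesis unfolding a I_Omega_def neg
      using sum_split[where k = m and h = "\<lambda>(b, B, \<kappa>). \<kappa> * (Re b - 1/2)" and xs = lo]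
        sum_split[where k = n and h = "\<lambda>(b, B, \<kappa>). \<kappa> * (Re b - 1/2)" and xs = up]
      by linarith
  qed
  have q: "(\<Sum>(b, B, \<kappa>)\<leftarrow>take m lo. \<kappa> * (- (pi / 2 * \<bar>B\<bar>))) + (\<Sum>(a, A, \<kappa>)\<leftarrow>take n up. \<kappa> * (- (pi / 2 * \<bar>- A\<bar>))) +
     ((\<Sum>(b, B, \<kappa>)\<leftarrow>drop m lo. \<kappa> * (pi / 2 * \<bar>- B\<bar>)) + (\<Sum>(a, A, \<kappa>)\<leftarrow>drop n up. \<kappa> * (pi / 2 * \<bar>A\<bar>))) = - (pi / 2 * I_Delta m n up lo)"
  proof -
    have "(\<Sum>(b, B, \<kappa>)\<leftarrow>take m lo. \<kappa> * (- (pi / 2) * \<bar>B\<bar>)) = - (pi / 2) * (\<Sum>(b, B, \<kappa>)\<leftarrow>take m lo. \<kappa> * B)"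
         "(\<Sum>(b, B, \<kappa>)\<leftarrow>take n up. \<kappa> * (- (pi / 2) * \<bar>B\<bar>)) = - (pi / 2) * (\<Sum>(b, B, \<kappa>)\<leftarrow>take n up. \<kappa> * B)"
         "(\<Sum>(b, B, \<kappa>)\<leftarrow>drop m lo. \<kappa> * ((pi / 2) * \<bar>B\<bar>)) = (pi / 2) * (\<Sum>(b, B, \<kappa>)\<leftarrow>drop m lo. \<kappa> * B)"
         "(\<Sum>(b, B, \<kappa>)\<leftarrow>drop n up. \<kappa> * ((pi / 2) * \<bar>B\<bar>)) = (pi / 2) * (\<Sum>(b, B, \<kappa>)\<leftarrow>drop n up. \<kappa> * B)"
      by (rule abs_sum; use pu pl in blast)+
    thus ?thesis unfolding I_Delta_def by (simp add: algebra_simps)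
  qed
  show ?thesis unfolding chi using growth_bound_mult[OF growth_bound_mult[OF 1 2] growth_bound_mult[OF 3 4]]
    unfolding p q .
qed

end

lemma integrable_powr_one_plus_abs:
  assumes s: "s < -1"
  shows "integrable lborel (\<lambda>y::real. (1 + \<bar>y\<bar>) powr s)"
proof -
  define f where "f = (\<lambda>x::real. indicator {1..} x * x powr s)"
  have "(\<lambda>x. x powr s) integrable_on {1..}" using has_integral_powr_to_inf[of s 1] s by (auto simp: integrable_on_def)
  hence "(\<lambda>x. x powr s) absolutely_integrable_on {1..}" by (intro nonnegative_absolutely_integrable_1) auto
  hence "integrable lebesgue f" by (simp add: set_integrable_def f_def)
  moreover have "f \<in> borel_measurable borel" unfolding f_def by measurable
  ultimately have f: "integrable lborel f" by (simp add: integrable_completion)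
  have "integrable lborel (\<lambda>y. f (1 + 1 * y) + f (1 + (-1) * y))"
    by (intro Bochner_Integration.integrable_add lborel_integrable_real_affine f) auto
  thus ?thesis
  proof (rule Bochner_Integration.integrable_bound)
    show "AE y in lborel. norm ((1 + \<bar>y\<bar>) powr s) \<le> norm (f (1 + 1 * y) + f (1 + (- 1) * y))"
      by (intro AE_I2) (auto simp: f_def indicator_def abs_if)
  qed simp
qed

lemma growth_bound_integrable:
  assumes g: "growth_bound h p q" and h: "h \<in> borel_measurable borel"
    and c: "q < 0 \<or> (q = 0 \<and> p + s < -1)"
  shows "integrable lborel (\<lambda>y. of_real ((1 + \<bar>y\<bar>) powr s) * h y)"
proof -
  obtain M where M: "M > 0" "\<And>y. norm (h y) \<le> M * ((1 + \<bar>y\<bar>) powr p * exp (q * \<bar>y\<bar>))"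
    using assms(1) unfolding growth_bound_def by blast
  obtain r K where r: "r < -1" and K: "\<And>y. (1 + \<bar>y\<bar>) powr (p + s) * exp (q * \<bar>y\<bar>) \<le> K * (1 + \<bar>y\<bar>) powr r"
  proof (cases "q < 0")
    case True
    have "((\<lambda>x. x powr (p + s + 2) * exp (q * (x - 1))) \<longlongrightarrow> 0) at_top"
      using True by real_asymp
    then have "eventually (\<lambda>x. x powr (p + s + 2) * exp (q * (x - 1)) < 1) at_top"
      by (rule order_tendstoD) simp
    then obtain X where X: "\<And>x. x \<ge> X \<Longrightarrow> x powr (p + s + 2) * exp (q * (x - 1)) < 1"
      unfolding eventually_at_top_linorder by blast
    have "continuous_on {1..max 1 X} (\<lambda>x. x powr (p + s + 2) * exp (q * (x - 1)))"
      by (intro continuous_intros) auto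
    hence "bounded ((\<lambda>x. x powr (p + s + 2) * exp (q * (x - 1))) ` {1..max 1 X})"
      using compact_continuous_image compact_imp_bounded compact_Icc by blast
    then obtain B where B: "\<And>x. x \<in> {1..max 1 X} \<Longrightarrow> norm (x powr (p + s + 2) * exp (q * (x - 1))) \<le> B"
      unfolding bounded_iff by blast
    have KB: "x powr (p + s + 2) * exp (q * (x - 1)) \<le> max 1 B" if "x \<ge> 1" for x
      using B[of x] X[of x] that by (cases "x \<le> max 1 X") (fastforce simp: le_max_iff_disj)+
    show ?thesis
    proof (rule that[of "-2" "max 1 B"])
      fix y :: real
      have "(1 + \<bar>y\<bar>) powr (p + s) * exp (q * \<bar>y\<bar>) = ((1 + \<bar>y\<bar>) powr (p + s + 2) * exp (q * ((1 + \<bar>y\<bar>) - 1))) * (1 + \<bar>y\<bar>) powr (-2)"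
      proof -
        have "(1 + \<bar>y\<bar>) powr (p + s) = (1 + \<bar>y\<bar>) powr (p + s + 2) * (1 + \<bar>y\<bar>) powr (-2)"
          unfolding powr_add[symmetric] by simp
        thus ?thesis by (simp only:) simp
      qed
      also have "\<dots> \<le> max 1 B * (1 + \<bar>y\<bar>) powr (-2)" by (intro mult_right_mono KB) auto
      finally show "(1 + \<bar>y\<bar>) powr (p + s) * exp (q * \<bar>y\<bar>) \<le> max 1 B * (1 + \<bar>y\<bar>) powr (-2)" .
    qed simp
  next
    case False
    with c have "q = 0" "p + s < -1" by auto
    thus ?thesis by (intro that[of "p + s" 1]) auto
  qed
  have "integrable lborel (\<lambda>y. M * K * (1 + \<bar>y\<bar>) powr r)"
    by (intro integrable_mult_right integrable_powr_one_plus_abs r)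
  thus ?thesis
  proof (rule Bochner_Integration.integrable_bound)
    show "AE y in lborel. norm (of_real ((1 + \<bar>y\<bar>) powr s) * h y) \<le> norm (M * K * (1 + \<bar>y\<bar>) powr r)"
    proof (rule AE_I2)
      fix y :: real
      have "norm (of_real ((1 + \<bar>y\<bar>) powr s) * h y) = (1 + \<bar>y\<bar>) powr s * norm (h y)" by (simp add: norm_mult)
      also have "\<dots> \<le> (1 + \<bar>y\<bar>) powr s * (M * ((1 + \<bar>y\<bar>) powr p * exp (q * \<bar>y\<bar>)))"
        by (intro mult_left_mono M) auto
      also have "\<dots> = M * ((1 + \<bar>y\<bar>) powr (p + s) * exp (q * \<bar>y\<bar>))" by (simp add: powr_add mult_ac)
      also have "\<dots> \<le> M * (K * (1 + \<bar>y\<bar>) powr r)" using M(1) by (intro mult_left_mono K) auto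
      finally show "norm (of_real ((1 + \<bar>y\<bar>) powr s) * h y) \<le> norm (M * K * (1 + \<bar>y\<bar>) powr r)" by simp
    qed
  qed (use h in simp)
qed

text \<open>
  This is the integrand of the I-function at \<open>z = a\<close>.  Passing from \<open>a\<close> to \<open>a t\<^sup>\<mu>\<close> with the same
  argument multiplies it by \<open>t powr (- \<i> \<mu> y)\<close>.
\<close>

definition axis_weight ::
  "(triple \<Rightarrow> complex \<Rightarrow> complex) \<Rightarrow> nat \<Rightarrow> nat \<Rightarrow> triple list \<Rightarrow> triple list \<Rightarrow> complex \<Rightarrow> real \<Rightarrow> real \<Rightarrow> complex" where
  "axis_weight G m n up lo a \<theta> y =
     I_chi G m n up lo (\<i> * of_real y) * exp (- (\<i> * of_real y) * (of_real (ln (cmod a)) + \<i> * of_real \<theta>))"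

lemma axis_weight_growth:
  assumes "Gamma_power_branch G" "I_params m n up lo" "I_separated m n up lo"
  shows "growth_bound (axis_weight G m n up lo a \<theta>) (I_Omega up lo) (\<bar>\<theta>\<bar> - pi / 2 * I_Delta m n up lo)"
proof -
  have "growth_bound (\<lambda>y. exp (- (\<i> * of_real y) * (of_real (ln (cmod a)) + \<i> * of_real \<theta>))) 0 \<bar>\<theta>\<bar>"
    unfolding growth_bound_def
  proof (intro exI[of _ 1] conjI allI)
    fix y :: real
    have "y * \<theta> \<le> \<bar>\<theta>\<bar> * \<bar>y\<bar>" using abs_mult[of y \<theta>] by (metis abs_ge_self mult.commute)
    thus "norm (exp (- (\<i> * of_real y) * (of_real (ln (cmod a)) + \<i> * of_real \<theta>))) \<le> 1 * ((1 + \<bar>y\<bar>) powr 0 * exp (\<bar>\<theta>\<bar> * \<bar>y\<bar>))"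
      by simp
  qed simp
  from growth_bound_mult[OF I_chi_growth[OF assms] this] show ?thesis
    unfolding axis_weight_def by (simp add: add.commute)
qed

lemma axis_weight_measurable:
  assumes "Gamma_power_branch G"
  shows "axis_weight G m n up lo a \<theta> \<in> borel_measurable borel"
  unfolding axis_weight_def[abs_def]
  by (intro borel_measurable_times I_chi_measurable assms) measurable

lemma axis_weight_integrable:
  assumes "Gamma_power_branch G" "I_params m n up lo" "I_separated m n up lo"
    and "I_conv_interior m n up lo \<theta> \<or> \<bar>\<theta>\<bar> = pi / 2 * I_Delta m n up lo \<and> I_Omega up lo + s < -1"
  shows "integrable lborel (\<lambda>y. of_real ((1 + \<bar>y\<bar>) powr s) * axis_weight G m n up lo a \<theta> y)"
  by (rule growth_bound_integrable[OF axis_weight_growth axis_weight_measurable])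
     (use assms in \<open>auto simp: I_conv_interior_def\<close>)

section \<open>Gauss' summation theorem\<close>

text \<open>
  Euler's limit formula for the reciprocal Gamma function, with the factorial and the power
  normalised so that the denominator is positive at \<open>n = 0\<close>.  The two-sided estimates derived from it
  decide the convergence of all hypergeometric series below.
\<close>

lemma pochhammer_asymptotic:
  fixes z :: complex
  shows "(\<lambda>n. norm (pochhammer z n) / (fact n * (real n + 1) powr (Re z - 1)))
           \<longlonglongrightarrow> norm (rGamma z)"
proof -
  have lim1: "(\<lambda>n. norm (rGamma_series z n)) \<longlonglongrightarrow> norm (rGamma z)"
    by (intro tendsto_norm rGamma_series_LIMSEQ)
  have lim2: "(\<lambda>n. (real n / (real n + 2)) powr (Re z) * ((real n + 2) / (real n + 1))) \<longlonglongrightarrow> 1"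
  proof -
    have "(\<lambda>n. (real n / (real n + 2)) powr (Re z)) \<longlonglongrightarrow> 1 powr (Re z)"
      by (intro tendsto_powr tendsto_const) (real_asymp, simp)
    moreover have "(\<lambda>n. ((real n + 2) / (real n + 1))) \<longlonglongrightarrow> 1" by real_asymp
    ultimately show ?thesis using tendsto_mult by fastforce
  qed
  have "(\<lambda>n. norm (rGamma_series z n) *
          ((real n / (real n + 2)) powr (Re z) * ((real n + 2) / (real n + 1)))) \<longlonglongrightarrow> norm (rGamma z) * 1"
    by (intro tendsto_mult lim1 lim2)
  moreover have "eventually (\<lambda>n. norm (rGamma_series z n) *
          ((real n / (real n + 2)) powr (Re z) * ((real n + 2) / (real n + 1)))
       = norm (pochhammer z (Suc n)) / (fact (Suc n) * (real (Suc n) + 1) powr (Re z - 1))) sequentially"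
    using eventually_gt_at_top[of 0]
  proof eventually_elim
    case (elim n)
    have "norm (exp (z * of_real (ln (of_nat n)))) = real n powr Re z"
      using elim by (simp add: powr_def)
    hence "norm (rGamma_series z n) = norm (pochhammer z (Suc n)) / (fact n * real n powr Re z)"
      by (simp add: rGamma_series_def norm_divide norm_mult)
    moreover have "(real n / (real n + 2)) powr (Re z) = real n powr Re z / (real n + 2) powr Re z"
      using elim by (simp add: powr_divide)
    moreover have "(real n + 2) powr Re z = (real n + 2) powr (Re z - 1) * (real n + 2)"
      using powr_add[of "real n + 2" "Re z - 1" 1] by simp
    moreover have "real n powr Re z > 0" "(real n + 2) powr (Re z - 1) > 0"  using elim by auto
    moreover have "p / (f * x) * (x / (y * m) * (m / k)) = p / (k * f * y)"
      if "x > 0" "y > 0" "m > 0" "k > 0" "f > 0" for p f x y m k :: real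
      using that by (simp add: divide_simps)
    ultimately show ?case by (simp add: add.commute)
  qed
  ultimately have "(\<lambda>n. norm (pochhammer z (Suc n)) / (fact (Suc n) * (real (Suc n) + 1) powr (Re z - 1)))
       \<longlonglongrightarrow> norm (rGamma z)" using Lim_transform_eventually by force
  thus ?thesis by (subst (asm) filterlim_sequentially_Suc)
qed

lemma pochhammer_upper:
  fixes z :: complex
  obtains C where "C > 0" "\<And>n. norm (pochhammer z n) \<le> C * fact n * (real n + 1) powr (Re z - 1)"
proof -
  have "Bseq (\<lambda>n. norm (pochhammer z n) / (fact n * (real n + 1) powr (Re z - 1)))"
    using pochhammer_asymptotic convergent_imp_Bseq convergentI by blast
  then obtain C where C: "C > 0" "\<And>n. norm (norm (pochhammer z n) / (fact n * (real n + 1) powr (Re z - 1))) \<le> C"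
    by (auto elim: BseqE)
  have "norm (pochhammer z n) \<le> C * fact n * (real n + 1) powr (Re z - 1)" for n
  proof -
    have "0 < fact n * (real n + 1) powr (Re z - 1)" by simp
    thus ?thesis using C(2)[of n] by (simp add: norm_divide pos_divide_le_eq mult.assoc)
  qed
  thus ?thesis using that C(1) by blast
qed

lemma pochhammer_lower:
  fixes z :: complex
  assumes "z \<notin> \<int>\<^sub>\<le>\<^sub>0"
  obtains C where "C > 0" "\<And>n. fact n * (real n + 1) powr (Re z - 1) \<le> C * norm (pochhammer z n)"
proof -
  define q where "q = (\<lambda>n. norm (pochhammer z n) / (fact n * (real n + 1) powr (Re z - 1)))"
  have nz: "pochhammer z n \<noteq> 0" for n using assms pochhammer_eq_0_imp_nonpos_Int by blast
  have "(\<lambda>n. inverse (q n)) \<longlonglongrightarrow> inverse (norm (rGamma z))"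
    unfolding q_def by (intro tendsto_inverse pochhammer_asymptotic) (use assms in \<open>auto simp: rGamma_eq_zero_iff\<close>)
  hence "Bseq (\<lambda>n. inverse (q n))" using convergent_imp_Bseq convergentI by blast
  then obtain C where C: "C > 0" "\<And>n. norm (inverse (q n)) \<le> C"
    by (auto elim: BseqE)
  have "fact n * (real n + 1) powr (Re z - 1) \<le> C * norm (pochhammer z n)" for n
  proof -
    have "0 < norm (pochhammer z n)" using nz by simp
    thus ?thesis using C(2)[of n] by (simp add: q_def norm_divide pos_divide_le_eq)
  qed
  thus ?thesis using that C(1) by blast
qed

lemma Re_pos_not_nonpos_Int: "Re z > 0 \<Longrightarrow> (z::complex) \<notin> \<int>\<^sub>\<le>\<^sub>0"
  by (auto elim!: nonpos_Ints_cases)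

text \<open>
  As \<open>z\<close> may be a nonpositive integer, \<open>1 / (z)\<^sub>n\<close> need not exist.  The estimate is made at
  \<open>z + m\<close> in the right half plane and moved back by a polynomial factor of degree \<open>m\<close>.
\<close>

lemma rGamma_shift_upper:
  fixes z :: complex
  obtains C where "C > 0" "\<And>n. norm (rGamma (z + of_nat n)) \<le> C * (real n + 1) powr (1 - Re z) / fact n"
proof -
  obtain m :: nat where m: "real m > - Re z" using reals_Archimedean2 by blast
  have notin: "z + of_nat m \<notin> \<int>\<^sub>\<le>\<^sub>0" by (rule Re_pos_not_nonpos_Int) (use m in simp)
  obtain C where C: "C > 0" "\<And>n. fact n * (real n + 1) powr (Re (z + of_nat m) - 1) \<le> C * norm (pochhammer (z + of_nat m) n)"
    using pochhammer_lower[OF notin] by blast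
  define K where "K = (norm z + real m + 1)"
  have K: "K \<ge> 1" by (simp add: K_def)
  have le1: "norm (pochhammer (z + of_nat n) m) \<le> (K * (real n + 1)) ^ m" for n
  proof -
    have "norm (pochhammer (z + of_nat n) m) = (\<Prod>i<m. norm (z + of_nat n + of_nat i))"
      by (simp add: pochhammer_prod lessThan_atLeast0 flip: prod_norm)
    also have "\<dots> \<le> (\<Prod>i<m. K * (real n + 1))"
    proof (intro prod_mono conjI norm_ge_zero)
      fix i assume "i \<in> {..<m}"
      hence "norm (z + of_nat n + of_nat i) \<le> norm z + real n + real m"
        by (intro norm_triangle_le add_mono) auto
      also have "\<dots> \<le> K * (real n + 1)" by (simp add: K_def algebra_simps)
      finally show "norm (z + of_nat n + of_nat i) \<le> K * (real n + 1)" .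
    qed
    finally show ?thesis by simp
  qed
  define D where "D = K ^ m * norm (rGamma (z + of_nat m)) * C + 1"
  have D: "D > 0" unfolding D_def using K C by (intro add_nonneg_pos mult_nonneg_nonneg) auto
  have "norm (rGamma (z + of_nat n)) \<le> D * (real n + 1) powr (1 - Re z) / fact n" for n
  proof -
    let ?p = "pochhammer (z + of_nat m) n"
    have pnz: "?p \<noteq> 0" using notin pochhammer_eq_0_imp_nonpos_Int by blast
    have "rGamma (z + of_nat n) = pochhammer (z + of_nat n) m * rGamma (z + of_nat n + of_nat m)"
      by (rule pochhammer_rGamma)
    also have "z + of_nat n + of_nat m = z + of_nat m + of_nat n" by simp
    also have "rGamma (z + of_nat m + of_nat n) = rGamma (z + of_nat m) / ?p"
      using pochhammer_rGamma[of "z + of_nat m" n] pnz by (simp add: field_simps)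
    finally have "norm (rGamma (z + of_nat n)) = norm (pochhammer (z + of_nat n) m) * norm (rGamma (z + of_nat m)) * (1 / norm ?p)"
      by (simp add: norm_mult norm_divide)
    also have "\<dots> \<le> (K * (real n + 1)) ^ m * norm (rGamma (z + of_nat m)) * (C / (fact n * (real n + 1) powr (Re z + real m - 1)))"
    proof (intro mult_mono le1 order_refl mult_nonneg_nonneg norm_ge_zero)
      have "0 < fact n * (real n + 1) powr (Re z + real m - 1)" by simp
      thus "1 / norm ?p \<le> C / (fact n * (real n + 1) powr (Re z + real m - 1))"
        using C(2)[of n] pnz by (simp add: divide_simps mult.commute)
    qed (use K in \<open>auto\<close>)
    also have "\<dots> = K ^ m * norm (rGamma (z + of_nat m)) * C * ((real n + 1) ^ m / (real n + 1) powr (Re z + real m - 1)) / fact n"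
      by (simp add: power_mult_distrib mult_ac)
    also have "(real n + 1) ^ m / (real n + 1) powr (Re z + real m - 1) = (real n + 1) powr (1 - Re z)"
      by (simp add: powr_diff[symmetric] flip: powr_realpow)
    also have "K ^ m * norm (rGamma (z + of_nat m)) * C * ((real n + 1) powr (1 - Re z)) / fact n \<le> D * (real n + 1) powr (1 - Re z) / fact n"
      by (intro divide_right_mono mult_right_mono) (auto simp: D_def)
    finally show ?thesis .
  qed
  thus ?thesis using that D by blast
qed

lemma summable_powr_shift: "s < -1 \<Longrightarrow> summable (\<lambda>n. (real n + 1) powr s)"
  using summable_Suc_iff[of "\<lambda>n. real n powr s"] summable_real_powr_iff[of s] by (simp add: add.commute)

text \<open>
  With the factor \<open>1 / \<Gamma>(c + k)\<close> in place of \<open>1 / (c)\<^sub>k\<close> the series is meaningful for every \<open>c\<close>,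
  including nonpositive integers; these do occur when the theorem is applied to the kernel.
\<close>

definition gauss_term :: "complex \<Rightarrow> complex \<Rightarrow> complex \<Rightarrow> nat \<Rightarrow> complex" where
  "gauss_term a b c k = pochhammer a k * pochhammer b k / fact k * rGamma (c + of_nat k)"

lemma gauss_term_bound:
  obtains C where "C > 0" "\<And>k. norm (gauss_term a b c k) \<le> C * (real k + 1) powr (Re (a + b - c) - 1)"
proof -
  obtain C1 where C1: "C1 > 0" "\<And>n. norm (pochhammer a n) \<le> C1 * fact n * (real n + 1) powr (Re a - 1)"
    using pochhammer_upper by blast
  obtain C2 where C2: "C2 > 0" "\<And>n. norm (pochhammer b n) \<le> C2 * fact n * (real n + 1) powr (Re b - 1)"
    using pochhammer_upper by blast
  obtain C3 where C3: "C3 > 0" "\<And>n. norm (rGamma (c + of_nat n)) \<le> C3 * (real n + 1) powr (1 - Re c) / fact n"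
    using rGamma_shift_upper by blast
  have "norm (gauss_term a b c k) \<le> (C1 * C2 * C3) * (real k + 1) powr (Re (a + b - c) - 1)" for k
  proof -
    have "norm (gauss_term a b c k) = norm (pochhammer a k) * norm (pochhammer b k) / fact k * norm (rGamma (c + of_nat k))"
      by (simp add: gauss_term_def norm_mult norm_divide)
    also have "\<dots> \<le> (C1 * fact k * (real k + 1) powr (Re a - 1)) * (C2 * fact k * (real k + 1) powr (Re b - 1)) / fact k
         * (C3 * (real k + 1) powr (1 - Re c) / fact k)"
      by (intro mult_mono divide_right_mono C1 C2 C3 mult_nonneg_nonneg divide_nonneg_nonneg) (use C1(1) C2(1) C3(1) in auto)
    also have "\<dots> = C1 * C2 * C3 * ((real k + 1) powr (Re a - 1) * (real k + 1) powr (Re b - 1) * (real k + 1) powr (1 - Re c))"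
      by simp
    also have "(real k + 1) powr (Re a - 1) * (real k + 1) powr (Re b - 1) * (real k + 1) powr (1 - Re c)
        = (real k + 1) powr (Re (a + b - c) - 1)" by (simp add: algebra_simps flip: powr_add)
    finally show ?thesis .
  qed
  thus ?thesis using that[of "C1 * C2 * C3"] C1 C2 C3 by auto
qed

lemma gauss_term_summable:
  assumes "Re (c - a - b) > 0"
  shows "summable (\<lambda>k. norm (gauss_term a b c k))"
proof -
  obtain C where C: "C > 0" "\<And>k. norm (gauss_term a b c k) \<le> C * (real k + 1) powr (Re (a + b - c) - 1)"
    using gauss_term_bound by blast
  show ?thesis
    by (rule summable_comparison_test'[where g = "\<lambda>k. C * (real k + 1) powr (Re (a + b - c) - 1)"])
       (use C assms in \<open>auto intro!: summable_mult summable_powr_shift\<close>)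
qed

text \<open>
  The difference of the two sides is a telescoping series: it is the sum of the increments of
  \<open>k t\<^sub>k\<close>, where \<open>t\<^sub>k\<close> is the term of the series for \<open>c\<close>.
\<close>

lemma gauss_contiguous:
  assumes "Re (c - a - b) > 0"
  shows "(c - a - b) * suminf (gauss_term a b c) = (c - a) * (c - b) * suminf (gauss_term a b (c + 1))"
proof -
  have s1: "gauss_term a b c sums suminf (gauss_term a b c)"
    using gauss_term_summable[OF assms] summable_norm_cancel summable_sums by blast
  have s2: "gauss_term a b (c + 1) sums suminf (gauss_term a b (c + 1))"
    using gauss_term_summable[of "c + 1" a b] assms summable_norm_cancel summable_sums by force
  \<comment> \<open>The increments of this sequence are the terms to be summed; it tends to 0 because
      \<open>Re (a + b - c) < 0\<close>.\<close>
  define y where "y = (\<lambda>k. of_nat k * gauss_term a b c k)"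
  obtain C where C: "C > 0" "\<And>k. norm (gauss_term a b c k) \<le> C * (real k + 1) powr (Re (a + b - c) - 1)"
    using gauss_term_bound by blast
  have "y \<longlonglongrightarrow> 0"
  proof (rule Lim_null_comparison)
    show "eventually (\<lambda>k. norm (y k) \<le> C * (real k + 1) powr (Re (a + b - c))) sequentially"
    proof (rule always_eventually, rule allI)
      fix k
      have "norm (y k) \<le> (real k + 1) * (C * (real k + 1) powr (Re (a + b - c) - 1))"
        unfolding y_def norm_mult by (intro mult_mono C) auto
      also have "\<dots> = C * (real k + 1) powr (Re (a + b - c))"
        using powr_add[of "real k + 1" "Re (a + b - c) - 1" 1] by simp
      finally show "norm (y k) \<le> C * (real k + 1) powr (Re (a + b - c))" .
    qed
    have "Re (a + b - c) < 0" using assms by simp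
    hence "(\<lambda>k. (real k + 1) powr (Re (a + b - c))) \<longlonglongrightarrow> 0"
      by (intro tendsto_neg_powr) (auto, real_asymp)
    thus "(\<lambda>k. C * (real k + 1) powr (Re (a + b - c))) \<longlonglongrightarrow> 0"
      using tendsto_mult_right_zero by blast
  qed
  hence "(\<lambda>k. y (Suc k) - y k) sums (0 - y 0)" by (rule telescope_sums)
  hence tel: "(\<lambda>k. y (Suc k) - y k) sums 0" by (simp add: y_def)
  have "y (Suc k) - y k = (c - a) * (c - b) * gauss_term a b (c + 1) k - (c - a - b) * gauss_term a b c k" for k
  proof -
    define X where "X = pochhammer a k * pochhammer b k / fact k"
    define r where "r = rGamma (c + 1 + of_nat k)"
    have r1: "rGamma (c + of_nat k) = (c + of_nat k) * r"
      using rGamma_plus1[of "c + of_nat k"] by (simp add: r_def add_ac)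
    have "y (Suc k) = (a + of_nat k) * (b + of_nat k) * X * r"
    proof -
      have "y (Suc k) = of_nat (Suc k) * (pochhammer a k * (a + of_nat k) * (pochhammer b k * (b + of_nat k))
               / (of_nat (Suc k) * fact k) * rGamma (c + of_nat (Suc k)))"
        by (simp only: y_def gauss_term_def pochhammer_Suc fact_Suc)
      also have "rGamma (c + of_nat (Suc k)) = r" by (simp add: r_def add_ac)
      also have "of_nat (Suc k) * (pochhammer a k * (a + of_nat k) * (pochhammer b k * (b + of_nat k))
               / (of_nat (Suc k) * fact k) * r) = (a + of_nat k) * (b + of_nat k) * X * r"
        unfolding X_def by (simp add: mult_ac del: of_nat_Suc)
      finally show ?thesis .
    qed
    moreover have "y k = of_nat k * (X * ((c + of_nat k) * r))"
      by (simp add: y_def gauss_term_def r1 X_def)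
    moreover have "gauss_term a b (c + 1) k = X * r" by (simp add: gauss_term_def X_def r_def)
    moreover have "gauss_term a b c k = X * ((c + of_nat k) * r)" by (simp add: gauss_term_def X_def r1)
    ultimately show ?thesis by (simp only: ring_distribs, simp add: algebra_simps)
  qed
  hence "(\<lambda>k. (c - a) * (c - b) * gauss_term a b (c + 1) k - (c - a - b) * gauss_term a b c k) sums 0"
    using tel by simp
  moreover have "(\<lambda>k. (c - a) * (c - b) * gauss_term a b (c + 1) k - (c - a - b) * gauss_term a b c k) sums
      ((c - a) * (c - b) * suminf (gauss_term a b (c + 1)) - (c - a - b) * suminf (gauss_term a b c))"
    by (intro sums_diff sums_mult s1 s2)
  ultimately show ?thesis using sums_unique2 by fastforce
qed

lemma gauss_contiguous_iterated:
  assumes "Re (c - a - b) > 0"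
  shows "pochhammer (c - a - b) n * suminf (gauss_term a b c) =
         pochhammer (c - a) n * pochhammer (c - b) n * suminf (gauss_term a b (c + of_nat n))"
proof (induction n)
  case (Suc n)
  have "Re (c + of_nat n - a - b) > 0" using assms by simp
  from gauss_contiguous[OF this]
  have eq: "(c - a - b + of_nat n) * suminf (gauss_term a b (c + of_nat n)) =
      (c - a + of_nat n) * (c - b + of_nat n) * suminf (gauss_term a b (c + of_nat (Suc n)))"
    by (simp add: algebra_simps)
  have "pochhammer (c - a - b) (Suc n) * suminf (gauss_term a b c)
      = (c - a - b + of_nat n) * (pochhammer (c - a - b) n * suminf (gauss_term a b c))"
    by (simp add: pochhammer_Suc)
  also have "\<dots> = pochhammer (c - a) n * pochhammer (c - b) n * ((c - a - b + of_nat n) * suminf (gauss_term a b (c + of_nat n)))"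
    unfolding Suc.IH by simp
  also have "\<dots> = pochhammer (c - a) (Suc n) * pochhammer (c - b) (Suc n) * suminf (gauss_term a b (c + of_nat (Suc n)))"
    unfolding eq by (simp add: pochhammer_Suc)
  finally show ?case .
qed simp

text \<open>
  After normalisation the term for \<open>k = 0\<close> is 1.  For \<open>k \<ge> 1\<close> the denominator \<open>(c + n + 1)\<^sub>k\<close> exceeds
  \<open>(c)\<^sub>k\<close> by a factor \<open>\<bar>c + n + 1\<bar> / \<bar>c\<bar>\<close> in its first factor alone, which makes the rest of the
  series \<open>O(1 / n)\<close>.
\<close>

lemma gauss_shift_limit:
  assumes c: "Re c > 0" and abc: "Re (c - a - b) > 0"
  shows "(\<lambda>n. (\<Sum>k. gauss_term a b (c + of_nat (Suc n)) k) * Gamma (c + of_nat (Suc n))) \<longlonglongrightarrow> 1"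
proof -
  have cn: "c \<notin> \<int>\<^sub>\<le>\<^sub>0" using c Re_pos_not_nonpos_Int by blast
  define v where "v = (\<lambda>k. norm (pochhammer a k * pochhammer b k / fact k / pochhammer c k))"
  have v: "v k = norm (gauss_term a b c k) * norm (Gamma c)" for k
  proof -
    have "rGamma c = pochhammer c k * rGamma (c + of_nat k)" by (rule pochhammer_rGamma)
    moreover have "rGamma c = inverse (Gamma c)" "Gamma c \<noteq> 0" "pochhammer c k \<noteq> 0"
      using cn pochhammer_eq_0_imp_nonpos_Int by (auto simp: rGamma_inverse_Gamma Gamma_eq_zero_iff)
    ultimately have "rGamma (c + of_nat k) * Gamma c = 1 / pochhammer c k" by (simp add: field_simps)
    thus ?thesis unfolding v_def gauss_term_def norm_mult[symmetric] by (simp add: mult.assoc) (simp add: mult_ac)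
  qed
  have sv: "summable v" unfolding v by (intro summable_mult2 gauss_term_summable abc)
  define S where "S = suminf v"
  have bound: "norm ((\<Sum>k. gauss_term a b (c + of_nat (Suc n)) k) * Gamma (c + of_nat (Suc n)) - 1)
      \<le> norm c * S / real (Suc n)" for n
  proof -
    let ?d = "c + of_nat (Suc n)"
    have dn: "?d \<notin> \<int>\<^sub>\<le>\<^sub>0" by (rule Re_pos_not_nonpos_Int) (use c in simp)
    have "summable (gauss_term a b ?d)"
      using gauss_term_summable[of ?d a b] abc summable_norm_cancel by fastforce
    hence "(\<lambda>k. gauss_term a b ?d k * Gamma ?d) sums (suminf (gauss_term a b ?d) * Gamma ?d)"
      by (intro sums_mult2 summable_sums)
    moreover define t where "t = (\<lambda>k. gauss_term a b ?d k * Gamma ?d)"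
    ultimately have ts: "t sums (suminf (gauss_term a b ?d) * Gamma ?d)" by simp
    have t: "t k = pochhammer a k * pochhammer b k / fact k / pochhammer ?d k" for k
    proof -
      have "rGamma ?d = pochhammer ?d k * rGamma (?d + of_nat k)" by (rule pochhammer_rGamma)
      moreover have "rGamma ?d = inverse (Gamma ?d)" "Gamma ?d \<noteq> 0" "pochhammer ?d k \<noteq> 0"
        using dn pochhammer_eq_0_imp_nonpos_Int[of ?d k] by (auto simp: rGamma_inverse_Gamma Gamma_eq_zero_iff)
      ultimately have "rGamma (?d + of_nat k) * Gamma ?d = 1 / pochhammer ?d k" by (simp add: field_simps)
      thus ?thesis unfolding t_def gauss_term_def by (simp add: mult_ac)
    qed
    have t0: "t 0 = 1" by (simp add: t)
    have ts': "(\<lambda>k. t (Suc k)) sums (suminf (gauss_term a b ?d) * Gamma ?d - 1)"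
      using ts t0 by (subst sums_Suc_iff) simp
    have le: "norm (t (Suc k)) \<le> norm c / real (Suc n) * v (Suc k)" for k
    proof -
      have nf: "norm (c + of_nat (Suc k')) \<ge> real (Suc k')" for k' using c complex_Re_le_cmod[of "c + of_nat (Suc k')"] by simp
      have mono: "norm (pochhammer (c + 1) k) \<le> norm (pochhammer (?d + 1) k)"
        unfolding pochhammer_prod prod_norm[symmetric]
      proof (intro prod_mono conjI norm_ge_zero)
        fix i
        show "norm (c + 1 + of_nat i) \<le> norm (?d + 1 + of_nat i)"
          unfolding cmod_def
        proof (intro real_sqrt_le_mono add_mono)
          show "(Re (c + 1 + of_nat i))\<^sup>2 \<le> (Re (?d + 1 + of_nat i))\<^sup>2"
            using c by (intro power_mono) auto
          have "Im (c + 1 + of_nat i) = Im (?d + 1 + of_nat i)" by simp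
          thus "(Im (c + 1 + of_nat i))\<^sup>2 \<le> (Im (?d + 1 + of_nat i))\<^sup>2" by (simp only: order_refl)
        qed
      qed
      have p1: "norm (pochhammer c (Suc k)) = norm c * norm (pochhammer (c + 1) k)"
        by (simp add: pochhammer_rec norm_mult)
      have p2: "norm (pochhammer ?d (Suc k)) = norm ?d * norm (pochhammer (?d + 1) k)"
        by (simp only: pochhammer_rec norm_mult)
      have pos: "norm (pochhammer (c + 1) k) > 0"
        using pochhammer_eq_0_imp_nonpos_Int[of "c+1" k] Re_pos_not_nonpos_Int[of "c + 1"] c by auto
      have "norm c / real (Suc n) / norm (pochhammer c (Suc k)) = 1 / (real (Suc n) * norm (pochhammer (c + 1) k))"
      proof -
        have "norm c > 0" using c by auto
        moreover have "x / s / (x * p) = 1 / (s * p)" if "x > 0" for x s p :: real using that by simp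
        ultimately show ?thesis unfolding p1 by blast
      qed
      also have "\<dots> \<ge> 1 / norm (pochhammer ?d (Suc k))"
      proof -
        have "real (Suc n) * norm (pochhammer (c + 1) k) \<le> norm ?d * norm (pochhammer (?d + 1) k)"
          by (intro mult_mono mono nf) auto
        moreover have "real (Suc n) * norm (pochhammer (c + 1) k) > 0" using pos by simp
        ultimately show ?thesis unfolding p2 by (intro divide_left_mono) (auto simp: mult_pos_pos)
      qed
      finally have "1 / norm (pochhammer ?d (Suc k)) \<le> norm c / real (Suc n) / norm (pochhammer c (Suc k))" .
      hence "norm (pochhammer a (Suc k) * pochhammer b (Suc k) / fact (Suc k)) * (1 / norm (pochhammer ?d (Suc k)))
         \<le> norm (pochhammer a (Suc k) * pochhammer b (Suc k) / fact (Suc k)) * (norm c / real (Suc n) / norm (pochhammer c (Suc k)))"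
        by (rule mult_left_mono) simp
      thus ?thesis unfolding t v_def by (simp add: norm_divide norm_mult mult_ac)
    qed
    have vn: "v k \<ge> 0" for k by (simp add: v_def)
    have sv': "summable (\<lambda>k. v (Suc k))" using sv by (simp add: summable_Suc_iff)
    have "norm (suminf (gauss_term a b ?d) * Gamma ?d - 1) = norm (\<Sum>k. t (Suc k))"
      using ts' by (simp add: sums_iff)
    also have "\<dots> \<le> (\<Sum>k. norm c / real (Suc n) * v (Suc k))"
    proof -
      have sm: "summable (\<lambda>k. norm c / real (Suc n) * v (Suc k))" by (intro summable_mult sv')
      have sn: "summable (\<lambda>k. norm (t (Suc k)))"
        by (rule summable_comparison_test'[OF sm, where N = 0]) (use le in simp)
      have "norm (\<Sum>k. t (Suc k)) \<le> (\<Sum>k. norm (t (Suc k)))" by (rule summable_norm[OF sn])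
      also have "\<dots> \<le> (\<Sum>k. norm c / real (Suc n) * v (Suc k))" by (intro suminf_le le sn sm)
      finally show ?thesis .
    qed
    also have "\<dots> = norm c / real (Suc n) * (\<Sum>k. v (Suc k))" by (rule suminf_mult[OF sv'])
    also have "\<dots> \<le> norm c / real (Suc n) * S"
      using suminf_split_head[OF sv] vn[of 0] by (intro mult_left_mono) (auto simp: S_def)
    finally show ?thesis by simp
  qed
  have "(\<lambda>n. norm c * S / real (Suc n)) \<longlonglongrightarrow> 0"
    by (intro real_tendsto_divide_at_top[OF tendsto_const] filterlim_compose[OF filterlim_real_sequentially filterlim_Suc])
  from Lim_null_comparison[OF always_eventually[OF allI[OF bound]] this] show ?thesis
    by (simp add: LIM_zero_iff)
qed

text \<open>
  For \<open>Re c > 0\<close> the contiguous relation is iterated and \<open>c + n\<close> tends to infinity, where the series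
  is governed by \<open>gauss_shift_limit\<close> and the Pochhammer symbols by Euler's limit.  The relation
  then leads back to arbitrary \<open>c\<close>.
\<close>

theorem gauss_summation:
  assumes "Re (c - a - b) > 0"
  shows "gauss_term a b c sums (Gamma (c - a - b) * rGamma (c - a) * rGamma (c - b))"
proof -
  have right: "suminf (gauss_term a b c) = Gamma (c - a - b) * rGamma (c - a) * rGamma (c - b)"
    if c: "Re c > 0" and abc: "Re (c - a - b) > 0" for c
  proof -
    let ?S = "suminf (gauss_term a b c)"
    have cn: "c \<notin> \<int>\<^sub>\<le>\<^sub>0" "c - a - b \<notin> \<int>\<^sub>\<le>\<^sub>0" using c abc Re_pos_not_nonpos_Int by blast+
    have "(\<lambda>n. rGamma_series (c - a) n * rGamma_series (c - b) n / (rGamma_series (c - a - b) n * rGamma_series c n)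
            * rGamma c * ((\<Sum>k. gauss_term a b (c + of_nat (Suc n)) k) * Gamma (c + of_nat (Suc n)))) \<longlonglongrightarrow>
           rGamma (c - a) * rGamma (c - b) / (rGamma (c - a - b) * rGamma c) * rGamma c * 1"
      by (intro tendsto_intros gauss_shift_limit c abc) (use cn in \<open>auto simp: rGamma_eq_zero_iff\<close>)
    moreover have "eventually (\<lambda>n. rGamma_series (c - a) n * rGamma_series (c - b) n / (rGamma_series (c - a - b) n * rGamma_series c n)
            * rGamma c * ((\<Sum>k. gauss_term a b (c + of_nat (Suc n)) k) * Gamma (c + of_nat (Suc n))) = ?S) sequentially"
      using eventually_gt_at_top[of 0]
    proof eventually_elim
      case (elim n)
      let ?d = "c + of_nat (Suc n)"
      have dn: "?d \<notin> \<int>\<^sub>\<le>\<^sub>0" by (rule Re_pos_not_nonpos_Int) (use c in simp)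
      have pn: "pochhammer c (Suc n) \<noteq> 0" "pochhammer (c - a - b) (Suc n) \<noteq> 0"
        using cn pochhammer_eq_0_imp_nonpos_Int by blast+
      have r: "rGamma c = pochhammer c (Suc n) / Gamma ?d" "Gamma ?d \<noteq> 0"
        using pochhammer_rGamma[of c "Suc n"] dn by (auto simp: rGamma_inverse_Gamma Gamma_eq_zero_iff divide_inverse)
      have e: "exp ((c - a) * of_real (ln (of_nat n))) * exp ((c - b) * of_real (ln (of_nat n)))
          = exp ((c - a - b) * of_real (ln (of_nat n))) * exp (c * of_real (ln (real n)))"
        by (simp add: algebra_simps flip: exp_add)
      have "rGamma_series (c - a) n * rGamma_series (c - b) n / (rGamma_series (c - a - b) n * rGamma_series c n)
           = pochhammer (c - a) (Suc n) * pochhammer (c - b) (Suc n) / (pochhammer (c - a - b) (Suc n) * pochhammer c (Suc n))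
             * (exp ((c - a - b) * of_real (ln (of_nat n))) * exp (c * of_real (ln (real n))) /
               (exp ((c - a) * of_real (ln (of_nat n))) * exp ((c - b) * of_real (ln (of_nat n)))))"
        by (simp add: rGamma_series_def field_simps)
      also have "\<dots> = pochhammer (c - a) (Suc n) * pochhammer (c - b) (Suc n) / (pochhammer (c - a - b) (Suc n) * pochhammer c (Suc n))"
        unfolding e by simp
      finally have q: "rGamma_series (c - a) n * rGamma_series (c - b) n / (rGamma_series (c - a - b) n * rGamma_series c n) = \<dots>" .
      have g: "pochhammer (c - a) (Suc n) * pochhammer (c - b) (Suc n) * suminf (gauss_term a b ?d) = pochhammer (c - a - b) (Suc n) * ?S"
        using gauss_contiguous_iterated[OF abc, of "Suc n"] by simp
      have "pochhammer (c - a) (Suc n) * pochhammer (c - b) (Suc n) / (pochhammer (c - a - b) (Suc n) * pochhammer c (Suc n))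
         * rGamma c * (suminf (gauss_term a b ?d) * Gamma ?d)
         = (pochhammer (c - a) (Suc n) * pochhammer (c - b) (Suc n) * suminf (gauss_term a b ?d)) / pochhammer (c - a - b) (Suc n)"
        unfolding r(1) using r(2) pn by (simp add: field_simps)
      also have "\<dots> = ?S" unfolding g using pn by simp
      finally show ?case unfolding q .
    qed
    ultimately have "(\<lambda>n. ?S) \<longlonglongrightarrow> rGamma (c - a) * rGamma (c - b) / (rGamma (c - a - b) * rGamma c) * rGamma c * 1"
      by (rule Lim_transform_eventually)
    hence "?S = rGamma (c - a) * rGamma (c - b) / (rGamma (c - a - b) * rGamma c) * rGamma c * 1"
      using LIMSEQ_unique tendsto_const by blast
    moreover have "rGamma c \<noteq> 0" using cn(1) by (simp add: rGamma_eq_zero_iff del: rGamma_inverse_Gamma)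
    moreover have "rGamma (c - a - b) = inverse (Gamma (c - a - b))" by (rule rGamma_inverse_Gamma)
    ultimately show ?thesis by (simp add: field_simps)
  qed
  obtain n :: nat where n: "real n > - Re c" using reals_Archimedean2 by blast
  have cn: "c - a - b \<notin> \<int>\<^sub>\<le>\<^sub>0" using assms Re_pos_not_nonpos_Int by blast
  have "pochhammer (c - a - b) n * suminf (gauss_term a b c) =
        pochhammer (c - a) n * pochhammer (c - b) n * suminf (gauss_term a b (c + of_nat n))"
    by (rule gauss_contiguous_iterated[OF assms])
  also have "suminf (gauss_term a b (c + of_nat n)) =
        Gamma (c + of_nat n - a - b) * rGamma (c + of_nat n - a) * rGamma (c + of_nat n - b)"
    by (rule right) (use n assms in auto)
  also have "pochhammer (c - a) n * pochhammer (c - b) n * \<dots> = Gamma (c - a - b + of_nat n) *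
     (pochhammer (c - a) n * rGamma (c - a + of_nat n)) * (pochhammer (c - b) n * rGamma (c - b + of_nat n))"
    by (simp add: algebra_simps)
  also have "\<dots> = pochhammer (c - a - b) n * (Gamma (c - a - b) * rGamma (c - a) * rGamma (c - b))"
    using cn by (simp add: pochhammer_rGamma[symmetric] pochhammer_Gamma[OF cn] Gamma_eq_zero_iff)
  finally have "suminf (gauss_term a b c) = Gamma (c - a - b) * rGamma (c - a) * rGamma (c - b)"
    using cn pochhammer_eq_0_imp_nonpos_Int by auto
  thus ?thesis using gauss_term_summable[OF assms] summable_norm_cancel sums_iff by metis
qed

section \<open>Pfaff's transformation\<close>

lemma abs_summable_on_nat_prod:
  fixes f :: "nat \<times> nat \<Rightarrow> complex" and F G :: "nat \<Rightarrow> real"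
  assumes F: "summable F" "\<And>k. F k \<ge> 0" and G: "summable G" "\<And>l. G l \<ge> 0"
    and le: "\<And>k l. norm (f (k, l)) \<le> F k * G l"
  shows "(\<lambda>x. norm (f x)) summable_on UNIV"
proof (rule Infinite_Sum.abs_summable_on_comparison_test)
  have sG: "G summable_on UNIV" using G by (intro norm_summable_imp_summable_on) simp
  have sF: "F summable_on UNIV" using F by (intro norm_summable_imp_summable_on) simp
  have "(\<lambda>x. norm ((\<lambda>(k, l). F k * G l) x)) summable_on Sigma UNIV (\<lambda>_. UNIV)"
    by (rule Infinite_Sum.abs_summable_on_Sigma_iff[THEN iffD2])
       (use F G sF sG in \<open>auto simp: abs_mult infsum_cmult_right' infsum_nonneg intro!: summable_on_cmult_right summable_on_cmult_left\<close>)
  thus "(\<lambda>x. norm ((\<lambda>(k, l). F k * G l) x)) summable_on (UNIV :: (nat \<times> nat) set)" by simp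
  show "norm (f x) \<le> norm ((\<lambda>(k, l). F k * G l) x)" for x
    using le[of "fst x" "snd x"] F(2)[of "fst x"] G(2)[of "snd x"] by (simp add: case_prod_unfold)
qed

lemma has_sum_diagonal:
  fixes f :: "nat \<times> nat \<Rightarrow> 'a :: {topological_comm_monoid_add, t3_space}"
  assumes "(f has_sum S) UNIV"
  shows "((\<lambda>n. \<Sum>k\<le>n. f (k, n - k)) has_sum S) UNIV"
proof -
  have "((\<lambda>(n, k). f (k, n - k)) has_sum S) (Sigma UNIV (\<lambda>n. {..n})) \<longleftrightarrow> (f has_sum S) UNIV"
    by (rule has_sum_reindex_bij_witness[of _ "\<lambda>(k, l). (k + l, k)" "\<lambda>(n, k). (k, n - k)"]) auto
  with assms have "((\<lambda>(n, k). f (k, n - k)) has_sum S) (Sigma UNIV (\<lambda>n. {..n}))" by simp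
  thus ?thesis by (rule has_sum_SigmaD) (auto intro!: has_sum_finiteI)
qed

text \<open>
  An absolutely summable double series may be summed by diagonals or by rows.
\<close>

lemma double_series:
  fixes f :: "nat \<times> nat \<Rightarrow> complex"
  assumes f: "(\<lambda>x. norm (f x)) summable_on UNIV"
  shows "(\<lambda>n. \<Sum>k\<le>n. f (k, n - k)) sums infsum f UNIV"
    and "summable (\<lambda>n. norm (\<Sum>k\<le>n. f (k, n - k)))"
    and "summable (\<lambda>l. norm (f (k, l)))"
    and "(\<lambda>k. \<Sum>l. f (k, l)) sums infsum f UNIV"
proof -
  have hs: "(f has_sum infsum f UNIV) UNIV" by (rule has_sum_infsum[OF abs_summable_summable[OF f]])
  show "(\<lambda>n. \<Sum>k\<le>n. f (k, n - k)) sums infsum f UNIV"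
    using has_sum_diagonal[OF hs] has_sum_imp_sums by blast
  have "((\<lambda>x. norm (f x)) has_sum infsum (\<lambda>x. norm (f x)) UNIV) UNIV" using f by simp
  from has_sum_imp_sums[OF has_sum_diagonal[OF this]]
  have "summable (\<lambda>n. \<Sum>k\<le>n. norm (f (k, n - k)))" by (simp add: sums_iff)
  thus "summable (\<lambda>n. norm (\<Sum>k\<le>n. f (k, n - k)))"
    by (rule summable_comparison_test'[where N = 0]) (auto intro: norm_sum)
  have row: "(\<lambda>l. norm (f (k, l))) summable_on UNIV" for k
  proof -
    have "(\<lambda>x. norm (f x)) summable_on Sigma UNIV (\<lambda>_. UNIV)" using f by simp
    thus ?thesis by (subst (asm) Infinite_Sum.abs_summable_on_Sigma_iff) simp
  qed
  show "summable (\<lambda>l. norm (f (k, l)))"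
    using row[of k] by (rule summable_on_imp_summable)
  have "((\<lambda>l. f (k, l)) has_sum (\<Sum>l. f (k, l))) UNIV" for k
    using row[of k] summable_on_imp_summable[OF row[of k]]
    by (intro norm_summable_imp_has_sum summable_sums) (auto dest: summable_norm_cancel)
  moreover have "(f has_sum infsum f UNIV) (Sigma UNIV (\<lambda>_. UNIV))" using hs by simp
  ultimately have "((\<lambda>k. \<Sum>l. f (k, l)) has_sum infsum f UNIV) UNIV"
    using has_sum_SigmaD[where f = f and A = UNIV and B = "\<lambda>_. UNIV"
        and g = "\<lambda>k. \<Sum>l. f (k, l)" and S = "infsum f UNIV"] by blast
  thus "(\<lambda>k. \<Sum>l. f (k, l)) sums infsum f UNIV" by (rule has_sum_imp_sums)
qed

text \<open>
  The exchange between growth of coefficients and growth at the end point \<open>u = 0\<close>: with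
  \<open>x = (n + 1) u\<close> it says that \<open>x powr r * exp (- x)\<close> is bounded.
\<close>

lemma powr_times_power_bound:
  fixes r :: real
  assumes r: "r \<ge> 0"
  obtains C where "C > 0" "\<And>n u. 0 < u \<Longrightarrow> u \<le> 1 \<Longrightarrow> (real n + 1) powr r * (1 - u) ^ n \<le> C * u powr (- r)"
proof -
  define C where "C = (r powr r + 1) * exp 1"
  have *: "x powr r \<le> (r powr r + 1) * exp x" if "x > 0" for x
  proof (cases "r = 0")
    case False
    with r have r: "r > 0" by simp
    have "x / r \<le> exp (x / r)" using exp_ge_add_one_self[of "x / r"] by linarith
    hence "x \<le> r * exp (x / r)" using r by (simp add: field_simps)
    hence "x powr r \<le> (r * exp (x / r)) powr r" using that r by (intro powr_mono2) auto
    also have "\<dots> = r powr r * exp x" proof -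
      have "exp (x / r) powr r = exp x" using r by (simp add: powr_def)
      thus ?thesis using r by (simp add: powr_mult)
    qed
    also have "\<dots> \<le> (r powr r + 1) * exp x" by (intro mult_right_mono) auto
    finally show ?thesis .
  qed (use that in auto)
  have "(real n + 1) powr r * (1 - u) ^ n \<le> C * u powr (- r)" if u: "0 < u" "u \<le> 1" for n u
  proof -
    have "(1 - u) ^ n \<le> exp (- u) ^ n" using u exp_ge_add_one_self[of "-u"] by (intro power_mono) auto
    also have "\<dots> = exp (- (real n * u))" by (simp add: exp_of_nat_mult[symmetric])
    finally have e: "(1 - u) ^ n \<le> exp (- (real n * u))" .
    have "(real n + 1) powr r * (1 - u) ^ n = ((real n + 1) * u) powr r * u powr (- r) * (1 - u) ^ n"
    proof -
      have "((real n + 1) * u) powr r = (real n + 1) powr r * u powr r" using u by (simp add: powr_mult)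
      moreover have "u powr r * u powr (- r) = 1" using u by (simp flip: powr_add)
      ultimately show ?thesis by (simp add: mult.assoc)
    qed
    also have "\<dots> \<le> ((r powr r + 1) * exp ((real n + 1) * u)) * u powr (- r) * exp (- (real n * u))"
      using u by (intro mult_mono * e) auto
    also have "\<dots> = (r powr r + 1) * u powr (- r) * exp u"
      by (simp add: algebra_simps mult_exp_exp)
    also have "\<dots> \<le> (r powr r + 1) * u powr (- r) * exp 1" using u by (intro mult_left_mono) auto
    finally show ?thesis by (simp add: C_def mult_ac)
  qed
  moreover have "C > 0" by (simp add: C_def add_nonneg_pos)
  ultimately show ?thesis using that by blast
qed

lemma summable_powr_geometric:
  fixes r q :: real
  assumes q: "0 \<le> q" "q < 1"
  shows "summable (\<lambda>n. (real n + 1) powr r * q ^ n)"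
proof -
  obtain C where C: "C > 0" "\<And>n u. 0 < u \<Longrightarrow> u \<le> 1 \<Longrightarrow> (real n + 1) powr (\<bar>r\<bar> + 2) * (1 - u) ^ n \<le> C * u powr (- (\<bar>r\<bar> + 2))"
    using powr_times_power_bound[of "\<bar>r\<bar> + 2"] by auto
  define K where "K = C * (1 - q) powr (- (\<bar>r\<bar> + 2))"
  have "summable (\<lambda>n. K * (real n + 1) powr (-2))" by (intro summable_mult summable_powr_shift) simp
  thus ?thesis
  proof (rule summable_comparison_test'[where N = 0])
    fix n :: nat
    have "(real n + 1) powr r * q ^ n \<le> (real n + 1) powr \<bar>r\<bar> * q ^ n"
      using q by (intro mult_right_mono powr_mono) auto
    also have "\<dots> = ((real n + 1) powr (\<bar>r\<bar> + 2) * q ^ n) * (real n + 1) powr (-2)"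
    proof -
      have "(real n + 1) powr \<bar>r\<bar> = (real n + 1) powr (\<bar>r\<bar> + 2) * (real n + 1) powr (-2)"
        unfolding powr_add[symmetric] by simp
      thus ?thesis by (simp only:) simp
    qed
    also have "\<dots> \<le> K * (real n + 1) powr (-2)"
      using C(2)[of "1 - q" n] q by (intro mult_right_mono) (auto simp: K_def)
    finally show "norm ((real n + 1) powr r * q ^ n) \<le> K * (real n + 1) powr (-2)" using q by simp
  qed
qed

lemma pochhammer_ratio_bound:
  fixes c :: complex
  assumes "c \<notin> \<int>\<^sub>\<le>\<^sub>0"
  obtains C s where "C > 0" "\<And>l. norm (pochhammer a l * pochhammer b l / (pochhammer c l * fact l)) \<le> C * (real l + 1) powr s"
proof -
  obtain C1 where C1: "C1 > 0" "\<And>n. norm (pochhammer a n) \<le> C1 * fact n * (real n + 1) powr (Re a - 1)"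
    using pochhammer_upper by blast
  obtain C2 where C2: "C2 > 0" "\<And>n. norm (pochhammer b n) \<le> C2 * fact n * (real n + 1) powr (Re b - 1)"
    using pochhammer_upper by blast
  obtain C3 where C3: "C3 > 0" "\<And>n. fact n * (real n + 1) powr (Re c - 1) \<le> C3 * norm (pochhammer c n)"
    using pochhammer_lower[OF assms] by blast
  have "norm (pochhammer a l * pochhammer b l / (pochhammer c l * fact l)) \<le> (C1 * C2 * C3) * (real l + 1) powr ((Re a - 1) + (Re b - 1) - (Re c - 1))" for l
  proof -
    let ?n = "real l + 1"
    have nz: "norm (pochhammer c l) > 0" using assms pochhammer_eq_0_imp_nonpos_Int by auto
    have pos: "fact l * ?n powr (Re c - 1) > 0" by simp
    have inv: "1 / norm (pochhammer c l) \<le> C3 / (fact l * ?n powr (Re c - 1))"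
      using C3(2)[of l] nz pos by (simp add: divide_simps mult.commute)
    have "norm (pochhammer a l * pochhammer b l / (pochhammer c l * fact l)) = norm (pochhammer a l) * norm (pochhammer b l) * (1 / norm (pochhammer c l)) / fact l"
      by (simp add: norm_mult norm_divide)
    also have "\<dots> \<le> (C1 * fact l * ?n powr (Re a - 1)) * (C2 * fact l * ?n powr (Re b - 1)) * (C3 / (fact l * ?n powr (Re c - 1))) / fact l"
      by (intro divide_right_mono mult_mono C1 C2 inv mult_nonneg_nonneg) (use C1(1) C2(1) C3(1) in auto)
    also have "\<dots> = (C1 * C2 * C3) * (?n powr (Re a - 1) * ?n powr (Re b - 1) / ?n powr (Re c - 1))" by simp
    also have "?n powr (Re a - 1) * ?n powr (Re b - 1) / ?n powr (Re c - 1) = ?n powr ((Re a - 1) + (Re b - 1) - (Re c - 1))"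
      by (simp only: powr_add powr_diff)
    finally show ?thesis .
  qed
  moreover have "C1 * C2 * C3 > 0" using C1 C2 C3 by simp
  ultimately show ?thesis using that by blast
qed

lemma hypergeometric_summable:
  fixes c z :: complex
  assumes "c \<notin> \<int>\<^sub>\<le>\<^sub>0" "norm z < 1"
  shows "summable (\<lambda>l. norm (pochhammer a l * pochhammer b l / (pochhammer c l * fact l) * z ^ l))"
proof -
  obtain C s where C: "C > 0" "\<And>l. norm (pochhammer a l * pochhammer b l / (pochhammer c l * fact l)) \<le> C * (real l + 1) powr s"
    using pochhammer_ratio_bound[OF assms(1), of a b] by blast
  have "summable (\<lambda>l. C * ((real l + 1) powr s * norm z ^ l))"
    using assms(2) by (intro summable_mult summable_powr_geometric) auto
  thus ?thesis
  proof (rule summable_comparison_test'[where N = 0])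
    fix l
    show "norm (norm (pochhammer a l * pochhammer b l / (pochhammer c l * fact l) * z ^ l)) \<le> C * ((real l + 1) powr s * norm z ^ l)"
      unfolding norm_mult[of _ "z ^ l"] norm_power abs_mult real_norm_def
      using mult_right_mono[OF C(2)[of l], of "norm z ^ l"] by (simp add: mult.assoc)
  qed
qed

text \<open>
  For an integer bound \<open>m\<close> of \<open>\<bar>a\<bar>\<close> the left-hand side is dominated by a binomial coefficient.
\<close>

lemma norm_pochhammer_shift_le:
  fixes a :: complex
  assumes "norm a \<le> real m"
  shows "norm (pochhammer (a + of_nat l) j) / fact j \<le> 2 ^ (m + l + j)"
proof -
  have "norm (pochhammer (a + of_nat l) j) \<le> pochhammer (real (m + l)) j"
    unfolding pochhammer_prod prod_norm[symmetric]
  proof (intro prod_mono conjI norm_ge_zero)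
    fix i
    have "norm (a + of_nat l + of_nat i) \<le> norm a + real l + real i"
      by (intro order_trans[OF norm_triangle_ineq] add_mono) (auto intro: order_trans[OF norm_triangle_ineq])
    thus "norm (a + of_nat l + of_nat i) \<le> real (m + l) + real i" using assms by simp
  qed
  also have "pochhammer (real (m + l)) j / fact j \<le> 2 ^ (m + l + j)"
  proof (cases "m + l + j = 0")
    case False
    define N where "N = m + l + j - 1"
    have "Suc N = m + l + j" using False unfolding N_def by linarith
    hence "real N - real j + 1 = real (m + l)" by (simp flip: of_nat_add)
    hence "pochhammer (real (m + l)) j / fact j = real N gchoose j" by (simp add: gbinomial_pochhammer')
    also have "\<dots> = real (N choose j)" by (simp add: binomial_gbinomial)
    also have "\<dots> \<le> real (2 ^ N)"
      using binomial_le_pow2[of N j] by (simp only: of_nat_le_iff)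
    also have "\<dots> \<le> 2 ^ (m + l + j)" unfolding N_def by (simp add: power_increasing)
    finally show ?thesis .
  qed simp
  hence "pochhammer (real (m + l)) j / fact j \<le> 2 ^ (m + l + j)" .
  finally show ?thesis by (simp add: divide_right_mono field_simps)
qed

text \<open>
  Expanding \<open>(1 - z) powr (- a - l)\<close> by the binomial theorem gives a double series with row sums on the
  right-hand side; along the diagonals the Chu-Vandermonde identity produces \<open>(b)\<^sub>n / (c)\<^sub>n\<close>.  For
  \<open>\<bar>z\<bar> < 1/3\<close> the crude bound \<open>norm_pochhammer_shift_le\<close> makes the double series absolutely
  convergent.
\<close>

lemma pfaff_near_0:
  fixes z :: complex
  assumes c: "c \<notin> \<int>\<^sub>\<le>\<^sub>0" and z: "norm z < 1/3"
  shows "(\<Sum>n. pochhammer a n * pochhammer b n / pochhammer c n * z ^ n / fact n) =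
     (1 - z) powr (- a) * (\<Sum>l. pochhammer a l * pochhammer (c - b) l / (pochhammer c l * fact l) * (z / (z - 1)) ^ l)"
proof -
  have z1: "1 - z \<noteq> 0" "norm z < 1" using z by auto
  define d where "d = (\<lambda>l. pochhammer a l * pochhammer (c - b) l / (pochhammer c l * fact l))"
  obtain C s where C: "C > 0" "\<And>l. norm (d l) \<le> C * (real l + 1) powr s"
    using pochhammer_ratio_bound[OF c, of a "c - b"] unfolding d_def by blast
  obtain m :: nat where m: "norm a \<le> real m" using real_arch_simple by blast
  define t where "t = (\<lambda>(l, j). d l * (- z) ^ l * (pochhammer (a + of_nat l) j / fact j * z ^ j))"
  have abs: "(\<lambda>x. norm (t x)) summable_on UNIV"
  proof (rule abs_summable_on_nat_prod)
    let ?F = "\<lambda>l. 2 ^ m * C * ((real l + 1) powr s * (2 * norm z) ^ l)" and ?G = "\<lambda>j. (2 * norm z) ^ j"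
    show "summable ?F" using z by (intro summable_mult summable_powr_geometric) auto
    show "summable ?G" using z by (intro summable_geometric) auto
    show "?F l \<ge> 0" "?G l \<ge> 0" for l using C by auto
    fix l j
    have "norm (t (l, j)) = norm (d l) * norm z ^ l * (norm (pochhammer (a + of_nat l) j) / fact j * norm z ^ j)"
      by (simp add: t_def norm_mult norm_divide norm_power)
    also have "\<dots> \<le> (C * (real l + 1) powr s) * norm z ^ l * (2 ^ (m + l + j) * norm z ^ j)"
      using C by (intro mult_mono norm_pochhammer_shift_le m) auto
    also have "\<dots> = ?F l * ?G j" by (simp add: power_add power_mult_distrib)
    finally show "norm (t (l, j)) \<le> ?F l * ?G j" .
  qed
  have row: "(\<Sum>j. t (l, j)) = (1 - z) powr (- a) * (d l * (z / (z - 1)) ^ l)" for l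
  proof -
    have "(\<lambda>j. (- (a + of_nat l) gchoose j) * (- z) ^ j) sums (1 + (- z)) powr (- (a + of_nat l))"
      using z1 by (intro gen_binomial_complex) auto
    moreover have "(- (a + of_nat l) gchoose j) * (- z) ^ j = pochhammer (a + of_nat l) j / fact j * z ^ j" for j
    proof -
      have "(-1 :: complex) ^ j * (-1) ^ j = 1" by (simp add: power_mult_distrib[symmetric])
      thus ?thesis by (simp add: gbinomial_pochhammer power_minus[of z] mult_ac add_ac)
    qed
    ultimately have "(\<lambda>j. pochhammer (a + of_nat l) j / fact j * z ^ j) sums (1 - z) powr (- (a + of_nat l))" by simp
    hence "(\<Sum>j. t (l, j)) = d l * (- z) ^ l * (1 - z) powr (- (a + of_nat l))"
      unfolding t_def prod.case by (intro sums_unique[symmetric] sums_mult)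
    also have "(1 - z) powr (- (a + of_nat l)) = (1 - z) powr (- a) * (1 / (1 - z) ^ l)"
      using z1 by (simp add: powr_diff powr_nat' divide_inverse powr_minus[symmetric])
    also have "d l * (- z) ^ l * ((1 - z) powr (- a) * (1 / (1 - z) ^ l)) = (1 - z) powr (- a) * (d l * (- z / (1 - z)) ^ l)"
      unfolding power_divide by simp
    also have "- z / (1 - z) = z / (z - 1)" using z1 by (simp add: divide_simps) (simp add: algebra_simps)
    finally show ?thesis .
  qed
  have diag: "(\<Sum>l\<le>n. t (l, n - l)) = pochhammer a n * pochhammer b n / pochhammer c n * z ^ n / fact n" for n
  proof -
    have "t (l, n - l) = pochhammer a n * z ^ n / fact n * (pochhammer (c - b) l * pochhammer (- of_nat n) l / (fact l * pochhammer c l))"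
      if l: "l \<le> n" for l
    proof -
      have p: "pochhammer a l * pochhammer (a + of_nat l) (n - l) = pochhammer a n"
        using pochhammer_product[OF l, of a] by simp
      have q: "pochhammer (- of_nat n) l = (- 1) ^ l * (fact n / fact (n - l) :: complex)"
      proof -
        have "(fact n :: complex) = fact (n - l) * pochhammer (1 + of_nat (n - l)) l"
          using pochhammer_product[of "n - l" n "1 :: complex"] l by (simp add: pochhammer_fact)
        moreover have "pochhammer (- of_nat n :: complex) l = (- 1) ^ l * pochhammer (1 + of_nat (n - l)) l"
          using l by (simp add: pochhammer_minus of_nat_diff add_ac)
        ultimately show ?thesis by simp
      qed
      have zz: "(- z) ^ l * z ^ (n - l) = (- 1) ^ l * z ^ n"
        using l by (simp add: power_minus[of z] power_add[symmetric])
      have "t (l, n - l) = (pochhammer a l * pochhammer (a + of_nat l) (n - l)) * ((- z) ^ l * z ^ (n - l)) * pochhammer (c - b) l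
          / (pochhammer c l * fact l * fact (n - l))" by (simp add: t_def d_def)
      also have "\<dots> = pochhammer a n * ((- 1) ^ l * z ^ n) * pochhammer (c - b) l / (pochhammer c l * fact l * fact (n - l))"
        unfolding p zz ..
      also have "\<dots> = pochhammer a n * z ^ n / fact n * (pochhammer (c - b) l * pochhammer (- of_nat n) l / (fact l * pochhammer c l))"
        unfolding q by (simp add: mult_ac)
      finally show ?thesis .
    qed
    hence "(\<Sum>l\<le>n. t (l, n - l)) = pochhammer a n * z ^ n / fact n *
        (\<Sum>l\<le>n. pochhammer (c - b) l * pochhammer (- of_nat n) l / (fact l * pochhammer c l))"
      by (simp add: sum_distrib_left)
    also have "(\<Sum>l\<le>n. pochhammer (c - b) l * pochhammer (- of_nat n) l / (fact l * pochhammer c l)) = pochhammer (c - (c - b)) n / pochhammer c n"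
    proof -
      have "\<forall>i\<in>{0..<n}. c \<noteq> - of_nat i" using c by auto
      from Vandermonde_pochhammer[OF this, of "c - b"] show ?thesis by (simp add: atMost_atLeast0)
    qed
    finally show ?thesis by (simp add: mult_ac)
  qed
  have "(\<lambda>n. \<Sum>l\<le>n. t (l, n - l)) sums infsum t UNIV" by (rule double_series[OF abs])
  hence "(\<Sum>n. pochhammer a n * pochhammer b n / pochhammer c n * z ^ n / fact n) = infsum t UNIV"
    unfolding diag by (simp add: sums_iff)
  also have "infsum t UNIV = (\<Sum>l. \<Sum>j. t (l, j))" using double_series(4)[OF abs] by (simp add: sums_iff)
  also have "\<dots> = (1 - z) powr (- a) * (\<Sum>l. d l * (z / (z - 1)) ^ l)" unfolding row
  proof (rule suminf_mult)
    have zz: "norm (z / (z - 1)) < 1"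
    proof -
      have "1 - norm z \<le> norm (z - 1)" using norm_triangle_ineq2[of 1 z] by (simp add: norm_minus_commute)
      thus ?thesis using z by (simp add: norm_divide divide_simps)
    qed
    show "summable (\<lambda>l. d l * (z / (z - 1)) ^ l)"
      unfolding d_def by (rule summable_norm_cancel[OF hypergeometric_summable[OF c zz]])
  qed
  finally show ?thesis unfolding d_def .
qed

text \<open>
  The map \<open>z / (z - 1)\<close> takes the half plane \<open>Re z < 1/2\<close> into the unit disc.  This half plane is
  convex and contains 0 and all \<open>v \<le> 0\<close>, so the right-hand side of Pfaff's formula is an admissible
  continuation; the identity theorem on the intersection of two convex domains makes it the only one.
  At \<open>v = 1 - 1 / u\<close> one has \<open>1 - v = 1 / u\<close> and \<open>v / (v - 1) = 1 - u\<close>.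
\<close>

lemma hyp_2F1_negative_real:
  assumes c: "c \<notin> \<int>\<^sub>\<le>\<^sub>0" and u: "0 < u" "u \<le> 1"
  shows "hyp_2F1 a b c (of_real (1 - 1 / u)) = of_real u powr a *
     (\<Sum>l. pochhammer a l * pochhammer (c - b) l / (pochhammer c l * fact l) * of_real (1 - u) ^ l)"
proof -
  define d where "d = (\<lambda>l. pochhammer a l * pochhammer (c - b) l / (pochhammer c l * fact l))"
  define h where "h = (\<lambda>\<zeta>. \<Sum>l. d l * \<zeta> ^ l)"
  define f where "f = (\<lambda>z::complex. (1 - z) powr (- a) * h (z / (z - 1)))"
  define H where "H = {z::complex. Re z < 1/2}"
  define ser where "ser = (\<lambda>u::complex. (\<Sum>l. pochhammer a l * pochhammer b l / pochhammer c l * u ^ l / fact l))"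
  have hol_h: "h holomorphic_on ball 0 1"
  proof (rule power_series_holomorphic)
    fix w :: complex assume "w \<in> ball 0 1"
    hence "summable (\<lambda>l. d l * w ^ l)"
      unfolding d_def by (intro summable_norm_cancel[OF hypergeometric_summable[OF c]]) auto
    thus "(\<lambda>n. d n * (w - 0) ^ n) sums h w" unfolding h_def by (simp add: summable_sums)
  qed
  have maps: "z / (z - 1) \<in> ball 0 1" "1 - z \<notin> \<real>\<^sub>\<le>\<^sub>0" "z \<noteq> 1" if "z \<in> H" for z
  proof -
    have "(norm z)\<^sup>2 < (norm (z - 1))\<^sup>2"
      using that unfolding cmod_power2 H_def by (simp add: power2_eq_square algebra_simps)
    hence "norm z < norm (z - 1)" by (rule power2_less_imp_less) simp
    thus "z / (z - 1) \<in> ball 0 1" by (auto simp: norm_divide divide_simps)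
    show "1 - z \<notin> \<real>\<^sub>\<le>\<^sub>0" "z \<noteq> 1" using that by (auto simp: H_def complex_nonpos_Reals_iff)
  qed
  have H: "open H" "convex H" "0 \<in> H"
    unfolding H_def by (rule open_halfspace_Re_lt, rule convex_halfspace_Re_lt, simp)
  have hol_f: "f holomorphic_on H"
    unfolding f_def
    by (intro holomorphic_intros holomorphic_on_compose_gen[OF _ hol_h, unfolded o_def])
       (use maps in auto)
  have near: "\<forall>\<^sub>F z in nhds 0. f z = ser z"
  proof -
    have "eventually (\<lambda>z. z \<in> ball 0 (1/3 :: real)) (nhds (0::complex))" by (intro eventually_nhds_in_open) auto
    thus ?thesis
    proof eventually_elim
      case (elim z)
      hence "norm z < 1 / 3" by simp
      from pfaff_near_0[OF c this, of a b] show ?case unfolding f_def ser_def h_def d_def by (rule sym)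
    qed
  qed
  let ?v = "of_real (1 - 1 / u) :: complex"
  have vH: "?v \<in> H" using u by (simp add: H_def field_simps)
  have "hyp_2F1 a b c ?v = f ?v" unfolding hyp_2F1_def
  proof (rule the_equality)
    show "\<exists>S g. open S \<and> convex S \<and> 0 \<in> S \<and> ?v \<in> S \<and> g holomorphic_on S \<and>
        (\<forall>\<^sub>F u in nhds 0. g u = (\<Sum>l. pochhammer a l * pochhammer b l / pochhammer c l * u ^ l / fact l)) \<and> f ?v = g ?v"
      using H vH hol_f near unfolding ser_def by (intro exI[of _ H] exI[of _ f]) auto
  next
    fix w assume "\<exists>S g. open S \<and> convex S \<and> 0 \<in> S \<and> ?v \<in> S \<and> g holomorphic_on S \<and>
        (\<forall>\<^sub>F u in nhds 0. g u = (\<Sum>l. pochhammer a l * pochhammer b l / pochhammer c l * u ^ l / fact l)) \<and> w = g ?v"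
    then obtain S g where S: "open S" "convex S" "0 \<in> S" "?v \<in> S" "g holomorphic_on S"
      and g: "\<forall>\<^sub>F u in nhds 0. g u = ser u" and w: "w = g ?v" unfolding ser_def by blast
    have "\<forall>\<^sub>F u in nhds 0. g u = f u \<and> u \<in> H \<inter> S"
    proof -
      have "\<forall>\<^sub>F u in nhds 0. u \<in> H \<inter> S" using S H by (intro eventually_nhds_in_open open_Int) auto
      with g near show ?thesis by eventually_elim simp
    qed
    then obtain T where T: "open T" "0 \<in> T" "\<And>u. u \<in> T \<Longrightarrow> g u = f u \<and> u \<in> H \<inter> S"
      unfolding eventually_nhds by blast
    have "g ?v = f ?v"
    proof (rule analytic_continuation_open[of T "H \<inter> S" g f ?v])
      show "connected (H \<inter> S)" using H S by (intro convex_connected convex_Int)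
      show "g holomorphic_on H \<inter> S" "f holomorphic_on H \<inter> S"
        using S(5) hol_f holomorphic_on_subset by blast+
    qed (use T S H vH in auto)
    thus "w = f ?v" using w by simp
  qed
  also have "f ?v = of_real u powr a * h (of_real (1 - u))"
  proof -
    have "1 - ?v = of_real (1 / u)" by simp
    moreover have "of_real (1 / u) powr (- a) = of_real u powr a"
    proof -
      have "Ln (of_real (1 / u)) = - of_real (ln u)" using u by (subst Ln_of_real) (auto simp: ln_div)
      moreover have "Ln (of_real u) = of_real (ln u)" using u by (subst Ln_of_real) auto
      ultimately show ?thesis using u by (simp add: powr_def del: of_real_divide)
    qed
    moreover have "?v / (?v - 1) = of_real (1 - u)" using u by (simp add: field_simps)
    ultimately show ?thesis unfolding f_def by metis
  qed
  finally show ?thesis unfolding h_def d_def .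
qed

section \<open>Kernels with a power series at the right end point\<close>

lemma norm_of_real_powr: "u \<ge> 0 \<Longrightarrow> norm (of_real u powr s :: complex) = u powr Re s"
  by (simp add: norm_powr_real_powr)

lemma of_real_powr_has_vector_derivative:
  fixes s :: complex
  assumes "u > 0"
  shows "((\<lambda>u. of_real u powr s) has_vector_derivative s * of_real u powr (s - 1)) (at u within A)"
  by (rule has_vector_derivative_real_field[where f = "\<lambda>z::complex. z powr s"], rule has_field_derivative_powr) (use assms in auto)

lemma continuous_on_of_real_powr:
  "continuous_on {0<..} (\<lambda>u. of_real u powr (s :: complex))"
  by (intro continuous_on_powr_complex continuous_intros) auto

lemma continuous_on_of_real_powr_0:
  "Re s > 0 \<Longrightarrow> continuous_on {0..} (\<lambda>u. of_real u powr (s :: complex))"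
  by (intro continuous_on_powr_complex continuous_intros) auto

lemma set_integrable_unit_real:
  assumes "a > 0" "b > (0::real)"
  shows "set_integrable lborel {0<..<1} (\<lambda>u. u powr (a - 1) * (1 - u) powr (b - 1))"
  by (rule set_integrable_subset[OF integrable_Beta[OF assms]]) auto

text \<open>
  All integrands on the unit interval below are compared with Euler's Beta integrand.
\<close>

lemma set_integrable_unit_dominated:
  fixes f :: "real \<Rightarrow> complex"
  assumes cont: "continuous_on {0<..<1} f" and ab: "a > 0" "b > (0::real)"
    and le: "\<And>u. 0 < u \<Longrightarrow> u < 1 \<Longrightarrow> norm (f u) \<le> C * (u powr (a - 1) * (1 - u) powr (b - 1))"
  shows "set_integrable lborel {0<..<1} f"
proof (rule set_integrable_bound)
  show "set_integrable lborel {0<..<1} (\<lambda>u. C * (u powr (a - 1) * (1 - u) powr (b - 1)))"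
    by (intro set_integrable_mult_right impI set_integrable_unit_real ab)
  show "set_borel_measurable lborel {0<..<1} f"
    unfolding set_borel_measurable_def using cont by (simp add: borel_measurable_continuous_on_indicator)
  show "AE x in lborel. x \<in> {0<..<1} \<longrightarrow> norm (f x) \<le> norm (C * (x powr (a - 1) * (1 - x) powr (b - 1)))"
    by (intro AE_I2 impI order_trans[OF le]) auto
qed

lemma power_integral_unit:
  fixes s :: complex
  assumes s: "Re s > 0"
  shows "set_integrable lborel {0<..<1} (\<lambda>u. of_real u powr (s - 1))"
    and "(LBINT u:{0<..<1}. of_real u powr (s - 1)) = 1 / s"
    and "(LBINT u:{0<..<1}. norm (of_real u powr (s - 1))) = 1 / Re s"
proof -
  have int: "set_integrable lborel {0<..<1} (\<lambda>u. of_real u powr (s - 1))" if "Re s > 0" for s :: complex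
    by (rule set_integrable_unit_dominated[where a = "Re s" and b = 1 and C = 1])
       (use that in \<open>auto simp: norm_of_real_powr intro!: continuous_on_subset[OF continuous_on_of_real_powr]\<close>)
  have val: "(LBINT u:{0<..<1}. of_real u powr (s - 1)) = 1 / s" if s: "Re s > 0" for s :: complex
  proof -
    have s0: "s \<noteq> 0" using s by auto
    have "((\<lambda>u. of_real u powr (s - 1)) has_integral (of_real 1 powr s / s - of_real 0 powr s / s)) {0..1}"
    proof (rule fundamental_theorem_of_calculus_interior)
      show "continuous_on {0..1} (\<lambda>u. of_real u powr s / s)"
        by (intro continuous_intros continuous_on_subset[OF continuous_on_of_real_powr_0[OF s]]) (use s0 in auto)
      show "((\<lambda>u. of_real u powr s / s) has_vector_derivative of_real u powr (s - 1)) (at u)" if "u \<in> {0<..<1}" for u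
      proof -
        have "((\<lambda>u. of_real u powr s / s) has_vector_derivative (s * of_real u powr (s - 1)) / s) (at u)"
          by (intro has_vector_derivative_divide of_real_powr_has_vector_derivative) (use that in auto)
        thus ?thesis using s0 by simp
      qed
    qed simp
    hence "((\<lambda>u. of_real u powr (s - 1)) has_integral (1 / s)) {0<..<1}"
      using s0 by (simp add: has_integral_Icc_iff_Ioo)
    thus ?thesis using set_borel_integral_eq_integral(2)[OF int[OF s]] by (simp add: integral_unique)
  qed
  show "set_integrable lborel {0<..<1} (\<lambda>u. of_real u powr (s - 1))" by (rule int[OF s])
  show "(LBINT u:{0<..<1}. of_real u powr (s - 1)) = 1 / s" by (rule val[OF s])
  have "(LBINT u:{0<..<1}. norm (of_real u powr (s - 1))) = (LBINT u:{0<..<1}. Re (of_real u powr (of_real (Re s) - 1)))"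
  proof (rule set_lebesgue_integral_cong)
    show "\<forall>u. u \<in> {0<..<1} \<longrightarrow> norm (of_real u powr (s - 1)) = Re (of_real u powr (of_real (Re s) - 1))"
    proof safe
      fix u :: real assume u: "u \<in> {0<..<1}"
      have "of_real u powr (of_real (Re s) - 1) = (of_real (u powr (Re s - 1)) :: complex)"
        using u by (subst of_real_1[symmetric], subst of_real_diff[symmetric], subst powr_of_real) auto
      thus "norm (of_real u powr (s - 1)) = Re (of_real u powr (of_real (Re s) - 1))"
        using u by (simp add: norm_of_real_powr)
    qed
  qed simp
  also have "\<dots> = Re (LBINT u:{0<..<1}. of_real u powr (of_real (Re s) - 1))"
  proof -
    have "integrable lborel (\<lambda>u. indicator {0<..<1} u *\<^sub>R (of_real u powr (of_real (Re s) - 1) :: complex))"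
      using int[of "of_real (Re s)"] s by (simp add: set_integrable_def)
    from integral_Re[OF this] show ?thesis by (simp add: set_lebesgue_integral_def)
  qed
  also have "\<dots> = Re (1 / of_real (Re s))" by (subst val) (use s in auto)
  finally show "(LBINT u:{0<..<1}. norm (of_real u powr (s - 1))) = 1 / Re s" by simp
qed

text \<open>
  Expanding \<open>(1 - u) powr (b - 1)\<close> and integrating term by term gives \<open>\<Sum> (1 - b)\<^sub>n / (n! (a + n))\<close>, which is
  Gauss' series with parameters \<open>1 - b\<close>, \<open>a\<close> and \<open>a + 1\<close>.
\<close>

theorem complex_Beta_integral:
  fixes a b :: complex
  assumes a: "Re a > 0" and b: "Re b > 0"
  shows "set_integrable lborel {0<..<1} (\<lambda>u. of_real u powr (a - 1) * of_real (1 - u) powr (b - 1))"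
    and "(LBINT u:{0<..<1}. of_real u powr (a - 1) * of_real (1 - u) powr (b - 1)) = Gamma a * Gamma b * rGamma (a + b)"
proof -
  have an: "a \<notin> \<int>\<^sub>\<le>\<^sub>0" using a Re_pos_not_nonpos_Int by blast
  show "set_integrable lborel {0<..<1} (\<lambda>u. of_real u powr (a - 1) * of_real (1 - u) powr (b - 1))"
  proof (rule set_integrable_unit_dominated[where a = "Re a" and b = "Re b" and C = 1])
    show "continuous_on {0<..<1} (\<lambda>u. of_real u powr (a - 1) * of_real (1 - u) powr (b - 1))"
      by (intro continuous_intros continuous_on_subset[OF continuous_on_of_real_powr]
          continuous_on_compose2[OF continuous_on_of_real_powr, of _ "\<lambda>u. 1 - u"]) auto
  qed (use a b in \<open>auto simp: norm_mult norm_of_real_powr simp del: of_real_diff\<close>)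
  define d where "d = (\<lambda>n. pochhammer (1 - b) n / fact n)"
  define f where "f = (\<lambda>n u. d n * of_real u powr (a + of_nat n - 1))"
  have ser: "(\<lambda>n. f n u) sums (of_real u powr (a - 1) * of_real (1 - u) powr (b - 1))" if u: "0 < u" "u < 1" for u
  proof -
    have "(\<lambda>n. ((b - 1) gchoose n) * (- of_real u) ^ n) sums (1 + (- of_real u)) powr (b - 1)"
      using u by (intro gen_binomial_complex) auto
    hence "(\<lambda>n. of_real u powr (a - 1) * (((b - 1) gchoose n) * (- of_real u) ^ n)) sums (of_real u powr (a - 1) * (1 + (- of_real u)) powr (b - 1))"
      by (rule sums_mult)
    moreover have "of_real u powr (a - 1) * (((b - 1) gchoose n) * (- of_real u) ^ n) = f n u" for n
    proof -
      have "(-1 :: complex) ^ n * (-1) ^ n = 1" by (simp add: power_mult_distrib[symmetric])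
      moreover have "of_real u powr (a + of_nat n - 1) = of_real u powr (a - 1) * of_real u ^ n"
      proof -
        have "of_real u powr (a + of_nat n - 1) = of_real u powr ((a - 1) + of_nat n)" by (simp add: algebra_simps)
        also have "\<dots> = of_real u powr (a - 1) * of_real u powr (of_nat n)" by (rule powr_add)
        also have "of_real u powr (of_nat n) = (of_real u :: complex) ^ n" using u by (simp add: powr_nat')
        finally show ?thesis .
      qed
      ultimately show ?thesis
        by (simp add: f_def d_def gbinomial_pochhammer power_minus[of "of_real u"] mult_ac)
    qed
    ultimately show ?thesis by simp
  qed
  have intf: "integrable lborel (\<lambda>u. indicator {0<..<1} u *\<^sub>R f n u)" for n
  proof -
    have "set_integrable lborel {0<..<1} (\<lambda>u. d n * of_real u powr (a + of_nat n - 1))"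
      by (intro set_integrable_mult_right impI power_integral_unit(1)) (use a in auto)
    thus ?thesis by (simp add: f_def set_integrable_def)
  qed
  have nf: "(LBINT u. norm (indicator {0<..<1} u *\<^sub>R f n u)) = norm (d n) / (Re a + n)" for n
  proof -
    have "(LBINT u. norm (indicator {0<..<1} u *\<^sub>R f n u)) = (LBINT u:{0<..<1}. norm (d n) * norm (of_real u powr (a + of_nat n - 1)))"
      unfolding set_lebesgue_integral_def f_def norm_mult norm_scaleR real_scaleR_def by (simp only: abs_indicator)
    also have "\<dots> = norm (d n) * (1 / Re (a + of_nat n))"
      by (subst set_integral_mult_right, subst power_integral_unit(3)) (use a in auto)
    finally show ?thesis by simp
  qed
  have vf: "(LBINT u. indicator {0<..<1} u *\<^sub>R f n u) = d n / (a + of_nat n)" for n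
  proof -
    have "(LBINT u. indicator {0<..<1} u *\<^sub>R f n u) = (LBINT u:{0<..<1}. d n * of_real u powr (a + of_nat n - 1))"
      unfolding set_lebesgue_integral_def f_def ..
    also have "\<dots> = d n * (1 / (a + of_nat n))"
      by (subst set_integral_mult_right, subst power_integral_unit(2)) (use a in auto)
    finally show ?thesis by simp
  qed
  obtain C where C: "C > 0" "\<And>n. norm (pochhammer (1 - b) n) \<le> C * fact n * (real n + 1) powr (Re (1 - b) - 1)"
    using pochhammer_upper by blast
  define K where "K = C * (1 + 1 / Re a)"
  have dn: "norm (d n) / (Re a + n) \<le> K * (real n + 1) powr (- Re b - 1)" for n
  proof -
    have "real n + 1 \<le> (1 + 1 / Re a) * (Re a + n)" using a by (simp add: field_simps)
    hence i: "1 / (Re a + n) \<le> (1 + 1 / Re a) / (real n + 1)"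
    proof -
      have X: "Re a + n > 0" using a by simp
      have "(real n + 1) / (Re a + n) \<le> 1 + 1 / Re a"
        using \<open>real n + 1 \<le> _\<close> X by (simp only: pos_divide_le_eq)
      hence "(real n + 1) / (Re a + n) / (real n + 1) \<le> (1 + 1 / Re a) / (real n + 1)" by (rule divide_right_mono) simp
      moreover have "x / y / x = 1 / y" if "x \<noteq> 0" for x y :: real using that by simp
      ultimately show ?thesis by (metis of_nat_Suc of_nat_neq_0 add.commute)
    qed
    have "norm (d n) \<le> C * (real n + 1) powr (- Re b)"
      using C(2)[of n] by (simp add: d_def norm_divide field_simps)
    hence "norm (d n) * (1 / (Re a + n)) \<le> (C * (real n + 1) powr (- Re b)) * ((1 + 1 / Re a) / (real n + 1))"
      using a C(1) i by (intro mult_mono) auto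
    also have "\<dots> = K * (real n + 1) powr (- Re b - 1)"
      using powr_diff[of "real n + 1" "- Re b" 1] by (simp add: K_def)
    finally show ?thesis by simp
  qed
  have sn: "summable (\<lambda>n. LBINT u. norm (indicator {0<..<1} u *\<^sub>R f n u))"
    unfolding nf
  proof (rule summable_comparison_test'[where N = 0])
    show "summable (\<lambda>n. K * (real n + 1) powr (- Re b - 1))"
      by (intro summable_mult summable_powr_shift) (use b in auto)
    show "norm (norm (d n) / (Re a + n)) \<le> K * (real n + 1) powr (- Re b - 1)" for n
      using dn[of n] a by simp
  qed
  have pt: "AE u in lborel. summable (\<lambda>n. norm (indicator {0<..<1} u *\<^sub>R f n u))"
  proof (rule AE_I2)
    fix u :: real
    show "summable (\<lambda>n. norm (indicator {0<..<1} u *\<^sub>R f n u))"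
    proof (cases "u \<in> {0<..<1}")
      case True
      hence u: "0 < u" "u < 1" by auto
      have "summable (\<lambda>n. (C * u powr (Re a - 1)) * ((real n + 1) powr (- Re b) * u ^ n))"
        using u by (intro summable_mult summable_powr_geometric) auto
      thus ?thesis
      proof (rule summable_comparison_test'[where N = 0])
        fix n
        have "norm (d n) \<le> C * (real n + 1) powr (- Re b)"
          using C(2)[of n] by (simp add: d_def norm_divide field_simps)
        moreover have "norm (of_real u powr (a + of_nat n - 1)) = u powr (Re a - 1) * u ^ n"
        proof -
          have "norm (of_real u powr (a + of_nat n - 1)) = u powr ((Re a - 1) + n)"
            using u by (simp add: norm_of_real_powr algebra_simps)
          thus ?thesis using u by (simp add: powr_add powr_realpow)
        qed
        ultimately have "norm (f n u) \<le> (C * (real n + 1) powr (- Re b)) * (u powr (Re a - 1) * u ^ n)"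
          unfolding f_def norm_mult using u C(1) by (intro mult_mono) auto
        thus "norm (norm (indicator {0<..<1} u *\<^sub>R f n u)) \<le> (C * u powr (Re a - 1)) * ((real n + 1) powr (- Re b) * u ^ n)"
          using True by (simp add: mult_ac)
      qed
    qed simp
  qed
  have "(\<lambda>n. LBINT u. indicator {0<..<1} u *\<^sub>R f n u) sums (LBINT u. \<Sum>n. indicator {0<..<1} u *\<^sub>R f n u)"
    by (rule sums_integral[OF intf pt sn])
  also have "(\<lambda>u. \<Sum>n. indicator {0<..<1} u *\<^sub>R f n u) = (\<lambda>u. indicator {0<..<1} u *\<^sub>R (of_real u powr (a - 1) * of_real (1 - u) powr (b - 1)))"
    by (rule ext) (auto simp: indicator_def sums_unique[OF ser, symmetric] simp del: of_real_diff)
  finally have s1: "(\<lambda>n. d n / (a + of_nat n)) sums (LBINT u:{0<..<1}. of_real u powr (a - 1) * of_real (1 - u) powr (b - 1))"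
    unfolding vf by (simp add: set_lebesgue_integral_def)
  have "gauss_term (1 - b) a (a + 1) sums (Gamma (a + 1 - (1 - b) - a) * rGamma (a + 1 - (1 - b)) * rGamma (a + 1 - a))"
    by (rule gauss_summation) (use b in auto)
  hence "(\<lambda>n. Gamma a * gauss_term (1 - b) a (a + 1) n) sums (Gamma a * (Gamma b * rGamma (a + b)))"
    by (intro sums_mult) simp
  moreover have "Gamma a * gauss_term (1 - b) a (a + 1) n = d n / (a + of_nat n)" for n
  proof -
    have an': "a + of_nat n \<noteq> 0" using a by (auto simp: complex_eq_iff)
    have "rGamma a = pochhammer a (Suc n) * rGamma (a + of_nat (Suc n))" by (rule pochhammer_rGamma)
    hence "1 = Gamma a * (pochhammer a n * (a + of_nat n) * rGamma (a + 1 + of_nat n))"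
      using an by (simp add: pochhammer_Suc rGamma_inverse_Gamma Gamma_eq_zero_iff field_simps)
    hence "Gamma a * (pochhammer a n * rGamma (a + 1 + of_nat n)) = 1 / (a + of_nat n)"
      using an' by (simp add: field_simps)
    moreover have "Gamma a * gauss_term (1 - b) a (a + 1) n = d n * (Gamma a * (pochhammer a n * rGamma (a + 1 + of_nat n)))"
      unfolding gauss_term_def d_def by (simp only: times_divide_eq_left times_divide_eq_right mult_ac)
    ultimately show ?thesis by simp
  qed
  ultimately have "(\<lambda>n. d n / (a + of_nat n)) sums (Gamma a * (Gamma b * rGamma (a + b)))" by simp
  from sums_unique2[OF s1 this]
  show "(LBINT u:{0<..<1}. of_real u powr (a - 1) * of_real (1 - u) powr (b - 1)) = Gamma a * Gamma b * rGamma (a + b)"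
    by (simp add: mult.assoc)
qed

text \<open>
  \<open>r\<close> is an abscissa of convergence: a kernel with exponent \<open>e\<close> and these coefficients is
  \<open>O(u powr (Re e - r))\<close> at \<open>u = 0\<close>, and its Mellin transform converges where \<open>Re (\<rho> + e) > r\<close>.
\<close>

definition tempered :: "(nat \<Rightarrow> complex) \<Rightarrow> real \<Rightarrow> bool" where
  "tempered c r \<longleftrightarrow> r > 0 \<and> summable (\<lambda>n. norm (c n) * (real n + 1) powr (- r))"

definition ser_kernel :: "complex \<Rightarrow> complex \<Rightarrow> (nat \<Rightarrow> complex) \<Rightarrow> real \<Rightarrow> complex" where
  "ser_kernel e g c u = of_real u powr e * of_real (1 - u) powr (g - 1) * (\<Sum>n. c n * of_real (1 - u) ^ n)"

definition ser_kernel_deriv :: "complex \<Rightarrow> complex \<Rightarrow> (nat \<Rightarrow> complex) \<Rightarrow> real \<Rightarrow> complex" where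
  "ser_kernel_deriv e g c u =
     (e * of_real u powr (e - 1) * of_real (1 - u) powr (g - 1) - of_real u powr e * ((g - 1) * of_real (1 - u) powr (g - 2)))
        * (\<Sum>n. c n * of_real (1 - u) ^ n)
     - of_real u powr e * of_real (1 - u) powr (g - 1) * (\<Sum>n. diffs c n * of_real (1 - u) ^ n)"

lemma tempered_bounds:
  assumes "tempered c r"
  shows "\<exists>C>0. \<forall>u. 0 < u \<longrightarrow> u \<le> 1 \<longrightarrow>
    summable (\<lambda>n. norm (c n) * (1 - u) ^ n) \<and>
    (\<Sum>n. norm (c n) * (1 - u) ^ n) \<le> C * u powr (- r) \<and>
    summable (\<lambda>n. norm (diffs c n) * (1 - u) ^ n) \<and>
    (\<Sum>n. norm (diffs c n) * (1 - u) ^ n) \<le> C * u powr (- r - 1)"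
proof -
  define a where "a = (\<lambda>n. norm (c n) * (real n + 1) powr (- r))"
  have r: "r > 0" and sa: "summable a" using assms by (auto simp: tempered_def a_def)
  have an: "a n \<ge> 0" for n by (simp add: a_def)
  obtain C1 where C1: "C1 > 0" "\<And>n u. 0 < u \<Longrightarrow> u \<le> 1 \<Longrightarrow> (real n + 1) powr r * (1 - u) ^ n \<le> C1 * u powr (- r)"
    using powr_times_power_bound[of r] r by auto
  obtain C2 where C2: "C2 > 0" "\<And>n u. 0 < u \<Longrightarrow> u \<le> 1 \<Longrightarrow> (real n + 1) powr (r + 1) * (1 - u) ^ n \<le> C2 * u powr (- (r + 1))"
    using powr_times_power_bound[of "r + 1"] r by auto
  define C where "C = (C1 + 2 powr r * C2) * (suminf a + 1)"
  have sg: "suminf a \<ge> 0" using sa an by (intro suminf_nonneg) auto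
  have sa': "summable (\<lambda>n. a (Suc n))" using sa by (simp add: summable_Suc_iff)
  have sg': "suminf (\<lambda>n. a (Suc n)) \<le> suminf a" using suminf_split_head[OF sa] an[of 0] by simp
  have le1: "norm (c n) * (1 - u) ^ n \<le> C1 * u powr (- r) * a n" if u: "0 < u" "u \<le> 1" for n u
  proof -
    have "norm (c n) * (1 - u) ^ n = a n * ((real n + 1) powr r * (1 - u) ^ n)"
      by (simp add: a_def powr_minus field_simps)
    also have "\<dots> \<le> a n * (C1 * u powr (- r))" by (intro mult_left_mono C1 u an)
    finally show ?thesis by (simp add: mult_ac)
  qed
  have le2: "norm (diffs c n) * (1 - u) ^ n \<le> 2 powr r * C2 * u powr (- r - 1) * a (Suc n)" if u: "0 < u" "u \<le> 1" for n u
  proof -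
    have "(real n + 2) powr r \<le> (2 * (real n + 1)) powr r" using r by (intro powr_mono2) auto
    also have "\<dots> = 2 powr r * (real n + 1) powr r" by (rule powr_mult)
    finally have p: "(real n + 2) powr r \<le> 2 powr r * (real n + 1) powr r" .
    have "norm (diffs c n) = (real n + 1) * norm (c (Suc n))"
      by (simp add: diffs_def norm_mult) (metis norm_of_nat of_nat_Suc add.commute)
    hence "norm (diffs c n) * (1 - u) ^ n = (real n + 1) * (a (Suc n) * (real n + 2) powr r) * (1 - u) ^ n"
      by (simp add: a_def powr_minus field_simps)
    also have "\<dots> \<le> (real n + 1) * (a (Suc n) * (2 powr r * (real n + 1) powr r)) * (1 - u) ^ n"
      using u an by (intro mult_left_mono mult_right_mono p) auto
    also have "\<dots> = 2 powr r * a (Suc n) * ((real n + 1) powr (r + 1) * (1 - u) ^ n)"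
      by (simp add: powr_add mult_ac)
    also have "\<dots> \<le> 2 powr r * a (Suc n) * (C2 * u powr (- (r + 1)))"
      using an by (intro mult_left_mono C2 u) auto
    finally show ?thesis by (simp add: mult_ac)
  qed
  have C: "C > 0" unfolding C_def
  proof (rule mult_pos_pos)
    show "C1 + 2 powr r * C2 > 0" using C1(1) C2(1) by (intro add_pos_pos mult_pos_pos) auto
    show "suminf a + 1 > 0" using sg by linarith
  qed
  show ?thesis
  proof (intro exI[of _ C] conjI C allI impI)
    fix u :: real assume u: "0 < u" "u \<le> 1"
    have sm: "summable (\<lambda>n. C1 * u powr (- r) * a n)" "summable (\<lambda>n. 2 powr r * C2 * u powr (- r - 1) * a (Suc n))"
      by (intro summable_mult sa sa')+
    show s1: "summable (\<lambda>n. norm (c n) * (1 - u) ^ n)"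
      by (rule summable_comparison_test'[OF sm(1), where N = 0]) (use le1[OF u] u in simp)
    show s2: "summable (\<lambda>n. norm (diffs c n) * (1 - u) ^ n)"
      by (rule summable_comparison_test'[OF sm(2), where N = 0]) (use le2[OF u] u in simp)
    have "(\<Sum>n. norm (c n) * (1 - u) ^ n) \<le> C1 * u powr (- r) * suminf a"
      using suminf_le[OF le1[OF u] s1 sm(1)] suminf_mult[OF sa] by simp
    also have "\<dots> = (C1 * suminf a) * u powr (- r)" by simp
    also have "\<dots> \<le> C * u powr (- r)"
      unfolding C_def using C1 C2 sg by (intro mult_right_mono mult_mono) auto
    finally show "(\<Sum>n. norm (c n) * (1 - u) ^ n) \<le> C * u powr (- r)" .
    have "(\<Sum>n. norm (diffs c n) * (1 - u) ^ n) \<le> 2 powr r * C2 * u powr (- r - 1) * (\<Sum>n. a (Suc n))"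
      using suminf_le[OF le2[OF u] s2 sm(2)] suminf_mult[OF sa'] by simp
    also have "\<dots> \<le> 2 powr r * C2 * u powr (- r - 1) * suminf a"
      using C2 sg' by (intro mult_left_mono) auto
    also have "\<dots> = (2 powr r * C2 * suminf a) * u powr (- r - 1)" by simp
    also have "\<dots> \<le> C * u powr (- r - 1)"
      unfolding C_def using C1 C2 sg by (intro mult_right_mono mult_mono) auto
    finally show "(\<Sum>n. norm (diffs c n) * (1 - u) ^ n) \<le> C * u powr (- r - 1)" .
  qed
qed

lemma tempered_summable:
  assumes "tempered c r" "norm z < 1"
  shows "summable (\<lambda>n. norm (c n * z ^ n))"
proof -
  obtain C where C: "C > 0"
    "\<And>u. 0 < u \<Longrightarrow> u \<le> 1 \<Longrightarrow> summable (\<lambda>n. norm (c n) * (1 - u) ^ n)"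
    "\<And>u. 0 < u \<Longrightarrow> u \<le> 1 \<Longrightarrow> (\<Sum>n. norm (c n) * (1 - u) ^ n) \<le> C * u powr (- r)"
    "\<And>u. 0 < u \<Longrightarrow> u \<le> 1 \<Longrightarrow> summable (\<lambda>n. norm (diffs c n) * (1 - u) ^ n)"
    "\<And>u. 0 < u \<Longrightarrow> u \<le> 1 \<Longrightarrow> (\<Sum>n. norm (diffs c n) * (1 - u) ^ n) \<le> C * u powr (- r - 1)"
  proof -
    obtain C where "C > 0" and *: "\<forall>u. 0 < u \<longrightarrow> u \<le> 1 \<longrightarrow>
    summable (\<lambda>n. norm (c n) * (1 - u) ^ n) \<and>
    (\<Sum>n. norm (c n) * (1 - u) ^ n) \<le> C * u powr (- r) \<and>
    summable (\<lambda>n. norm (diffs c n) * (1 - u) ^ n) \<and>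
    (\<Sum>n. norm (diffs c n) * (1 - u) ^ n) \<le> C * u powr (- r - 1)"
      using tempered_bounds[OF assms(1)] by blast
    show ?thesis by (rule that[OF \<open>C > 0\<close>]) (use * in blast)+
  qed
  from C(2)[of "1 - norm z"] assms(2) show ?thesis by (simp add: norm_mult norm_power)
qed

lemma ser_kernel_has_vector_derivative:
  assumes t: "tempered c r" and u: "0 < u" "u < 1"
  shows "(ser_kernel e g c has_vector_derivative ser_kernel_deriv e g c u) (at u)"
proof -
  have 1: "((\<lambda>u. of_real u powr e) has_vector_derivative e * of_real u powr (e - 1)) (at u)"
    by (rule of_real_powr_has_vector_derivative[OF u(1)])
  have 2: "((\<lambda>u. of_real (1 - u) powr (g - 1)) has_vector_derivative - ((g - 1) * of_real (1 - u) powr (g - 2))) (at u)"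
  proof -
    have "((\<lambda>v. of_real v powr (g - 1)) has_vector_derivative (g - 1) * of_real (1 - u) powr (g - 2)) (at (1 - u))"
      using of_real_powr_has_vector_derivative[of "1 - u" "g - 1" UNIV] u by simp
    moreover have "((\<lambda>u. 1 - u) has_vector_derivative -1) (at u)" by (auto intro!: derivative_eq_intros)
    ultimately have "((\<lambda>v. of_real v powr (g - 1)) \<circ> (\<lambda>u. 1 - u) has_vector_derivative (-1) *\<^sub>R ((g - 1) * of_real (1 - u) powr (g - 2))) (at u)"
      by (intro vector_diff_chain_at) auto
    thus ?thesis by (simp add: o_def)
  qed
  have 3: "((\<lambda>u. \<Sum>n. c n * of_real (1 - u) ^ n) has_vector_derivative - (\<Sum>n. diffs c n * of_real (1 - u) ^ n)) (at u)"
  proof -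
    have "((\<lambda>z. \<Sum>n. c n * z ^ n) has_field_derivative (\<Sum>n. diffs c n * of_real (1 - u) ^ n)) (at (of_real (1 - u)))"
      using u by (intro termdiffs_strong'[where K = 1] summable_norm_cancel[OF tempered_summable[OF t]])
        (auto simp del: of_real_diff)
    moreover have "((\<lambda>u. of_real (1 - u) :: complex) has_vector_derivative -1) (at u)"
      by (auto intro!: derivative_eq_intros)
    ultimately have "((\<lambda>z. \<Sum>n. c n * z ^ n) \<circ> (\<lambda>u. of_real (1 - u)) has_vector_derivative (-1) * (\<Sum>n. diffs c n * of_real (1 - u) ^ n)) (at u)"
      by (intro field_vector_diff_chain_at) auto
    thus ?thesis by (simp add: o_def)
  qed
  show ?thesis unfolding ser_kernel_def[abs_def] ser_kernel_deriv_def
    by (rule has_vector_derivative_eq_rhs[OF has_vector_derivative_mult[OF has_vector_derivative_mult[OF 1 2] 3]])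
       (simp add: algebra_simps)
qed

lemma tempered_series_continuous:
  assumes t: "tempered c r"
  shows "continuous_on {0<..1} (\<lambda>u. \<Sum>n. c n * of_real (1 - u) ^ n)"
    and "continuous_on {0<..1} (\<lambda>u. \<Sum>n. diffs c n * of_real (1 - u) ^ n)"
proof -
  have *: "continuous_on {0<..1} (\<lambda>u. \<Sum>n. d n * of_real (1 - u) ^ n)" if d: "\<And>z. norm z < 1 \<Longrightarrow> summable (\<lambda>n. d n * z ^ n)" for d :: "nat \<Rightarrow> complex"
  proof -
    have "(\<lambda>z. \<Sum>n. d n * z ^ n) holomorphic_on ball 0 1"
      by (rule power_series_holomorphic[where a = d]) (use d in \<open>auto simp: summable_sums\<close>)
    hence c: "continuous_on (ball 0 1) (\<lambda>z. \<Sum>n. d n * z ^ n)" by (rule holomorphic_on_imp_continuous_on)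
    have "continuous_on {0<..1} (\<lambda>u. of_real (1 - u) :: complex)" by (intro continuous_intros)
    moreover have "of_real (1 - u) \<in> ball (0::complex) 1" if "u \<in> {0<..1}" for u
      using that by (simp add: dist_norm del: of_real_diff)
    ultimately show ?thesis by (intro continuous_on_compose2[OF c]) auto
  qed
  show "continuous_on {0<..1} (\<lambda>u. \<Sum>n. c n * of_real (1 - u) ^ n)"
    by (rule *) (rule summable_norm_cancel[OF tempered_summable[OF t]])
  obtain C where C: "C > 0"
    "\<And>u. 0 < u \<Longrightarrow> u \<le> 1 \<Longrightarrow> summable (\<lambda>n. norm (c n) * (1 - u) ^ n)"
    "\<And>u. 0 < u \<Longrightarrow> u \<le> 1 \<Longrightarrow> (\<Sum>n. norm (c n) * (1 - u) ^ n) \<le> C * u powr (- r)"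
    "\<And>u. 0 < u \<Longrightarrow> u \<le> 1 \<Longrightarrow> summable (\<lambda>n. norm (diffs c n) * (1 - u) ^ n)"
    "\<And>u. 0 < u \<Longrightarrow> u \<le> 1 \<Longrightarrow> (\<Sum>n. norm (diffs c n) * (1 - u) ^ n) \<le> C * u powr (- r - 1)"
  proof -
    obtain C where "C > 0" and *: "\<forall>u. 0 < u \<longrightarrow> u \<le> 1 \<longrightarrow>
    summable (\<lambda>n. norm (c n) * (1 - u) ^ n) \<and>
    (\<Sum>n. norm (c n) * (1 - u) ^ n) \<le> C * u powr (- r) \<and>
    summable (\<lambda>n. norm (diffs c n) * (1 - u) ^ n) \<and>
    (\<Sum>n. norm (diffs c n) * (1 - u) ^ n) \<le> C * u powr (- r - 1)"
      using tempered_bounds[OF t] by blast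
    show ?thesis by (rule that[OF \<open>C > 0\<close>]) (use * in blast)+
  qed
  show "continuous_on {0<..1} (\<lambda>u. \<Sum>n. diffs c n * of_real (1 - u) ^ n)"
  proof (rule *)
    fix z :: complex assume "norm z < 1"
    with C(4)[of "1 - norm z"] have "summable (\<lambda>n. norm (diffs c n * z ^ n))" by (simp add: norm_mult norm_power)
    thus "summable (\<lambda>n. diffs c n * z ^ n)" by (rule summable_norm_cancel)
  qed
qed

lemma ser_kernel_continuous:
  assumes t: "tempered c r"
  shows "continuous_on {0<..<1} (ser_kernel e g c)" "continuous_on {0<..<1} (ser_kernel_deriv e g c)"
  unfolding ser_kernel_def[abs_def] ser_kernel_deriv_def[abs_def]
  by (intro continuous_intros continuous_on_subset[OF continuous_on_of_real_powr]
       continuous_on_compose2[OF continuous_on_of_real_powr, of _ "\<lambda>u. 1 - u"]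
       continuous_on_subset[OF tempered_series_continuous(1)[OF t]]
       continuous_on_subset[OF tempered_series_continuous(2)[OF t]]; force)+

lemma ser_kernel_bounds:
  assumes t: "tempered c r"
  shows "\<exists>C>0. \<forall>u. 0 < u \<longrightarrow> u < 1 \<longrightarrow>
    norm (ser_kernel e g c u) \<le> C * (u powr (Re e - r) * (1 - u) powr (Re g - 1)) \<and>
    norm (ser_kernel_deriv e g c u) \<le> C * (u powr (Re e - r - 1) * (1 - u) powr (Re g - 2))"
proof -
  obtain C where C: "C > 0"
    "\<And>u. 0 < u \<Longrightarrow> u \<le> 1 \<Longrightarrow> summable (\<lambda>n. norm (c n) * (1 - u) ^ n)"
    "\<And>u. 0 < u \<Longrightarrow> u \<le> 1 \<Longrightarrow> (\<Sum>n. norm (c n) * (1 - u) ^ n) \<le> C * u powr (- r)"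
    "\<And>u. 0 < u \<Longrightarrow> u \<le> 1 \<Longrightarrow> summable (\<lambda>n. norm (diffs c n) * (1 - u) ^ n)"
    "\<And>u. 0 < u \<Longrightarrow> u \<le> 1 \<Longrightarrow> (\<Sum>n. norm (diffs c n) * (1 - u) ^ n) \<le> C * u powr (- r - 1)"
  proof -
    obtain C where "C > 0" and *: "\<forall>u. 0 < u \<longrightarrow> u \<le> 1 \<longrightarrow>
    summable (\<lambda>n. norm (c n) * (1 - u) ^ n) \<and>
    (\<Sum>n. norm (c n) * (1 - u) ^ n) \<le> C * u powr (- r) \<and>
    summable (\<lambda>n. norm (diffs c n) * (1 - u) ^ n) \<and>
    (\<Sum>n. norm (diffs c n) * (1 - u) ^ n) \<le> C * u powr (- r - 1)"
      using tempered_bounds[OF t] by blast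
    show ?thesis by (rule that[OF \<open>C > 0\<close>]) (use * in blast)+
  qed
  define D where "D = C * (norm e + norm (g - 1) + 1)"
  have D: "D > 0" unfolding D_def using C(1) by (intro mult_pos_pos add_nonneg_pos) auto
  have S1: "norm (\<Sum>n. c n * of_real (1 - u) ^ n) \<le> C * u powr (- r)" if u: "0 < u" "u < 1" for u
  proof -
    have "norm (\<Sum>n. c n * of_real (1 - u) ^ n) \<le> (\<Sum>n. norm (c n) * (1 - u) ^ n)"
      by (intro norm_suminf_le C(2)) (use u in \<open>auto simp: norm_mult norm_power simp del: of_real_diff\<close>)
    also have "\<dots> \<le> C * u powr (- r)" by (rule C) (use u in auto)
    finally show ?thesis .
  qed
  have S2: "norm (\<Sum>n. diffs c n * of_real (1 - u) ^ n) \<le> C * u powr (- r - 1)" if u: "0 < u" "u < 1" for u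
  proof -
    have "norm (\<Sum>n. diffs c n * of_real (1 - u) ^ n) \<le> (\<Sum>n. norm (diffs c n) * (1 - u) ^ n)"
      by (intro norm_suminf_le C(4)) (use u in \<open>auto simp: norm_mult norm_power simp del: of_real_diff\<close>)
    also have "\<dots> \<le> C * u powr (- r - 1)" by (rule C) (use u in auto)
    finally show ?thesis .
  qed
  show ?thesis
  proof (intro exI[of _ D] conjI D allI impI)
    fix u :: real assume u: "0 < u" "u < 1"
    have "norm (ser_kernel e g c u) = u powr Re e * (1 - u) powr (Re g - 1) * norm (\<Sum>n. c n * of_real (1 - u) ^ n)"
      unfolding ser_kernel_def norm_mult using u by (simp add: norm_of_real_powr del: of_real_diff)
    also have "\<dots> \<le> u powr Re e * (1 - u) powr (Re g - 1) * (C * u powr (- r))"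
      by (intro mult_left_mono S1 u) auto
    also have "\<dots> = C * (u powr (Re e - r) * (1 - u) powr (Re g - 1))"
      by (simp add: powr_diff powr_minus divide_inverse)
    also have "\<dots> \<le> D * (u powr (Re e - r) * (1 - u) powr (Re g - 1))"
      unfolding D_def using C(1) by (intro mult_right_mono) auto
    finally show "norm (ser_kernel e g c u) \<le> D * (u powr (Re e - r) * (1 - u) powr (Re g - 1))" .
    define X where "X = u powr (Re e - r - 1) * (1 - u) powr (Re g - 2)"
    have wle: "(1 - u) powr (Re g - 1) \<le> (1 - u) powr (Re g - 2)" using u by (intro powr_mono') auto
    have ule: "u powr (Re e) \<le> u powr (Re e - 1)" using u by (intro powr_mono') auto
    have a: "norm (e * of_real u powr (e - 1) * of_real (1 - u) powr (g - 1) - of_real u powr e * ((g - 1) * of_real (1 - u) powr (g - 2)))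
        \<le> (norm e + norm (g - 1)) * (u powr (Re e - 1) * (1 - u) powr (Re g - 2))"
    proof -
      have "norm (e * of_real u powr (e - 1) * of_real (1 - u) powr (g - 1) - of_real u powr e * ((g - 1) * of_real (1 - u) powr (g - 2)))
         \<le> norm e * (u powr (Re e - 1) * (1 - u) powr (Re g - 1)) + norm (g - 1) * (u powr (Re e) * (1 - u) powr (Re g - 2))"
        using u by (intro order_trans[OF norm_triangle_ineq4])
          (simp add: norm_mult norm_of_real_powr mult_ac del: of_real_diff)
      also have "\<dots> \<le> norm e * (u powr (Re e - 1) * (1 - u) powr (Re g - 2)) + norm (g - 1) * (u powr (Re e - 1) * (1 - u) powr (Re g - 2))"
        by (intro add_mono mult_left_mono mult_right_mono wle ule) auto
      finally show ?thesis by (simp add: algebra_simps)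
    qed
    have pX: "u powr (Re e - 1) * u powr (- r) = u powr (Re e - r - 1)" "u powr Re e * u powr (- r - 1) = u powr (Re e - r - 1)"
      by (simp_all add: algebra_simps flip: powr_add)
    have "norm (ser_kernel_deriv e g c u) \<le>
       (norm e + norm (g - 1)) * (u powr (Re e - 1) * (1 - u) powr (Re g - 2)) * (C * u powr (- r))
       + u powr Re e * (1 - u) powr (Re g - 1) * (C * u powr (- r - 1))"
      unfolding ser_kernel_deriv_def
    proof (intro order_trans[OF norm_triangle_ineq4] add_mono)
      show "norm ((e * of_real u powr (e - 1) * of_real (1 - u) powr (g - 1) - of_real u powr e * ((g - 1) * of_real (1 - u) powr (g - 2)))
        * (\<Sum>n. c n * of_real (1 - u) ^ n)) \<le> (norm e + norm (g - 1)) * (u powr (Re e - 1) * (1 - u) powr (Re g - 2)) * (C * u powr (- r))"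
        unfolding norm_mult[of _ "suminf _"] by (intro mult_mono a S1 u) auto
      show "norm (of_real u powr e * of_real (1 - u) powr (g - 1) * (\<Sum>n. diffs c n * of_real (1 - u) ^ n)) \<le> u powr Re e * (1 - u) powr (Re g - 1) * (C * u powr (- r - 1))"
        unfolding norm_mult[of _ "suminf _"] 
        by (intro mult_mono S2 u) (use u in \<open>auto simp: norm_mult norm_of_real_powr simp del: of_real_diff\<close>)
    qed
    also have "\<dots> \<le> (norm e + norm (g - 1)) * (u powr (Re e - 1) * (1 - u) powr (Re g - 2)) * (C * u powr (- r))
       + u powr Re e * (1 - u) powr (Re g - 2) * (C * u powr (- r - 1))"
      using C(1) by (intro add_mono order_refl mult_right_mono mult_left_mono wle) auto
    also have "\<dots> = C * (norm e + norm (g - 1)) * ((u powr (Re e - 1) * u powr (- r)) * (1 - u) powr (Re g - 2)) + C * ((u powr Re e * u powr (- r - 1)) * (1 - u) powr (Re g - 2))"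
      by (simp add: mult_ac)
    also have "\<dots> = D * X" unfolding pX X_def D_def by (simp add: algebra_simps)
    finally show "norm (ser_kernel_deriv e g c u) \<le> D * (u powr (Re e - r - 1) * (1 - u) powr (Re g - 2))" by (simp add: X_def)
  qed
qed

text \<open>
  The partial sums of the power series are dominated by the bound of \<open>tempered_bounds\<close> for the full
  series, so the Beta integrals of the terms converge to the integral of the kernel.
\<close>

lemma ser_kernel_Mellin:
  assumes t: "tempered c r" and g: "Re g > 0" and \<rho>: "Re (\<rho> + e) > r"
  shows "set_integrable lborel {0<..<1} (\<lambda>u. ser_kernel e g c u * of_real u powr (\<rho> - 1))"
    and "(\<lambda>n. c n * (Gamma (\<rho> + e) * Gamma (g + of_nat n) * rGamma (\<rho> + e + (g + of_nat n))))
            sums (LBINT u:{0<..<1}. ser_kernel e g c u * of_real u powr (\<rho> - 1))"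
proof -
  have r: "r > 0" using t by (simp add: tempered_def)
  obtain C where C: "C > 0"
    "\<And>u. 0 < u \<Longrightarrow> u \<le> 1 \<Longrightarrow> summable (\<lambda>n. norm (c n) * (1 - u) ^ n)"
    "\<And>u. 0 < u \<Longrightarrow> u \<le> 1 \<Longrightarrow> (\<Sum>n. norm (c n) * (1 - u) ^ n) \<le> C * u powr (- r)"
    "\<And>u. 0 < u \<Longrightarrow> u \<le> 1 \<Longrightarrow> summable (\<lambda>n. norm (diffs c n) * (1 - u) ^ n)"
    "\<And>u. 0 < u \<Longrightarrow> u \<le> 1 \<Longrightarrow> (\<Sum>n. norm (diffs c n) * (1 - u) ^ n) \<le> C * u powr (- r - 1)"
  proof -
    obtain C where "C > 0" and *: "\<forall>u. 0 < u \<longrightarrow> u \<le> 1 \<longrightarrow>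
    summable (\<lambda>n. norm (c n) * (1 - u) ^ n) \<and>
    (\<Sum>n. norm (c n) * (1 - u) ^ n) \<le> C * u powr (- r) \<and>
    summable (\<lambda>n. norm (diffs c n) * (1 - u) ^ n) \<and>
    (\<Sum>n. norm (diffs c n) * (1 - u) ^ n) \<le> C * u powr (- r - 1)"
      using tempered_bounds[OF t] by blast
    show ?thesis by (rule that[OF \<open>C > 0\<close>]) (use * in blast)+
  qed
  define \<beta> where "\<beta> = (\<lambda>u. of_real u powr (\<rho> + e - 1) * of_real (1 - u) powr (g - 1) :: complex)"
  have \<beta>cont: "continuous_on {0<..<1} \<beta>" unfolding \<beta>_def
    by (intro continuous_intros continuous_on_subset[OF continuous_on_of_real_powr]
        continuous_on_compose2[OF continuous_on_of_real_powr, of _ "\<lambda>u. 1 - u"]) auto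
  have n\<beta>: "norm (\<beta> u) = u powr (Re (\<rho> + e) - 1) * (1 - u) powr (Re g - 1)" if "0 < u" "u < 1" for u
    unfolding \<beta>_def norm_mult using that by (simp add: norm_of_real_powr del: of_real_diff)
  have eqK: "ser_kernel e g c u * of_real u powr (\<rho> - 1) = \<beta> u * (\<Sum>n. c n * of_real (1 - u) ^ n)" for u
  proof -
    have "of_real u powr (\<rho> + e - 1) = (of_real u powr e * of_real u powr (\<rho> - 1) :: complex)"
      by (simp add: algebra_simps flip: powr_add)
    thus ?thesis unfolding ser_kernel_def \<beta>_def by simp
  qed
  define W where "W = (\<lambda>u. C * (u powr (Re (\<rho> + e) - r - 1) * (1 - u) powr (Re g - 1)))"
  have Wint: "set_integrable lborel {0<..<1} W" unfolding W_def
    by (intro set_integrable_mult_right impI set_integrable_unit_real) (use \<rho> g in auto)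
  have bd: "norm (\<beta> u) * (C * u powr (- r)) = W u" if "0 < u" "u < 1" for u
  proof -
    have "u powr (Re (\<rho> + e) - r - 1) = u powr (Re (\<rho> + e) - 1) * u powr (- r)" by (simp add: algebra_simps flip: powr_add)
    thus ?thesis using that by (simp add: n\<beta> W_def)
  qed
  define s where "s = (\<lambda>m u. indicator {0<..<1::real} u *\<^sub>R (\<Sum>n<m. c n * (\<beta> u * of_real (1 - u) ^ n)))"
  define h where "h = (\<lambda>u. indicator {0<..<1::real} u *\<^sub>R (ser_kernel e g c u * of_real u powr (\<rho> - 1)))"
  have scont: "continuous_on {0<..<1} (\<lambda>u. \<Sum>n<m. c n * (\<beta> u * of_real (1 - u) ^ n))" for m
    by (intro continuous_intros \<beta>cont)
  have hcont: "continuous_on {0<..<1} (\<lambda>u. ser_kernel e g c u * of_real u powr (\<rho> - 1))"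
    by (intro continuous_intros ser_kernel_continuous(1)[OF t] continuous_on_subset[OF continuous_on_of_real_powr]) auto
  have meas: "h \<in> borel_measurable lborel" "s m \<in> borel_measurable lborel" for m
    using borel_measurable_continuous_on_indicator[OF _ hcont] borel_measurable_continuous_on_indicator[OF _ scont[of m]]
    unfolding h_def s_def by auto
  have W: "integrable lborel (\<lambda>u. indicator {0<..<1} u *\<^sub>R W u)" using Wint by (simp add: set_integrable_def)
  have lim: "AE u in lborel. (\<lambda>m. s m u) \<longlonglongrightarrow> h u"
  proof (rule AE_I2)
    fix u :: real
    show "(\<lambda>m. s m u) \<longlonglongrightarrow> h u"
    proof (cases "u \<in> {0<..<1}")
      case True
      have "summable (\<lambda>n. c n * of_real (1 - u) ^ n)"
        by (rule summable_norm_cancel[OF tempered_summable[OF t]]) (use True in \<open>auto simp del: of_real_diff\<close>)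
      hence "(\<lambda>n. \<beta> u * (c n * of_real (1 - u) ^ n)) sums (\<beta> u * (\<Sum>n. c n * of_real (1 - u) ^ n))"
        by (intro sums_mult summable_sums)
      thus ?thesis using True unfolding s_def h_def eqK sums_def by (simp add: mult_ac)
    qed (simp add: s_def h_def)
  qed
  have dom: "AE u in lborel. norm (s m u) \<le> indicator {0<..<1} u *\<^sub>R W u" for m
  proof (rule AE_I2)
    fix u :: real
    show "norm (s m u) \<le> indicator {0<..<1} u *\<^sub>R W u"
    proof (cases "u \<in> {0<..<1}")
      case True
      hence u: "0 < u" "u < 1" by auto
      have "norm (s m u) \<le> (\<Sum>n<m. norm (\<beta> u) * (norm (c n) * (1 - u) ^ n))"
        unfolding s_def using True by (auto intro!: sum_norm_le simp: norm_mult norm_power mult_ac simp del: of_real_diff)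
      also have "\<dots> = norm (\<beta> u) * (\<Sum>n<m. norm (c n) * (1 - u) ^ n)" by (simp add: sum_distrib_left)
      also have "\<dots> \<le> norm (\<beta> u) * (\<Sum>n. norm (c n) * (1 - u) ^ n)"
        using u by (intro mult_left_mono sum_le_suminf C(2)) auto
      also have "\<dots> \<le> norm (\<beta> u) * (C * u powr (- r))" using u by (intro mult_left_mono C(3)) auto
      also have "\<dots> = W u" by (rule bd[OF u])
      finally show ?thesis using True by simp
    qed (simp add: s_def)
  qed
  show "set_integrable lborel {0<..<1} (\<lambda>u. ser_kernel e g c u * of_real u powr (\<rho> - 1))"
    using integrable_dominated_convergence[OF meas(1) meas(2) W lim dom] by (simp add: set_integrable_def h_def)
  have conv: "(\<lambda>m. integral\<^sup>L lborel (s m)) \<longlonglongrightarrow> integral\<^sup>L lborel h"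
    by (rule integral_dominated_convergence[OF meas(1) meas(2) W lim dom])
  have tm: "integrable lborel (\<lambda>u. indicator {0<..<1::real} u *\<^sub>R (\<beta> u * of_real (1 - u) ^ n))"
     "(LBINT u. indicator {0<..<1::real} u *\<^sub>R (\<beta> u * of_real (1 - u) ^ n)) = Gamma (\<rho> + e) * Gamma (g + of_nat n) * rGamma (\<rho> + e + (g + of_nat n))" for n
  proof -
    have eq: "indicator {0<..<1::real} u *\<^sub>R (\<beta> u * of_real (1 - u) ^ n) =
       indicator {0<..<1::real} u *\<^sub>R (of_real u powr (\<rho> + e - 1) * of_real (1 - u) powr (g + of_nat n - 1) :: complex)" for u
    proof (cases "u \<in> {0<..<1}")
      case True
      have "of_real (1 - u) powr (g + of_nat n - 1) = (of_real (1 - u) powr ((g - 1) + of_nat n) :: complex)" by (simp add: algebra_simps)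
      also have "\<dots> = of_real (1 - u) powr (g - 1) * of_real (1 - u) powr (of_nat n)" by (rule powr_add)
      also have "of_real (1 - u) powr (of_nat n) = (of_real (1 - u) :: complex) ^ n"
        using True by (subst powr_nat') (auto simp del: of_real_diff)
      finally show ?thesis unfolding \<beta>_def by (simp only: mult.assoc)
    qed simp
    have rr: "Re (\<rho> + e) > 0" "Re (g + of_nat n) > 0" using \<rho> g r by auto
    show "integrable lborel (\<lambda>u. indicator {0<..<1::real} u *\<^sub>R (\<beta> u * of_real (1 - u) ^ n))"
      unfolding eq using complex_Beta_integral(1)[OF rr] by (simp only: set_integrable_def)
    show "(LBINT u. indicator {0<..<1::real} u *\<^sub>R (\<beta> u * of_real (1 - u) ^ n)) = Gamma (\<rho> + e) * Gamma (g + of_nat n) * rGamma (\<rho> + e + (g + of_nat n))"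
      unfolding eq using complex_Beta_integral(2)[OF rr] by (simp only: set_lebesgue_integral_def)
  qed
  have "integral\<^sup>L lborel (s m) = (\<Sum>n<m. c n * (Gamma (\<rho> + e) * Gamma (g + of_nat n) * rGamma (\<rho> + e + (g + of_nat n))))" for m
  proof -
    define \<phi> where "\<phi> = (\<lambda>n u. indicator {0<..<1::real} u *\<^sub>R (\<beta> u * of_real (1 - u) ^ n))"
    have i: "integrable lborel (\<phi> n)" and v: "integral\<^sup>L lborel (\<phi> n) = Gamma (\<rho> + e) * Gamma (g + of_nat n) * rGamma (\<rho> + e + (g + of_nat n))" for n
      using tm[of n] unfolding \<phi>_def by auto
    have "s m = (\<lambda>u. \<Sum>n<m. c n * \<phi> n u)"
      by (rule ext) (simp only: s_def \<phi>_def scaleR_sum_right mult_scaleR_right)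
    hence "integral\<^sup>L lborel (s m) = (\<Sum>n<m. integral\<^sup>L lborel (\<lambda>u. c n * \<phi> n u))"
      by (simp only:) (intro Bochner_Integration.integral_sum integrable_mult_right i)
    thus ?thesis by (simp only: integral_mult_right_zero v)
  qed
  thus "(\<lambda>n. c n * (Gamma (\<rho> + e) * Gamma (g + of_nat n) * rGamma (\<rho> + e + (g + of_nat n))))
            sums (LBINT u:{0<..<1}. ser_kernel e g c u * of_real u powr (\<rho> - 1))"
    using conv unfolding sums_def by (simp add: h_def set_lebesgue_integral_def)
qed

section \<open>The kernel of the third Appell function\<close>

text \<open>
  Coefficient of \<open>(1 - u) ^ (k + l)\<close> in \<open>u powr (- A') * F\<^sub>3(A, A', B, B'; g; 1 - u, 1 - 1 / u)\<close>
  after Pfaff's transformation of the inner Gauss function.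
\<close>

definition f3_term :: "complex \<Rightarrow> complex \<Rightarrow> complex \<Rightarrow> complex \<Rightarrow> complex \<Rightarrow> nat \<Rightarrow> nat \<Rightarrow> complex" where
  "f3_term A A' B B' g k l =
     (pochhammer A k * pochhammer B k / fact k) * (pochhammer A' l * pochhammer (g + of_nat k - B') l / fact l)
       / pochhammer g (k + l)"

definition f3_coeff :: "complex \<Rightarrow> complex \<Rightarrow> complex \<Rightarrow> complex \<Rightarrow> complex \<Rightarrow> nat \<Rightarrow> complex" where
  "f3_coeff A A' B B' g n = (\<Sum>k\<le>n. f3_term A A' B B' g k (n - k))"

text \<open>
  The bound is that of \<open>(z)\<^bsub>k + l\<^esub> / (z)\<^sub>k\<close>, a quotient that is undefined when \<open>z\<close> is a nonpositive
  integer.  Moving a real \<open>z\<close> to \<open>z + \<i>\<close> keeps its real part and enlarges the modulus of every factor,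
  so the quotient can be estimated there.
\<close>

lemma pochhammer_shift_upper:
  fixes z :: complex
  obtains C where "C > 0" "\<And>k l. norm (pochhammer (z + of_nat k) l) \<le>
     C * (fact (k + l) * (real (k + l) + 1) powr (Re z - 1)) / (fact k * (real k + 1) powr (Re z - 1))"
proof -
  \<comment> \<open>Any nonreal point with the same real part and no smaller modulus would do.\<close>
  define z' where "z' = z + (if Im z = 0 then \<i> else 0)"
  have z': "Re z' = Re z" "z' \<notin> \<int>\<^sub>\<le>\<^sub>0"
    by (auto simp: z'_def elim!: nonpos_Ints_cases) (auto simp: complex_eq_iff)
  have le: "norm (pochhammer (z + of_nat k) l) \<le> norm (pochhammer (z' + of_nat k) l)" for k l
    unfolding pochhammer_prod prod_norm[symmetric]
  proof (intro prod_mono conjI norm_ge_zero)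
    fix i
    show "norm (z + of_nat k + of_nat i) \<le> norm (z' + of_nat k + of_nat i)"
      by (auto simp: z'_def cmod_def intro!: real_sqrt_le_mono)
  qed
  obtain C1 where C1: "C1 > 0" "\<And>n. norm (pochhammer z' n) \<le> C1 * fact n * (real n + 1) powr (Re z' - 1)"
    using pochhammer_upper by blast
  obtain C2 where C2: "C2 > 0" "\<And>n. fact n * (real n + 1) powr (Re z' - 1) \<le> C2 * norm (pochhammer z' n)"
    using pochhammer_lower[OF z'(2)] by blast
  have "norm (pochhammer (z + of_nat k) l) \<le>
     (C1 * C2) * (fact (k + l) * (real (k + l) + 1) powr (Re z - 1)) / (fact k * (real k + 1) powr (Re z - 1))" for k l
  proof -
    have nz: "norm (pochhammer z' k) > 0" using z'(2) pochhammer_eq_0_imp_nonpos_Int by auto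
    have pos: "fact k * (real k + 1) powr (Re z - 1) > 0" by simp
    have "pochhammer z' (k + l) = pochhammer z' k * pochhammer (z' + of_nat k) l"
      using pochhammer_product[of k "k + l" z'] by simp
    hence "norm (pochhammer (z' + of_nat k) l) = norm (pochhammer z' (k + l)) * (1 / norm (pochhammer z' k))"
      using nz by (simp add: norm_mult)
    also have "\<dots> \<le> (C1 * fact (k + l) * (real (k + l) + 1) powr (Re z - 1)) * (C2 / (fact k * (real k + 1) powr (Re z - 1)))"
    proof (intro mult_mono)
      show "norm (pochhammer z' (k + l)) \<le> C1 * fact (k + l) * (real (k + l) + 1) powr (Re z - 1)"
        using C1(2)[of "k + l"] by (simp add: z')
      show "1 / norm (pochhammer z' k) \<le> C2 / (fact k * (real k + 1) powr (Re z - 1))"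
        using C2(2)[of k] nz pos by (simp add: z' divide_simps mult.commute)
    qed (use C1(1) in auto)
    finally show ?thesis using le[of k l] by (simp add: mult_ac)
  qed
  moreover have "C1 * C2 > 0" using C1 C2 by simp
  ultimately show ?thesis using that by blast
qed

lemma f3_term_bound:
  assumes g: "g \<notin> \<int>\<^sub>\<le>\<^sub>0"
  obtains C where "C > 0" "\<And>k l. norm (f3_term A A' B B' g k l) \<le>
      C * ((real k + 1) powr (Re A + Re B - 1 - (Re g - Re B')) * (real l + 1) powr (Re A' - 1) * (real (k + l) + 1) powr (- Re B'))"
proof -
  obtain C1 where C1: "C1 > 0" "\<And>n. norm (pochhammer A n) \<le> C1 * fact n * (real n + 1) powr (Re A - 1)"
    using pochhammer_upper by blast
  obtain C2 where C2: "C2 > 0" "\<And>n. norm (pochhammer B n) \<le> C2 * fact n * (real n + 1) powr (Re B - 1)"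
    using pochhammer_upper by blast
  obtain C3 where C3: "C3 > 0" "\<And>n. norm (pochhammer A' n) \<le> C3 * fact n * (real n + 1) powr (Re A' - 1)"
    using pochhammer_upper by blast
  obtain C4 where C4: "C4 > 0" "\<And>k l. norm (pochhammer ((g - B') + of_nat k) l) \<le>
     C4 * (fact (k + l) * (real (k + l) + 1) powr (Re (g - B') - 1)) / (fact k * (real k + 1) powr (Re (g - B') - 1))"
    using pochhammer_shift_upper by blast
  obtain C5 where C5: "C5 > 0" "\<And>n. fact n * (real n + 1) powr (Re g - 1) \<le> C5 * norm (pochhammer g n)"
    using pochhammer_lower[OF g] by blast
  have "norm (f3_term A A' B B' g k l) \<le> (C1 * C2 * C3 * C4 * C5) *
     ((real k + 1) powr (Re A + Re B - 1 - (Re g - Re B')) * (real l + 1) powr (Re A' - 1) * (real (k + l) + 1) powr (- Re B'))" for k l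
  proof -
    let ?k = "real k + 1" and ?l = "real l + 1" and ?n = "real (k + l) + 1"
    have nz: "norm (pochhammer g (k + l)) > 0" using g pochhammer_eq_0_imp_nonpos_Int by auto
    have inv: "1 / norm (pochhammer g (k + l)) \<le> C5 / (fact (k + l) * ?n powr (Re g - 1))"
    proof -
      have "0 < fact (k + l) * ?n powr (Re g - 1)" by simp
      thus ?thesis using C5(2)[of "k + l"] nz by (simp add: divide_simps mult.commute)
    qed
    have c4: "norm (pochhammer (g + of_nat k - B') l) \<le> C4 * (fact (k + l) * ?n powr (Re (g - B') - 1)) / (fact k * ?k powr (Re (g - B') - 1))"
      using C4(2)[of k l] by (simp add: algebra_simps)
    have "norm (f3_term A A' B B' g k l) = (norm (pochhammer A k) * norm (pochhammer B k) / fact k) *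
        (norm (pochhammer A' l) * norm (pochhammer (g + of_nat k - B') l) / fact l) * (1 / norm (pochhammer g (k + l)))"
      by (simp add: f3_term_def norm_mult norm_divide)
    also have "\<dots> \<le> ((C1 * fact k * ?k powr (Re A - 1)) * (C2 * fact k * ?k powr (Re B - 1)) / fact k) *
        ((C3 * fact l * ?l powr (Re A' - 1)) * (C4 * (fact (k + l) * ?n powr (Re (g - B') - 1)) / (fact k * ?k powr (Re (g - B') - 1))) / fact l)
        * (C5 / (fact (k + l) * ?n powr (Re g - 1)))"
      using C1(1) C2(1) C3(1) C4(1) C5(1)
      by (intro mult_mono divide_right_mono C1(2) C2(2) C3(2) c4 inv mult_nonneg_nonneg divide_nonneg_nonneg) auto
    also have "\<dots> = (C1 * C2 * C3 * C4 * C5) * ((?k powr (Re A - 1) * ?k powr (Re B - 1) / ?k powr (Re (g - B') - 1))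
        * ?l powr (Re A' - 1) * (?n powr (Re (g - B') - 1) / ?n powr (Re g - 1)))"
      by (simp add: divide_simps)
    also have "?k powr (Re A - 1) * ?k powr (Re B - 1) / ?k powr (Re (g - B') - 1) = ?k powr (Re A + Re B - 1 - (Re g - Re B'))"
      by (simp add: algebra_simps flip: powr_add powr_diff)
    also have "?n powr (Re (g - B') - 1) / ?n powr (Re g - 1) = ?n powr (- Re B')"
      by (simp add: algebra_simps flip: powr_diff)
    finally show ?thesis .
  qed
  moreover have "C1 * C2 * C3 * C4 * C5 > 0" using C1 C2 C3 C4 C5 by simp
  ultimately show ?thesis using that by blast
qed

text \<open>
  By \<open>f3_term_bound\<close> the sum is one over
  \<open>(k + 1) powr (X - 1) * (l + 1) powr (Re A' - 1) * (k + l + 1) powr (- s)\<close> with \<open>s = r + Re B'\<close> and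
  \<open>X = Re A + Re B - (Re g - Re B')\<close>.  The last power is split between \<open>k\<close> and \<open>l\<close>: the share of \<open>l\<close> must
  exceed \<open>Re A'\<close> and that of \<open>k\<close> must exceed \<open>X\<close>, both being nonnegative.  For \<open>Re A' > 0\<close>
  and \<open>P = Re A'\<close> the conditions on \<open>r\<close> are those under which Gauss' theorem will be applied.
\<close>

lemma f3_weighted_summable:
  assumes g: "g \<notin> \<int>\<^sub>\<le>\<^sub>0" and P: "P > 0" "P \<ge> Re A'"
    and r: "r > P - Re B'" "r > P + Re A + Re B - Re g"
    and h: "\<And>n. norm (h n) \<le> K * (real n + 1) powr (- r)"
  shows "(\<lambda>x. norm ((\<lambda>(k, l). f3_term A A' B B' g k l * h (k + l)) x)) summable_on UNIV"
proof -
  obtain C where C: "C > 0" "\<And>k l. norm (f3_term A A' B B' g k l) \<le>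
      C * ((real k + 1) powr (Re A + Re B - 1 - (Re g - Re B')) * (real l + 1) powr (Re A' - 1) * (real (k + l) + 1) powr (- Re B'))"
    using f3_term_bound[OF g] by blast
  have K: "K \<ge> 0" by (rule order_trans[OF norm_ge_zero[of "h 0"]]) (use h[of 0] in simp)
  define X where "X = Re A + Re B - (Re g - Re B')"
  define s where "s = r + Re B'"
  define m where "m = max 0 X"
  have m: "m \<ge> 0" "m \<ge> X" "s > P + m" using r unfolding m_def s_def X_def by linarith+
  \<comment> \<open>The slack left after giving \<open>P\<close> to \<open>l\<close> and \<open>m\<close> to \<open>k\<close> is shared equally.\<close>
  define \<eta> where "\<eta> = (s - P - m) / 2"
  have \<eta>: "\<eta> > 0" "s = P + m + \<eta> + \<eta>" using m by (simp_all add: \<eta>_def)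
  define s1 where "s1 = P + \<eta>"
  define s2 where "s2 = m + \<eta>"
  have s12: "s1 \<ge> 0" "s2 \<ge> 0" "s1 > Re A'" "s2 > X" "s = s1 + s2"
    using P \<eta> m unfolding s1_def s2_def by linarith+
  show ?thesis
  proof (rule abs_summable_on_nat_prod)
    let ?F = "\<lambda>k. K * C * (real k + 1) powr (X - 1 - s2)" and ?G = "\<lambda>l. (real l + 1) powr (Re A' - 1 - s1)"
    show "summable ?F" "summable ?G" using s12 by (intro summable_mult summable_powr_shift; simp)+
    show "?F k \<ge> 0" "?G k \<ge> 0" for k using K C(1) by auto
    fix k l
    let ?k = "real k + 1" and ?l = "real l + 1" and ?n = "real (k + l) + 1"
    have n1: "?n powr (- s1) \<le> ?l powr (- s1)" and n2: "?n powr (- s2) \<le> ?k powr (- s2)"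
      using s12 by (auto intro!: powr_mono2')
    have "norm ((\<lambda>(k, l). f3_term A A' B B' g k l * h (k + l)) (k, l)) = norm (f3_term A A' B B' g k l) * norm (h (k + l))"
      by (simp add: norm_mult)
    also have "\<dots> \<le> (C * (?k powr (Re A + Re B - 1 - (Re g - Re B')) * ?l powr (Re A' - 1) * ?n powr (- Re B'))) * (K * ?n powr (- r))"
      using C(1) by (intro mult_mono C(2) h) auto
    also have "\<dots> = (K * C) * (?k powr (X - 1) * ?l powr (Re A' - 1) * (?n powr (- s2) * ?n powr (- s1)))"
    proof -
      have "?n powr (- Re B') * ?n powr (- r) = ?n powr (- s2) * ?n powr (- s1)"
      proof -
        have "- Re B' + - r = - s2 + - s1" using s12(5) unfolding s_def by linarith
        thus ?thesis unfolding powr_add[symmetric] by (simp only:)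
      qed
      moreover have "Re A + Re B - 1 - (Re g - Re B') = X - 1" by (simp add: X_def)
      moreover have "(c * (x * y * p)) * (d * q) = (d * c) * (x * y * (p * q))" for x y p q c d :: real
        by (simp add: mult_ac)
      ultimately show ?thesis by (simp only:)
    qed
    also have "\<dots> \<le> (K * C) * (?k powr (X - 1) * ?l powr (Re A' - 1) * (?k powr (- s2) * ?l powr (- s1)))"
      using K C(1) by (intro mult_left_mono mult_mono n1 n2) auto
    also have "\<dots> = ?F k * ?G l" by (simp add: powr_diff powr_minus divide_inverse)
    finally show "norm ((\<lambda>(k, l). f3_term A A' B B' g k l * h (k + l)) (k, l)) \<le> ?F k * ?G l" .
  qed
qed

lemma f3_coeff_weighted:
  "(\<Sum>k\<le>n. (\<lambda>(k, l). f3_term A A' B B' g k l * h (k + l)) (k, n - k)) = f3_coeff A A' B B' g n * h n"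
  unfolding f3_coeff_def sum_distrib_right by (intro sum.cong) auto

lemma f3_coeff_tempered:
  assumes g: "g \<notin> \<int>\<^sub>\<le>\<^sub>0" and P: "P > 0" "P \<ge> Re A'"
    and r: "r > 0" "r > P - Re B'" "r > P + Re A + Re B - Re g"
  shows "tempered (f3_coeff A A' B B' g) r"
proof -
  define h :: "nat \<Rightarrow> complex" where "h = (\<lambda>n. of_real ((real n + 1) powr (- r)))"
  have "(\<lambda>x. norm ((\<lambda>(k, l). f3_term A A' B B' g k l * h (k + l)) x)) summable_on UNIV"
    by (rule f3_weighted_summable[OF g P r(2,3), where K = 1]) (auto simp: h_def)
  from double_series(2)[OF this] have "summable (\<lambda>n. norm (f3_coeff A A' B B' g n * h n))"
    unfolding f3_coeff_weighted .
  thus ?thesis using r(1) by (simp add: tempered_def norm_mult h_def)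
qed

text \<open>
  In the double series of Beta integrals \<open>\<Gamma>(g + k + l)\<close> cancels \<open>(g)\<^bsub>k + l\<^esub>\<close>.  The sum over \<open>l\<close> is then
  Gauss' series with parameters \<open>A'\<close>, \<open>g + k - B'\<close>, \<open>\<rho> + e + g + k\<close>, and the sum over \<open>k\<close> that remains is
  Gauss' series with parameters \<open>A\<close>, \<open>B\<close>, \<open>\<rho> + e + g - A'\<close>.
\<close>

lemma f3_kernel_Mellin:
  assumes g: "Re g > 0" and P: "P > 0" "P \<ge> Re A'"
    and r: "r > 0" "r > P - Re B'" "r > P + Re A + Re B - Re g" and \<rho>: "Re (\<rho> + e) > r"
  shows "(LBINT u:{0<..<1}. ser_kernel e g (f3_coeff A A' B B' g) u * of_real u powr (\<rho> - 1)) =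
    Gamma g * (Gamma (\<rho> + e) * Gamma (\<rho> + e + B' - A') * Gamma (\<rho> + e + g - A - A' - B)) *
      (rGamma (\<rho> + e + B') * rGamma (\<rho> + e + g - A - A') * rGamma (\<rho> + e + g - A' - B))"
proof -
  have gn: "g \<notin> \<int>\<^sub>\<le>\<^sub>0" using g Re_pos_not_nonpos_Int by blast
  have t: "tempered (f3_coeff A A' B B' g) r" by (rule f3_coeff_tempered[OF gn P r])
  define \<sigma> where "\<sigma> = \<rho> + e"
  define h where "h = (\<lambda>n. Gamma \<sigma> * Gamma (g + of_nat n) * rGamma (\<sigma> + (g + of_nat n)))"
  have pg: "pochhammer g n \<noteq> 0" for n using gn pochhammer_eq_0_imp_nonpos_Int by blast
  have h': "h n = Gamma \<sigma> * Gamma g * (pochhammer g n * rGamma (\<sigma> + g + of_nat n))" for n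
    using pochhammer_Gamma[OF gn, of n] gn by (simp add: h_def Gamma_eq_zero_iff add_ac)
  obtain C1 where C1: "C1 > 0" "\<And>n. norm (pochhammer g n) \<le> C1 * fact n * (real n + 1) powr (Re g - 1)"
    using pochhammer_upper by blast
  obtain C2 where C2: "C2 > 0" "\<And>n. norm (rGamma ((\<sigma> + g) + of_nat n)) \<le> C2 * (real n + 1) powr (1 - Re (\<sigma> + g)) / fact n"
    using rGamma_shift_upper by blast
  define K where "K = norm (Gamma \<sigma> * Gamma g) * (C1 * C2)"
  have hb: "norm (h n) \<le> K * (real n + 1) powr (- r)" for n
  proof -
    have "norm (h n) = norm (Gamma \<sigma> * Gamma g) * (norm (pochhammer g n) * norm (rGamma (\<sigma> + g + of_nat n)))"
      by (simp only: h' norm_mult)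
    also have "\<dots> \<le> norm (Gamma \<sigma> * Gamma g) * ((C1 * fact n * (real n + 1) powr (Re g - 1)) * (C2 * (real n + 1) powr (1 - Re (\<sigma> + g)) / fact n))"
      using C1(1) by (intro mult_left_mono mult_mono C1(2) C2(2)) auto
    also have "\<dots> = K * ((real n + 1) powr (Re g - 1) * (real n + 1) powr (1 - Re (\<sigma> + g)))"
      by (simp add: K_def)
    also have "(real n + 1) powr (Re g - 1) * (real n + 1) powr (1 - Re (\<sigma> + g)) = (real n + 1) powr (- Re \<sigma>)"
      by (simp flip: powr_add)
    also have "K * (real n + 1) powr (- Re \<sigma>) \<le> K * (real n + 1) powr (- r)"
      using C1(1) C2(1) \<rho> by (intro mult_left_mono powr_mono) (auto simp: K_def \<sigma>_def)
    finally show ?thesis .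
  qed
  let ?f = "\<lambda>(k, l). f3_term A A' B B' g k l * h (k + l)"
  have abs: "(\<lambda>x. norm (?f x)) summable_on UNIV"
    by (rule f3_weighted_summable[OF gn P r(2,3) hb])
  have "(\<lambda>n. f3_coeff A A' B B' g n * h n) sums infsum ?f UNIV"
    using double_series(1)[OF abs] unfolding f3_coeff_weighted .
  moreover have "(\<lambda>n. f3_coeff A A' B B' g n * h n) sums (LBINT u:{0<..<1}. ser_kernel e g (f3_coeff A A' B B' g) u * of_real u powr (\<rho> - 1))"
    using ser_kernel_Mellin(2)[OF t g \<rho>] unfolding h_def \<sigma>_def .
  ultimately have I: "(LBINT u:{0<..<1}. ser_kernel e g (f3_coeff A A' B B' g) u * of_real u powr (\<rho> - 1)) = infsum ?f UNIV"
    using sums_unique2 by blast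
  have cond1: "Re (\<sigma> + B' - A') > 0" using r \<rho> P by (simp add: \<sigma>_def)
  have cond2: "Re (\<sigma> + g - A - A' - B) > 0" using r \<rho> P by (simp add: \<sigma>_def)
  define Q where "Q = Gamma \<sigma> * Gamma g * (Gamma (\<sigma> + B' - A') * rGamma (\<sigma> + B'))"
  have inner: "(\<Sum>l. ?f (k, l)) = Q * gauss_term A B (\<sigma> + g - A') k" for k
  proof -
    have "?f (k, l) = (Gamma \<sigma> * Gamma g * (pochhammer A k * pochhammer B k / fact k)) * gauss_term A' (g + of_nat k - B') (\<sigma> + g + of_nat k) l" for l
      using pg[of "k + l"] by (simp add: f3_term_def h' gauss_term_def add_ac)
    moreover have "gauss_term A' (g + of_nat k - B') (\<sigma> + g + of_nat k) sums
       (Gamma (\<sigma> + g + of_nat k - A' - (g + of_nat k - B')) * rGamma (\<sigma> + g + of_nat k - A') * rGamma (\<sigma> + g + of_nat k - (g + of_nat k - B')))"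
      by (rule gauss_summation) (use cond1 in auto)
    ultimately have "(\<lambda>l. ?f (k, l)) sums ((Gamma \<sigma> * Gamma g * (pochhammer A k * pochhammer B k / fact k)) *
      (Gamma (\<sigma> + g + of_nat k - A' - (g + of_nat k - B')) * rGamma (\<sigma> + g + of_nat k - A') * rGamma (\<sigma> + g + of_nat k - (g + of_nat k - B'))))"
      by (simp only: sums_mult)
    moreover have "\<sigma> + g + of_nat k - A' - (g + of_nat k - B') = \<sigma> + B' - A'" "\<sigma> + g + of_nat k - (g + of_nat k - B') = \<sigma> + B'"
        "\<sigma> + g + of_nat k - A' = \<sigma> + g - A' + of_nat k"
      by (simp_all add: algebra_simps)
    ultimately have "(\<lambda>l. ?f (k, l)) sums ((Gamma \<sigma> * Gamma g * (pochhammer A k * pochhammer B k / fact k)) *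
      (Gamma (\<sigma> + B' - A') * rGamma (\<sigma> + g - A' + of_nat k) * rGamma (\<sigma> + B')))" by (simp only:)
    hence "(\<Sum>l. ?f (k, l)) = ((Gamma \<sigma> * Gamma g * (pochhammer A k * pochhammer B k / fact k)) *
      (Gamma (\<sigma> + B' - A') * rGamma (\<sigma> + g - A' + of_nat k) * rGamma (\<sigma> + B')))" by (rule sums_unique[symmetric])
    thus ?thesis by (simp add: Q_def gauss_term_def)
  qed
  have "(\<lambda>k. \<Sum>l. ?f (k, l)) sums infsum ?f UNIV" by (rule double_series(4)[OF abs])
  moreover have "(\<lambda>k. \<Sum>l. ?f (k, l)) sums (Q * (Gamma (\<sigma> + g - A' - A - B) * rGamma (\<sigma> + g - A' - A) * rGamma (\<sigma> + g - A' - B)))"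
    unfolding inner by (intro sums_mult gauss_summation) (use cond2 in auto)
  ultimately have "infsum ?f UNIV = Q * (Gamma (\<sigma> + g - A' - A - B) * rGamma (\<sigma> + g - A' - A) * rGamma (\<sigma> + g - A' - B))"
    using sums_unique2 by blast
  moreover have "\<sigma> + g - A' - A - B = \<sigma> + g - A - A' - B" "\<sigma> + g - A' - A = \<sigma> + g - A - A'" by simp_all
  ultimately show ?thesis unfolding I Q_def \<sigma>_def by (simp add: mult_ac)
qed

text \<open>
  The exponent \<open>- A'\<close> of the operator cancels the factor \<open>u powr A'\<close> of Pfaff's transformation.  The series
  of the Appell function is the sum by rows of the double series, the kernel is the sum by
  diagonals.
\<close>

lemma f3_kernel_eq_appell:
  assumes g: "Re g > 0" and u: "0 < u" "u < 1"
  shows "of_real (1 - u) powr (g - 1) * of_real u powr (- A') * appell_F3 A A' B B' g (of_real (1 - u)) (of_real (1 - 1 / u))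
       = ser_kernel 0 g (f3_coeff A A' B B' g) u"
proof -
  have gn: "g \<notin> \<int>\<^sub>\<le>\<^sub>0" using g Re_pos_not_nonpos_Int by blast
  define P where "P = \<bar>Re A'\<bar> + 1"
  define r where "r = \<bar>P - Re B'\<bar> + \<bar>P + Re A + Re B - Re g\<bar> + 1"
  have r: "r \<ge> 0" "r > P - Re B'" "r > P + Re A + Re B - Re g" by (auto simp: r_def)
  obtain C where C: "C > 0" "\<And>n u. 0 < u \<Longrightarrow> u \<le> 1 \<Longrightarrow> (real n + 1) powr r * (1 - u) ^ n \<le> C * u powr (- r)"
    using powr_times_power_bound[OF r(1)] by blast
  define w :: complex where "w = of_real (1 - u)"
  have hb: "norm (w ^ n) \<le> (C * u powr (- r)) * (real n + 1) powr (- r)" for n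
  proof -
    have "norm (w ^ n) = ((real n + 1) powr r * (1 - u) ^ n) * (real n + 1) powr (- r)"
      using u by (simp add: w_def norm_power powr_minus del: of_real_diff)
    also have "\<dots> \<le> (C * u powr (- r)) * (real n + 1) powr (- r)" using u by (intro mult_right_mono C) auto
    finally show ?thesis .
  qed
  let ?f = "\<lambda>(k, l). f3_term A A' B B' g k l * w ^ (k + l)"
  have abs: "(\<lambda>x. norm (?f x)) summable_on UNIV"
    by (rule f3_weighted_summable[OF gn _ _ r(2,3) hb]) (auto simp: P_def)
  have c: "(\<lambda>n. f3_coeff A A' B B' g n * w ^ n) sums infsum ?f UNIV"
    using double_series(1)[OF abs] unfolding f3_coeff_weighted .
  have d: "(\<lambda>k. \<Sum>l. ?f (k, l)) sums infsum ?f UNIV" by (rule double_series(4)[OF abs])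
  have row: "pochhammer A k * pochhammer B k / pochhammer g k * w ^ k / fact k * hyp_2F1 A' B' (g + of_nat k) (of_real (1 - 1 / u))
      = of_real u powr A' * (\<Sum>l. ?f (k, l))" for k
  proof -
    have gk: "g + of_nat k \<notin> \<int>\<^sub>\<le>\<^sub>0" by (rule Re_pos_not_nonpos_Int) (use g in simp)
    define D where "D = (\<lambda>l. pochhammer A' l * pochhammer (g + of_nat k - B') l / (pochhammer (g + of_nat k) l * fact l) * w ^ l)"
    have "summable D" unfolding D_def
      by (rule summable_norm_cancel[OF hypergeometric_summable[OF gk]]) (use u in \<open>auto simp: w_def simp del: of_real_diff\<close>)
    hence "(\<lambda>l. (pochhammer A k * pochhammer B k / pochhammer g k * w ^ k / fact k) * D l) sums
        ((pochhammer A k * pochhammer B k / pochhammer g k * w ^ k / fact k) * suminf D)" by (intro sums_mult summable_sums)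
    moreover have "(pochhammer A k * pochhammer B k / pochhammer g k * w ^ k / fact k) * D l = ?f (k, l)" for l
    proof -
      have "pochhammer g (k + l) = pochhammer g k * pochhammer (g + of_nat k) l"
        using pochhammer_product[of k "k + l" g] by simp
      thus ?thesis by (simp add: D_def f3_term_def power_add mult_ac)
    qed
    ultimately have "(\<Sum>l. ?f (k, l)) = (pochhammer A k * pochhammer B k / pochhammer g k * w ^ k / fact k) * suminf D"
      by (simp add: sums_iff)
    moreover have "hyp_2F1 A' B' (g + of_nat k) (of_real (1 - 1 / u)) = of_real u powr A' * suminf D"
      unfolding D_def w_def using u by (intro hyp_2F1_negative_real gk) auto
    ultimately show ?thesis by (simp only: mult_ac)
  qed
  have "appell_F3 A A' B B' g (of_real (1 - u)) (of_real (1 - 1 / u)) = (\<Sum>k. of_real u powr A' * (\<Sum>l. ?f (k, l)))"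
    unfolding appell_F3_def w_def[symmetric] row ..
  also have "\<dots> = of_real u powr A' * infsum ?f UNIV" using sums_mult[OF d] by (simp add: sums_iff)
  also have "infsum ?f UNIV = (\<Sum>n. f3_coeff A A' B B' g n * w ^ n)" using c by (simp add: sums_iff)
  finally have "appell_F3 A A' B B' g (of_real (1 - u)) (of_real (1 - 1 / u)) = of_real u powr A' * (\<Sum>n. f3_coeff A A' B B' g n * w ^ n)" .
  moreover have "of_real u powr (- A') * (of_real u powr A') = (1 :: complex)" using u by (simp flip: powr_add)
  ultimately show ?thesis using u unfolding ser_kernel_def w_def[symmetric] by (simp add: mult.assoc)
qed

section \<open>Rearranging the parameters of the kernel\<close>

lemma continuous_on_unit_extend:
  fixes f :: "real \<Rightarrow> complex"
  assumes f: "continuous_on {0<..<1} f" and ab: "a > 0" "b > 0"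
    and le: "\<And>u. 0 < u \<Longrightarrow> u < 1 \<Longrightarrow> norm (f u) \<le> C * (u powr a * (1 - u) powr b)"
  shows "continuous_on {0..1} (\<lambda>u. if 0 < u \<and> u < 1 then f u else 0)"
  unfolding continuous_on_eq_continuous_within
proof
  define F where "F = (\<lambda>u. if 0 < u \<and> u < 1 then f u else 0)"
  define M where "M = (\<lambda>u. \<bar>C\<bar> * (u powr a * (1 - u) powr b))"
  fix x :: real assume x: "x \<in> {0..1}"
  show "continuous (at x within {0..1}) (\<lambda>u. if 0 < u \<and> u < 1 then f u else 0)"
  proof (cases "0 < x \<and> x < 1")
    case True
    have "isCont f x" using f True by (simp add: continuous_on_eq_continuous_at)
    moreover have "\<forall>\<^sub>F u in nhds x. F u = f u"
      using True by (auto simp: F_def eventually_nhds intro!: exI[of _ "{0<..<1}"])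
    ultimately have "isCont F x" by (simp add: isCont_cong)
    thus ?thesis unfolding F_def by (rule continuous_at_imp_continuous_at_within)
  next
    case False
    have Mle: "norm (F u) \<le> M u" if "u \<in> {0..1}" for u
    proof (cases "0 < u \<and> u < 1")
      case True
      have "norm (F u) \<le> C * (u powr a * (1 - u) powr b)" using le True by (simp add: F_def)
      also have "\<dots> \<le> M u" unfolding M_def by (intro mult_right_mono) auto
      finally show ?thesis .
    qed (auto simp: F_def M_def)
    have "continuous_on {0..1} M" unfolding M_def using ab
      by (intro continuous_intros continuous_on_powr') auto
    hence "(M \<longlongrightarrow> M x) (at x within {0..1})" using x by (auto simp: continuous_on_def)
    moreover have "M x = 0" using False x ab by (auto simp: M_def)
    ultimately have M0: "(M \<longlongrightarrow> 0) (at x within {0..1})" by simp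
    have "(F \<longlongrightarrow> 0) (at x within {0..1})"
      by (rule Lim_null_comparison[OF _ M0]) (auto simp: eventually_at_filter intro!: always_eventually Mle)
    moreover have "F x = 0" using False by (auto simp: F_def)
    ultimately show ?thesis unfolding F_def continuous_within by simp
  qed
qed

text \<open>
  By Weierstrass' theorem \<open>f\<close> is orthogonal to every continuous function on the closed interval.  It is
  tested against its own conjugate, multiplied by \<open>(1 - u)\<^sup>2\<close> to remove the possible singularity at
  \<open>u = 1\<close>; the factor \<open>u\<close> in the bound takes care of \<open>u = 0\<close>.
\<close>

lemma vanishing_moments:
  fixes f :: "real \<Rightarrow> complex"
  assumes f: "continuous_on {0<..<1} f" and b: "b > 0"
    and le: "\<And>u. 0 < u \<Longrightarrow> u < 1 \<Longrightarrow> norm (f u) \<le> C * (u * (1 - u) powr (b - 1))"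
    and mom: "\<And>n. (LBINT u:{0<..<1}. f u * of_real u ^ n) = 0"
    and u: "0 < u" "u < 1"
  shows "f u = 0"
proof -
  have C: "C \<ge> 0"
  proof -
    have "norm (f (1/2)) \<le> C * ((1/2) * (1 - 1/2) powr (b - 1))" by (rule le) auto
    hence "0 \<le> C * ((1/2) * (1 - 1/2) powr (b - 1))" by (rule order_trans[OF norm_ge_zero])
    thus ?thesis by (simp add: zero_le_mult_iff)
  qed
  define V where "V = (LBINT u:{0<..<1}. norm (f u))"
  have fint: "set_integrable lborel {0<..<1} f"
  proof (rule set_integrable_unit_dominated[OF f, where a = 1 and b = b and C = C])
    fix u :: real assume u: "0 < u" "u < 1"
    have "norm (f u) \<le> C * (u * (1 - u) powr (b - 1))" by (rule le[OF u])
    also have "\<dots> \<le> C * (1 * (1 - u) powr (b - 1))" using u C by (intro mult_left_mono mult_right_mono) auto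
    finally show "norm (f u) \<le> C * (u powr (1 - 1) * (1 - u) powr (b - 1))" using u by simp
  qed (use b in auto)
  have V: "V \<ge> 0" unfolding V_def set_lebesgue_integral_def by (intro Bochner_Integration.integral_nonneg) auto
  have prodint: "set_integrable lborel {0<..<1} (\<lambda>u. f u * of_real (\<psi> u))" if \<psi>: "continuous_on {0..1} \<psi>" for \<psi> :: "real \<Rightarrow> real"
  proof -
    have "bounded (\<psi> ` {0..1})" using \<psi> compact_continuous_image compact_imp_bounded compact_Icc by blast
    then obtain B where "\<forall>x\<in>\<psi> ` {0..1}. norm x \<le> B" unfolding bounded_iff by blast
    hence B: "\<And>u. u \<in> {0..1} \<Longrightarrow> \<bar>\<psi> u\<bar> \<le> B" by simp
    show ?thesis
    proof (rule set_integrable_unit_dominated[where a = 1 and b = b and C = "C * B"])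
      show "continuous_on {0<..<1} (\<lambda>u. f u * of_real (\<psi> u))"
        by (intro continuous_intros f continuous_on_subset[OF \<psi>]) auto
      fix u :: real assume u: "0 < u" "u < 1"
      have "norm (f u * of_real (\<psi> u)) \<le> (C * (u * (1 - u) powr (b - 1))) * B"
        unfolding norm_mult using le[OF u] B[of u] u C by (intro mult_mono) auto
      also have "\<dots> \<le> (C * (1 * (1 - u) powr (b - 1))) * B"
        using B[of u] u C by (intro mult_left_mono mult_right_mono) auto
      finally show "norm (f u * of_real (\<psi> u)) \<le> C * B * (u powr (1 - 1) * (1 - u) powr (b - 1))" using u by (simp add: mult_ac)
    qed (use b in auto)
  qed
  have poly: "(LBINT u:{0<..<1}. f u * of_real (p u)) = 0" if p: "real_polynomial_function p" for p :: "real \<Rightarrow> real"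
  proof -
    obtain a n where an: "p = (\<lambda>x. \<Sum>i\<le>n. a i * x ^ i)" using p real_polynomial_function_iff_sum by blast
    have "(LBINT u:{0<..<1}. f u * of_real (p u)) = (LBINT u. \<Sum>i\<le>n. of_real (a i) * (indicator {0<..<1} u *\<^sub>R (f u * of_real u ^ i)))"
      unfolding set_lebesgue_integral_def an
      by (intro Bochner_Integration.integral_cong) (auto simp: sum_distrib_left scaleR_sum_right mult_ac)
    also have "\<dots> = (\<Sum>i\<le>n. LBINT u. of_real (a i) * (indicator {0<..<1} u *\<^sub>R (f u * of_real u ^ i)))"
    proof (intro Bochner_Integration.integral_sum integrable_mult_right)
      fix i
      have "set_integrable lborel {0<..<1} (\<lambda>u. f u * of_real (u ^ i))" by (intro prodint continuous_intros)
      thus "integrable lborel (\<lambda>u. indicator {0<..<1} u *\<^sub>R (f u * of_real u ^ i))" by (simp add: set_integrable_def)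
    qed
    also have "\<dots> = 0"
      by (simp only: integral_mult_right_zero mom[unfolded set_lebesgue_integral_def] mult_zero_right sum.neutral_const)
    finally show ?thesis .
  qed
  have cont0: "(LBINT u:{0<..<1}. f u * of_real (\<psi> u)) = 0" if \<psi>: "continuous_on {0..1} \<psi>" for \<psi> :: "real \<Rightarrow> real"
  proof -
    have "norm (LBINT u:{0<..<1}. f u * of_real (\<psi> u)) \<le> \<epsilon> * V" if \<epsilon>: "\<epsilon> > 0" for \<epsilon>
    proof -
      obtain p where p: "real_polynomial_function p" "\<And>x. x \<in> {0..1} \<Longrightarrow> \<bar>\<psi> x - p x\<bar> < \<epsilon>"
        using Stone_Weierstrass_real_polynomial_function[OF compact_Icc \<psi> \<epsilon>] by blast
      have pc: "continuous_on {0..1} p" using p(1) continuous_real_polymonial_function continuous_at_imp_continuous_on by blast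
      have "(LBINT u:{0<..<1}. f u * of_real (\<psi> u)) = (LBINT u:{0<..<1}. f u * of_real (\<psi> u)) - (LBINT u:{0<..<1}. f u * of_real (p u))"
        using poly[OF p(1)] by simp
      also have "\<dots> = (LBINT u:{0<..<1}. f u * of_real (\<psi> u) - f u * of_real (p u))"
        by (rule set_integral_diff(2)[symmetric]) (intro prodint \<psi> pc)+
      also have "norm \<dots> \<le> (LBINT u. norm (indicator {0<..<1} u *\<^sub>R (f u * of_real (\<psi> u) - f u * of_real (p u))))"
        unfolding set_lebesgue_integral_def by (rule integral_norm_bound)
      also have "\<dots> \<le> (LBINT u. \<epsilon> * (indicator {0<..<1} u *\<^sub>R norm (f u)))"
      proof (rule integral_mono)
        have "set_integrable lborel {0<..<1} (\<lambda>u. f u * of_real (\<psi> u) - f u * of_real (p u))"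
          by (rule set_integral_diff(1)) (intro prodint \<psi> pc)+
        thus "integrable lborel (\<lambda>u. norm (indicator {0<..<1} u *\<^sub>R (f u * of_real (\<psi> u) - f u * of_real (p u))))"
          unfolding set_integrable_def by (rule integrable_norm)
        have "integrable lborel (\<lambda>u. norm (indicator {0<..<1} u *\<^sub>R f u))" using fint unfolding set_integrable_def by (rule integrable_norm)
        thus "integrable lborel (\<lambda>u. \<epsilon> * (indicator {0<..<1} u *\<^sub>R norm (f u)))" by simp
        fix u :: real
        show "norm (indicator {0<..<1} u *\<^sub>R (f u * of_real (\<psi> u) - f u * of_real (p u))) \<le> \<epsilon> * (indicator {0<..<1} u *\<^sub>R norm (f u))"
        proof (cases "u \<in> {0<..<1}")
          case True
          have "norm (f u * of_real (\<psi> u) - f u * of_real (p u)) = norm (f u) * \<bar>\<psi> u - p u\<bar>"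
            unfolding right_diff_distrib[symmetric] norm_mult by (simp flip: of_real_diff)
          also have "\<dots> \<le> norm (f u) * \<epsilon>" using p(2)[of u] True by (intro mult_left_mono) auto
          finally show ?thesis using True by (simp add: mult_ac)
        qed simp
      qed
      also have "\<dots> = \<epsilon> * V" by (simp add: V_def set_lebesgue_integral_def)
      finally show ?thesis .
    qed
    hence "norm (LBINT u:{0<..<1}. f u * of_real (\<psi> u)) \<le> \<epsilon>" if "\<epsilon> > 0" for \<epsilon>
    proof -
      have "norm (LBINT u:{0<..<1}. f u * of_real (\<psi> u)) \<le> (\<epsilon> / (V + 1)) * V" 
        using \<open>\<And>\<epsilon>. \<epsilon> > 0 \<Longrightarrow> _ \<le> \<epsilon> * V\<close>[of "\<epsilon> / (V + 1)"] that V by simp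
      also have "\<dots> \<le> \<epsilon>" using that V by (simp add: field_simps)
      finally show ?thesis .
    qed
    hence "norm (LBINT u:{0<..<1}. f u * of_real (\<psi> u)) \<le> 0" by (rule field_le_epsilon[of _ 0, simplified])
    thus ?thesis by simp
  qed
  define \<Psi> where "\<Psi> = (\<lambda>u. if 0 < u \<and> u < 1 then cnj (f u) * of_real ((1 - u)\<^sup>2) else 0)"
  have \<Psi>c: "continuous_on {0..1} \<Psi>" unfolding \<Psi>_def
  proof (rule continuous_on_unit_extend[where a = 1 and b = "b + 1" and C = C])
    show "continuous_on {0<..<1} (\<lambda>u. cnj (f u) * of_real ((1 - u)\<^sup>2))" by (intro continuous_intros f)
    fix u :: real assume u: "0 < u" "u < 1"
    have "norm (cnj (f u) * of_real ((1 - u)\<^sup>2)) \<le> C * (u * (1 - u) powr (b - 1)) * (1 - u)\<^sup>2"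
      unfolding norm_mult complex_mod_cnj norm_of_real using le[OF u] by (simp add: mult_right_mono)
    also have "\<dots> = C * (u powr 1 * (1 - u) powr (b + 1))"
    proof -
      have "(1 - u) powr (b - 1) * (1 - u)\<^sup>2 = (1 - u) powr (b - 1) * (1 - u) powr 2" using u by simp
      also have "\<dots> = (1 - u) powr (b + 1)" by (simp add: add.commute flip: powr_add)
      finally show ?thesis using u by (simp add: mult.assoc)
    qed
    finally show "norm (cnj (f u) * of_real ((1 - u)\<^sup>2)) \<le> C * (u powr 1 * (1 - u) powr (b + 1))" .
  qed (use b in auto)
  define \<Phi> where "\<Phi> = (\<lambda>u. if 0 < u \<and> u < 1 then of_real ((norm (f u))\<^sup>2 * (1 - u)\<^sup>2) else (0 :: complex))"
  have \<Phi>c: "continuous_on {0..1} \<Phi>" unfolding \<Phi>_def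
  proof (rule continuous_on_unit_extend[where a = 2 and b = "2 * b" and C = "C\<^sup>2"])
    show "continuous_on {0<..<1} (\<lambda>u. complex_of_real ((norm (f u))\<^sup>2 * (1 - u)\<^sup>2))" by (intro continuous_intros f)
    fix u :: real assume u: "0 < u" "u < 1"
    have "norm (complex_of_real ((norm (f u))\<^sup>2 * (1 - u)\<^sup>2)) = (norm (f u) * (1 - u))\<^sup>2"
      unfolding norm_of_real by (simp add: power_mult_distrib)
    also have "\<dots> \<le> (C * (u * (1 - u) powr (b - 1)) * (1 - u))\<^sup>2" using le[OF u] u by (intro power_mono mult_right_mono) auto
    also have "\<dots> = C\<^sup>2 * (u powr 2 * ((1 - u) powr (b - 1) * (1 - u))\<^sup>2)" using u by (simp add: power_mult_distrib)
    also have "((1 - u) powr (b - 1) * (1 - u))\<^sup>2 = (1 - u) powr (2 * b)"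
    proof -
      have "(1 - u) powr (b - 1) * (1 - u) = (1 - u) powr b" using u powr_add[of "1 - u" "b - 1" 1] by simp
      thus ?thesis using u by (simp add: power2_eq_square flip: powr_add)
    qed
    finally show "norm (complex_of_real ((norm (f u))\<^sup>2 * (1 - u)\<^sup>2)) \<le> C\<^sup>2 * (u powr 2 * (1 - u) powr (2 * b))" .
  qed (use b in auto)
  have R: "continuous_on {0..1} (\<lambda>u. Re (\<Psi> u))" and I: "continuous_on {0..1} (\<lambda>u. Im (\<Psi> u))"
    by (intro continuous_intros \<Psi>c)+
  have z: "(LBINT u:{0<..<1}. f u * of_real (Re (\<Psi> u)) + \<i> * (f u * of_real (Im (\<Psi> u)))) = 0"
    using cont0[OF R] cont0[OF I] prodint[OF R] prodint[OF I] by (subst set_integral_add(2)) auto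
  have zi: "set_integrable lborel {0<..<1} (\<lambda>u. f u * of_real (Re (\<Psi> u)) + \<i> * (f u * of_real (Im (\<Psi> u))))"
    by (intro set_integral_add(1) set_integrable_mult_right impI prodint R I)
  have eq: "f u * of_real (Re (\<Psi> u)) + \<i> * (f u * of_real (Im (\<Psi> u))) = \<Phi> u" if "u \<in> {0<..<1}" for u
  proof -
    have "f u * of_real (Re (\<Psi> u)) + \<i> * (f u * of_real (Im (\<Psi> u))) = f u * (of_real (Re (\<Psi> u)) + \<i> * of_real (Im (\<Psi> u)))"
      by (simp add: algebra_simps)
    also have "of_real (Re (\<Psi> u)) + \<i> * of_real (Im (\<Psi> u)) = \<Psi> u" by (simp add: complex_eq_iff)
    also have "f u * \<Psi> u = \<Phi> u"
    proof -
      have "0 < u \<and> u < 1" using that by simp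
      hence "\<Psi> u = cnj (f u) * of_real ((1 - u)\<^sup>2)" "\<Phi> u = of_real ((norm (f u))\<^sup>2) * of_real ((1 - u)\<^sup>2)"
        unfolding \<Psi>_def \<Phi>_def by (simp_all only: if_True of_real_mult simp_thms)
      thus ?thesis by (simp only: complex_norm_square mult.assoc)
    qed
    finally show ?thesis .
  qed
  have "((\<lambda>u. f u * of_real (Re (\<Psi> u)) + \<i> * (f u * of_real (Im (\<Psi> u)))) has_integral 0) {0<..<1}"
    using set_borel_integral_eq_integral[OF zi] z by (simp add: has_integral_integrable_integral)
  hence "(\<Phi> has_integral 0) {0<..<1}" by (rule has_integral_eq[rotated]) (rule eq)
  hence "((\<lambda>u. Re (\<Phi> u)) has_integral Re 0) {0..1}"
    unfolding has_integral_Icc_iff_Ioo by (rule has_integral_linear[OF _ bounded_linear_Re, unfolded o_def])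
  hence h0: "((\<lambda>u. Re (\<Phi> u)) has_integral 0) (cbox 0 1)" by simp
  have "Re (\<Phi> u) = 0"
  proof (rule has_integral_0_cbox_imp_0[OF _ _ h0])
    show "continuous_on (cbox 0 1) (\<lambda>u. Re (\<Phi> u))" using \<Phi>c by (auto intro: continuous_intros)
  qed (use u in \<open>auto simp: \<Phi>_def\<close>)
  thus ?thesis using u by (simp add: \<Phi>_def)
qed

text \<open>
  The moments of the difference of the two kernels, multiplied by a high power of \<open>u\<close>, are values of the
  Mellin transforms far to the right, so all of them vanish.
\<close>

lemma ser_kernel_unique:
  assumes t1: "tempered c1 r1" and t2: "tempered c2 r2" and g: "Re g > 0"
    and eq: "\<And>\<rho>. Re \<rho> > R \<Longrightarrow> (LBINT u:{0<..<1}. ser_kernel e1 g c1 u * of_real u powr (\<rho> - 1)) =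
                              (LBINT u:{0<..<1}. ser_kernel e2 g c2 u * of_real u powr (\<rho> - 1))"
    and u: "0 < u" "u < 1"
  shows "ser_kernel e1 g c1 u = ser_kernel e2 g c2 u"
proof -
  obtain C1 where C1: "C1 > 0" "\<And>u. 0 < u \<Longrightarrow> u < 1 \<Longrightarrow> norm (ser_kernel e1 g c1 u) \<le> C1 * (u powr (Re e1 - r1) * (1 - u) powr (Re g - 1))"
  proof -
    obtain C where "C > 0" "\<forall>u. 0 < u \<longrightarrow> u < 1 \<longrightarrow> norm (ser_kernel e1 g c1 u) \<le> C * (u powr (Re e1 - r1) * (1 - u) powr (Re g - 1))"
      using ser_kernel_bounds[OF t1, of e1 g] by blast
    thus ?thesis by (intro that[of C]) auto
  qed
  obtain C2 where C2: "C2 > 0" "\<And>u. 0 < u \<Longrightarrow> u < 1 \<Longrightarrow> norm (ser_kernel e2 g c2 u) \<le> C2 * (u powr (Re e2 - r2) * (1 - u) powr (Re g - 1))"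
  proof -
    obtain C where "C > 0" "\<forall>u. 0 < u \<longrightarrow> u < 1 \<longrightarrow> norm (ser_kernel e2 g c2 u) \<le> C * (u powr (Re e2 - r2) * (1 - u) powr (Re g - 1))"
      using ser_kernel_bounds[OF t2, of e2 g] by blast
    thus ?thesis by (intro that[of C]) auto
  qed
  \<comment> \<open>Large enough for the Mellin transforms to agree at \<open>s + n\<close> and for both kernels times
      \<open>u powr (s - 1)\<close> to be \<open>O(u)\<close>.\<close>
  define s where "s = \<bar>R\<bar> + \<bar>Re e1 - r1\<bar> + \<bar>Re e2 - r2\<bar> + 2"
  define f where "f = (\<lambda>u. (ser_kernel e1 g c1 u - ser_kernel e2 g c2 u) * of_real u powr (of_real s - 1))"
  have "f u = 0"
  proof (rule vanishing_moments[where f = f and b = "Re g" and C = "C1 + C2"])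
    show "continuous_on {0<..<1} f" unfolding f_def
      by (intro continuous_intros ser_kernel_continuous(1)[OF t1] ser_kernel_continuous(1)[OF t2]
          continuous_on_subset[OF continuous_on_of_real_powr]) auto
    fix u :: real assume u: "0 < u" "u < 1"
    have p: "u powr (Re e - r) * u powr (s - 1) \<le> u" if "s \<ge> \<bar>Re e - r\<bar> + 2" for e r
    proof -
      have "u powr (Re e - r) * u powr (s - 1) = u powr (Re e - r + (s - 1))" by (simp add: powr_add)
      also have "\<dots> \<le> u powr 1" using u that by (intro powr_mono') auto
      finally show ?thesis using u by simp
    qed
    have "norm (f u) \<le> (norm (ser_kernel e1 g c1 u) + norm (ser_kernel e2 g c2 u)) * u powr (s - 1)"
      using u unfolding f_def norm_mult by (simp add: norm_of_real_powr mult_right_mono norm_triangle_ineq4)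
    also have "\<dots> \<le> (C1 * (u powr (Re e1 - r1) * (1 - u) powr (Re g - 1)) + C2 * (u powr (Re e2 - r2) * (1 - u) powr (Re g - 1))) * u powr (s - 1)"
      by (intro mult_right_mono add_mono C1 C2 u) auto
    also have "\<dots> = C1 * ((u powr (Re e1 - r1) * u powr (s - 1)) * (1 - u) powr (Re g - 1)) + C2 * ((u powr (Re e2 - r2) * u powr (s - 1)) * (1 - u) powr (Re g - 1))"
      by (simp add: algebra_simps)
    also have "\<dots> \<le> C1 * (u * (1 - u) powr (Re g - 1)) + C2 * (u * (1 - u) powr (Re g - 1))"
      using C1(1) C2(1) by (intro add_mono mult_left_mono mult_right_mono p) (auto simp: s_def)
    finally show "norm (f u) \<le> (C1 + C2) * (u * (1 - u) powr (Re g - 1))" by (simp add: algebra_simps)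
  next
    fix n :: nat
    let ?\<rho> = "of_real s + of_nat n :: complex"
    have R: "Re ?\<rho> > R" "Re (?\<rho> + e1) > r1" "Re (?\<rho> + e2) > r2" by (auto simp: s_def)
    have "(LBINT u:{0<..<1}. f u * of_real u ^ n) = (LBINT u:{0<..<1}. ser_kernel e1 g c1 u * of_real u powr (?\<rho> - 1) - ser_kernel e2 g c2 u * of_real u powr (?\<rho> - 1))"
    proof (rule set_lebesgue_integral_cong)
      show "\<forall>u. u \<in> {0<..<1} \<longrightarrow> f u * of_real u ^ n = ser_kernel e1 g c1 u * of_real u powr (?\<rho> - 1) - ser_kernel e2 g c2 u * of_real u powr (?\<rho> - 1)"
      proof safe
        fix u :: real assume "u \<in> {0<..<1}"
        hence u: "u > 0" by simp
        have "of_real u powr (?\<rho> - 1) = of_real u powr ((of_real s - 1) + of_nat n)" by (simp add: algebra_simps)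
        also have "\<dots> = of_real u powr (of_real s - 1) * of_real u powr of_nat n" by (rule powr_add)
        also have "of_real u powr of_nat n = (of_real u :: complex) ^ n" using u by (simp add: powr_nat')
        finally show "f u * of_real u ^ n = ser_kernel e1 g c1 u * of_real u powr (?\<rho> - 1) - ser_kernel e2 g c2 u * of_real u powr (?\<rho> - 1)"
          unfolding f_def by (simp add: algebra_simps)
      qed
    qed simp
    also have "\<dots> = 0"
      by (subst set_integral_diff(2)[OF ser_kernel_Mellin(1)[OF t1 g R(2)] ser_kernel_Mellin(1)[OF t2 g R(3)]])
         (use eq[OF R(1)] in simp)
    finally show "(LBINT u:{0<..<1}. f u * of_real u ^ n) = 0" .
  qed (use g u in auto)
  thus ?thesis using u by (simp add: f_def)
qed

text \<open>
  Coefficients for which the kernel with exponent \<open>e\<^sub>1\<close> has a Mellin transform proportional to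
  \<open>\<Gamma>(\<rho> + e\<^sub>1) \<Gamma>(\<rho> + e\<^sub>2) \<Gamma>(\<rho> + e\<^sub>3) / (\<Gamma>(\<rho> + d\<^sub>1) \<Gamma>(\<rho> + d\<^sub>2) \<Gamma>(\<rho> + d\<^sub>3))\<close>.  This is Noerlund's expansion of a
  Meijer function at \<open>u = 1\<close>; the parameters do not enter the series symmetrically.
\<close>

definition norlund_coeff :: "complex \<Rightarrow> complex \<Rightarrow> complex \<Rightarrow> complex \<Rightarrow> complex \<Rightarrow> complex \<Rightarrow> nat \<Rightarrow> complex" where
  "norlund_coeff e1 e2 e3 d1 d2 d3 = f3_coeff (d3 - e2) (d1 - e3) (d2 - e2) (d1 - e1) (d1 + d2 + d3 - e1 - e2 - e3)"

lemma norlund_Mellin: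
  assumes g: "g = d1 + d2 + d3 - e1 - e2 - e3" "Re g > 0" and P: "P > 0" "P \<ge> Re (d1 - e3)"
    and r: "r > 0" "r > P - Re (d1 - e1)" "r > P + Re (e3 + e1 - e2 - d1)"
  shows "tempered (norlund_coeff e1 e2 e3 d1 d2 d3) r"
    and "Re (\<rho> + e1) > r \<Longrightarrow> (LBINT u:{0<..<1}. ser_kernel e1 g (norlund_coeff e1 e2 e3 d1 d2 d3) u * of_real u powr (\<rho> - 1)) =
       Gamma g * (Gamma (\<rho> + e1) * Gamma (\<rho> + e2) * Gamma (\<rho> + e3)) * (rGamma (\<rho> + d1) * rGamma (\<rho> + d2) * rGamma (\<rho> + d3))"
proof -
  have gn: "g \<notin> \<int>\<^sub>\<le>\<^sub>0" using g(2) Re_pos_not_nonpos_Int by blast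
  have r3: "r > P + Re (d3 - e2) + Re (d2 - e2) - Re g" using r(3) by (simp add: g(1))
  show "tempered (norlund_coeff e1 e2 e3 d1 d2 d3) r"
    unfolding norlund_coeff_def g(1)[symmetric] by (rule f3_coeff_tempered[OF gn P r(1,2) r3])
  assume \<rho>: "Re (\<rho> + e1) > r"
  have e: "\<rho> + e1 + (d1 - e1) - (d1 - e3) = \<rho> + e3" "\<rho> + e1 + g - (d3 - e2) - (d1 - e3) - (d2 - e2) = \<rho> + e2"
    "\<rho> + e1 + (d1 - e1) = \<rho> + d1" "\<rho> + e1 + g - (d3 - e2) - (d1 - e3) = \<rho> + d2" "\<rho> + e1 + g - (d1 - e3) - (d2 - e2) = \<rho> + d3"
    by (simp_all add: g(1))
  show "(LBINT u:{0<..<1}. ser_kernel e1 g (norlund_coeff e1 e2 e3 d1 d2 d3) u * of_real u powr (\<rho> - 1)) =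
       Gamma g * (Gamma (\<rho> + e1) * Gamma (\<rho> + e2) * Gamma (\<rho> + e3)) * (rGamma (\<rho> + d1) * rGamma (\<rho> + d2) * rGamma (\<rho> + d3))"
    using f3_kernel_Mellin[OF g(2) P r(1,2) r3 \<rho>] unfolding norlund_coeff_def g(1)[symmetric] e
    by (simp add: mult_ac)
qed

lemma min_to_third:
  fixes e1 e2 e3 :: complex
  obtains a1 a2 a3 where "a1 + a2 + a3 = e1 + e2 + e3" "{a1, a2, a3} = {e1, e2, e3}" "Re a3 \<le> Re e1" "Re a3 \<le> Re e2" "Re a3 \<le> Re e3"
    "\<And>f :: complex \<Rightarrow> complex. f a1 * f a2 * f a3 = f e1 * f e2 * f e3"
proof -
  consider "Re e3 \<le> Re e1" "Re e3 \<le> Re e2" | "Re e2 \<le> Re e1" "Re e2 \<le> Re e3" | "Re e1 \<le> Re e2" "Re e1 \<le> Re e3" by linarith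
  thus ?thesis
  proof cases
    case 1 thus ?thesis by (intro that[of e1 e2 e3]) auto
  next
    case 2 thus ?thesis by (intro that[of e1 e3 e2]) auto
  next
    case 3 thus ?thesis by (intro that[of e2 e3 e1]) (auto simp: mult_ac)
  qed
qed

text \<open>
  The hypotheses on \<open>r\<close> say that \<open>Re (\<rho> + e\<^sub>i) > 0\<close> for all \<open>i\<close> when \<open>Re \<rho> \<ge> r\<close>.  The given arrangement
  of the parameters has the known Mellin transform only far to the right.  With an \<open>e\<^sub>j\<close> of
  smallest real part in third place and a \<open>d\<^sub>i\<close> of largest real part in first place, the parameter
  \<open>A' = d\<^sub>1 - e\<^sub>3\<close> has positive real part and the transform is valid up to the abscissa \<open>r\<close>.  Both series
  represent the same kernel by uniqueness.
\<close>

theorem f3_kernel_representation: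
  assumes g: "Re g > 0" and r: "r > 0" "r > Re (A' - B')" "r > Re (A + A' + B - g)"
  obtains e c where
    "\<And>u. 0 < u \<Longrightarrow> u < 1 \<Longrightarrow> ser_kernel 0 g (f3_coeff A A' B B' g) u = ser_kernel e g c u"
    "tempered c (r + Re e)"
    "\<And>\<rho>. Re \<rho> > r \<Longrightarrow> (LBINT u:{0<..<1}. ser_kernel e g c u * of_real u powr (\<rho> - 1)) =
       Gamma g * (Gamma \<rho> * Gamma (\<rho> + B' - A') * Gamma (\<rho> + g - A - A' - B)) *
         (rGamma (\<rho> + B') * rGamma (\<rho> + g - A - A') * rGamma (\<rho> + g - A' - B))"
proof -
  define e1 e2 e3 where "e1 = (0 :: complex)" and "e2 = g - A - A' - B" and "e3 = B' - A'"
  define d1 d2 d3 where "d1 = B'" and "d2 = g - A - A'" and "d3 = g - A' - B"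
  note defs = e1_def e2_def e3_def d1_def d2_def d3_def
  have gd: "g = d1 + d2 + d3 - e1 - e2 - e3" by (simp add: defs)
  have co: "norlund_coeff e1 e2 e3 d1 d2 d3 = f3_coeff A A' B B' g"
    unfolding norlund_coeff_def gd[symmetric] by (simp add: defs)
  obtain a1 a2 a3 where a: "a1 + a2 + a3 = e1 + e2 + e3" "{a1, a2, a3} = {e1, e2, e3}" "Re a3 \<le> Re e1" "Re a3 \<le> Re e2" "Re a3 \<le> Re e3"
    and af: "\<And>f :: complex \<Rightarrow> complex. f a1 * f a2 * f a3 = f e1 * f e2 * f e3"
    by (rule min_to_third[of e1 e2 e3]) (rule that)
  \<comment> \<open>The minimum of the negatives serves as the maximum of the \<open>d\<^sub>i\<close>.\<close>
  obtain b1 b2 b3 where b: "b1 + b2 + b3 = - d1 + - d2 + - d3" "{b1, b2, b3} = {- d1, - d2, - d3}" "Re b3 \<le> Re (- d1)" "Re b3 \<le> Re (- d2)" "Re b3 \<le> Re (- d3)"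
    and bf: "\<And>f :: complex \<Rightarrow> complex. f b1 * f b2 * f b3 = f (- d1) * f (- d2) * f (- d3)"
    by (rule min_to_third[of "- d1" "- d2" "- d3"]) (rule that)
  have ga: "g = - b3 + - b2 + - b1 - a1 - a2 - a3"
  proof -
    have "- b3 + - b2 + - b1 - a1 - a2 - a3 = - (b1 + b2 + b3) - (a1 + a2 + a3)" by simp
    also have "\<dots> = g" unfolding a(1) b(1) gd by simp
    finally show ?thesis by simp
  qed
  have pos: "Re (- b3 - a3) > 0"
  proof -
    have "3 * Re (- b3) \<ge> Re d1 + Re d2 + Re d3" using b(3-5) by simp
    moreover have "3 * Re a3 \<le> Re e1 + Re e2 + Re e3" using a(3-5) by simp
    moreover have "Re d1 + Re d2 + Re d3 - (Re e1 + Re e2 + Re e3) > 0" using g by (simp add: gd)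
    ultimately show ?thesis by simp
  qed
  have re: "r > - Re e" if "e \<in> {e1, e2, e3}" for e using that r by (auto simp: defs)
  have ra: "r > - Re a1" "r > - Re a2" "r > - Re a3" using re a(2) by blast+
  have r': "r + Re a1 > 0" "r + Re a1 > Re (- b3 - a3) - Re (- b3 - a1)" "r + Re a1 > Re (- b3 - a3) + Re (a3 + a1 - a2 - - b3)"
    using ra by auto
  have t: "tempered (norlund_coeff a1 a2 a3 (- b3) (- b2) (- b1)) (r + Re a1)"
    by (rule norlund_Mellin(1)[OF ga g pos order_refl r'])
  have M: "(LBINT u:{0<..<1}. ser_kernel a1 g (norlund_coeff a1 a2 a3 (- b3) (- b2) (- b1)) u * of_real u powr (\<rho> - 1)) =
       Gamma g * (Gamma (\<rho> + e1) * Gamma (\<rho> + e2) * Gamma (\<rho> + e3)) * (rGamma (\<rho> + d1) * rGamma (\<rho> + d2) * rGamma (\<rho> + d3))"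
    if \<rho>: "Re \<rho> > r" for \<rho>
  proof -
    have "Re (\<rho> + a1) > r + Re a1" using \<rho> by simp
    from norlund_Mellin(2)[OF ga g pos order_refl r' this]
    show ?thesis using af[of "\<lambda>e. Gamma (\<rho> + e)"] bf[of "\<lambda>d. rGamma (\<rho> - d)"] by (simp add: mult_ac)
  qed
  define P where "P = \<bar>Re (d1 - e3)\<bar> + 1"
  define R where "R = \<bar>P - Re (d1 - e1)\<bar> + \<bar>P + Re (e3 + e1 - e2 - d1)\<bar> + r + 1"
  have PR: "P > 0" "P \<ge> Re (d1 - e3)" "R > 0" "R > P - Re (d1 - e1)" "R > P + Re (e3 + e1 - e2 - d1)" "R > r"
    using r(1) unfolding P_def R_def by linarith+
  have t0: "tempered (f3_coeff A A' B B' g) R"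
    using norlund_Mellin(1)[OF gd g PR(1-5)] unfolding co .
  have M0: "(LBINT u:{0<..<1}. ser_kernel 0 g (f3_coeff A A' B B' g) u * of_real u powr (\<rho> - 1)) =
       Gamma g * (Gamma (\<rho> + e1) * Gamma (\<rho> + e2) * Gamma (\<rho> + e3)) * (rGamma (\<rho> + d1) * rGamma (\<rho> + d2) * rGamma (\<rho> + d3))"
    if \<rho>: "Re \<rho> > R" for \<rho>
    using norlund_Mellin(2)[OF gd g PR(1-5), of \<rho>] \<rho> unfolding co by (simp add: e1_def)
  show ?thesis
  proof (rule that[OF _ t])
    show "ser_kernel 0 g (f3_coeff A A' B B' g) u = ser_kernel a1 g (norlund_coeff a1 a2 a3 (- b3) (- b2) (- b1)) u" if "0 < u" "u < 1" for u
      by (rule ser_kernel_unique[OF t0 t g _ that, where R = R]) (use M0 M PR in simp)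
    show "(LBINT u:{0<..<1}. ser_kernel a1 g (norlund_coeff a1 a2 a3 (- b3) (- b2) (- b1)) u * of_real u powr (\<rho> - 1)) =
       Gamma g * (Gamma \<rho> * Gamma (\<rho> + B' - A') * Gamma (\<rho> + g - A - A' - B)) *
         (rGamma (\<rho> + B') * rGamma (\<rho> + g - A - A') * rGamma (\<rho> + g - A' - B))" if "Re \<rho> > r" for \<rho>
      using M[OF that] by (simp add: defs algebra_simps)
  qed
qed

section \<open>Integration by parts against the kernel\<close>

text \<open>
  The two inequalities on \<open>a\<close> and \<open>b\<close> make the product of kernel and \<open>D\<close> vanish at both end points and the
  product with the differentiated kernel absolutely integrable.  The derivative \<open>D'\<close> is arbitrary, so
  the integral on the left of the result is in general only a gauge integral.
\<close>

lemma ser_kernel_by_parts: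
  fixes D D' :: "real \<Rightarrow> complex"
  assumes t: "tempered c s"
    and ab: "a + Re e - s > 0" "b + Re g - 1 > 0"
    and D: "\<And>u. 0 < u \<Longrightarrow> u < 1 \<Longrightarrow> (D has_vector_derivative D' u) (at u)"
    and bd: "\<And>u. 0 < u \<Longrightarrow> u < 1 \<Longrightarrow> norm (D u) \<le> M * (u powr a * (1 - u) powr b)"
  shows "set_integrable lborel {0<..<1} (\<lambda>u. ser_kernel_deriv e g c u * D u)"
    and "((\<lambda>u. ser_kernel e g c u * D' u) has_integral - (LBINT u:{0<..<1}. ser_kernel_deriv e g c u * D u)) {0<..<1}"
proof -
  let ?K = "ser_kernel e g c" and ?K' = "ser_kernel_deriv e g c"
  obtain C where C: "C > 0" and Cb: "\<forall>u. 0 < u \<longrightarrow> u < 1 \<longrightarrow>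
    norm (?K u) \<le> C * (u powr (Re e - s) * (1 - u) powr (Re g - 1)) \<and>
    norm (?K' u) \<le> C * (u powr (Re e - s - 1) * (1 - u) powr (Re g - 2))"
    using ser_kernel_bounds[OF t] by blast
  have Dc: "continuous_on {0<..<1} D"
    using D by (intro continuous_at_imp_continuous_on ballI has_vector_derivative_continuous) auto
  show int: "set_integrable lborel {0<..<1} (\<lambda>u. ?K' u * D u)"
  proof (rule set_integrable_unit_dominated[where a = "a + Re e - s" and b = "b + Re g - 1" and C = "C * M"])
    show "continuous_on {0<..<1} (\<lambda>u. ?K' u * D u)" by (intro continuous_intros ser_kernel_continuous(2)[OF t] Dc)
    fix u :: real assume u: "0 < u" "u < 1"
    have "norm (?K' u * D u) \<le> (C * (u powr (Re e - s - 1) * (1 - u) powr (Re g - 2))) * (M * (u powr a * (1 - u) powr b))"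
      unfolding norm_mult using Cb bd[OF u] u C by (intro mult_mono) auto
    also have "\<dots> = (C * M) * ((u powr (Re e - s - 1) * u powr a) * ((1 - u) powr (Re g - 2) * (1 - u) powr b))" by (simp add: mult_ac)
    also have "u powr (Re e - s - 1) * u powr a = u powr (a + Re e - s - 1)" unfolding powr_add[symmetric] by (simp add: algebra_simps)
    also have "(1 - u) powr (Re g - 2) * (1 - u) powr b = (1 - u) powr (b + Re g - 1 - 1)" unfolding powr_add[symmetric] by (simp add: algebra_simps)
    finally show "norm (?K' u * D u) \<le> C * M * (u powr (a + Re e - s - 1) * (1 - u) powr (b + Re g - 1 - 1))" .
  qed (use ab in auto)
  define F where "F = (\<lambda>u. if 0 < u \<and> u < 1 then ?K u * D u else 0)"
  have "continuous_on {0..1} F" unfolding F_def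
  proof (rule continuous_on_unit_extend[where a = "a + Re e - s" and b = "b + Re g - 1" and C = "C * M"])
    show "continuous_on {0<..<1} (\<lambda>u. ?K u * D u)" by (intro continuous_intros ser_kernel_continuous(1)[OF t] Dc)
    fix u :: real assume u: "0 < u" "u < 1"
    have "norm (?K u * D u) \<le> (C * (u powr (Re e - s) * (1 - u) powr (Re g - 1))) * (M * (u powr a * (1 - u) powr b))"
      unfolding norm_mult using Cb bd[OF u] u C by (intro mult_mono) auto
    also have "\<dots> = (C * M) * ((u powr (Re e - s) * u powr a) * ((1 - u) powr (Re g - 1) * (1 - u) powr b))" by (simp add: mult_ac)
    also have "u powr (Re e - s) * u powr a = u powr (a + Re e - s)" unfolding powr_add[symmetric] by (simp add: algebra_simps)
    also have "(1 - u) powr (Re g - 1) * (1 - u) powr b = (1 - u) powr (b + Re g - 1)" unfolding powr_add[symmetric] by (simp add: algebra_simps)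
    finally show "norm (?K u * D u) \<le> C * M * (u powr (a + Re e - s) * (1 - u) powr (b + Re g - 1))" .
  qed (use ab in auto)
  moreover have "(F has_vector_derivative (?K u * D' u + ?K' u * D u)) (at u)" if "u \<in> {0<..<1}" for u
  proof -
    have "((\<lambda>u. ?K u * D u) has_vector_derivative (?K u * D' u + ?K' u * D u)) (at u)"
      using that by (intro has_vector_derivative_mult ser_kernel_has_vector_derivative[OF t] D) auto
    thus ?thesis
      by (rule has_vector_derivative_transform_within_open[where S = "{0<..<1}"]) (use that in \<open>auto simp: F_def\<close>)
  qed
  ultimately have "((\<lambda>u. ?K u * D' u + ?K' u * D u) has_integral (F 1 - F 0)) {0..1}"
    by (intro fundamental_theorem_of_calculus_interior) auto
  hence 1: "((\<lambda>u. ?K u * D' u + ?K' u * D u) has_integral 0) {0<..<1}"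
    by (simp add: F_def has_integral_Icc_iff_Ioo)
  have 2: "((\<lambda>u. ?K' u * D u) has_integral (LBINT u:{0<..<1}. ?K' u * D u)) {0<..<1}"
    using set_borel_integral_eq_integral[OF int] by (simp add: has_integral_integrable_integral)
  show "((\<lambda>u. ?K u * D' u) has_integral - (LBINT u:{0<..<1}. ?K' u * D u)) {0<..<1}"
    using has_integral_diff[OF 1 2] by simp
qed

lemma abs_ln_le:
  assumes u: "0 < u" "u < 1" and \<eta>: "0 < \<eta>" "\<eta> \<le> (1::real)"
  shows "\<bar>ln u\<bar> \<le> u powr (- \<eta>) * (1 - u) / \<eta>"
proof -
  have "\<eta> * \<bar>ln u\<bar> = ln (u powr (- \<eta>))" using u \<eta> by (simp add: ln_powr)
  also have "\<dots> \<le> u powr (- \<eta>) - 1" by (rule ln_le_minus_one) (use u in auto)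
  also have "\<dots> = u powr (- \<eta>) * (1 - u powr \<eta>)" using u by (simp add: algebra_simps flip: powr_add)
  also have "\<dots> \<le> u powr (- \<eta>) * (1 - u)"
    using powr_mono'[of \<eta> 1 u] u \<eta> by (intro mult_left_mono) auto
  finally show ?thesis using \<eta> by (simp add: field_simps)
qed

text \<open>
  Interpolation between the bounds 2 and \<open>\<bar>x\<bar>\<close>.
\<close>

lemma norm_cis_minus_one_le:
  fixes x \<delta> :: real
  assumes \<delta>: "0 < \<delta>" "\<delta> \<le> 1"
  shows "norm (exp (\<i> * of_real x) - 1) \<le> 2 * \<bar>x\<bar> powr \<delta>"
proof -
  have n: "norm (exp (\<i> * of_real x) - 1) = 2 * \<bar>sin (x / 2)\<bar>" by (rule dist_exp_i_1)
  show ?thesis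
  proof (cases "\<bar>x\<bar> \<ge> 1")
    case True
    have "\<bar>sin (x / 2)\<bar> \<le> 1" by simp
    also have "1 \<le> \<bar>x\<bar> powr \<delta>" using True \<delta> by (intro ge_one_powr_ge_zero) auto
    finally show ?thesis unfolding n by simp
  next
    case False
    have "2 * \<bar>sin (x / 2)\<bar> \<le> 2 * \<bar>x / 2\<bar>" by (intro mult_left_mono abs_sin_x_le_abs_x) auto
    also have "\<dots> \<le> \<bar>x\<bar>" by simp
    also have "\<bar>x\<bar> \<le> \<bar>x\<bar> powr \<delta>"
    proof (cases "x = 0")
      case False
      thus ?thesis using \<open>\<not> \<bar>x\<bar> \<ge> 1\<close> \<delta> powr_mono'[of \<delta> 1 "\<bar>x\<bar>"] by simp
    qed simp
    also have "\<dots> \<le> 2 * \<bar>x\<bar> powr \<delta>" by simp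
    finally show ?thesis unfolding n .
  qed
qed

text \<open>
  An exponent \<open>\<delta>\<close> below 1 gives up smoothness at \<open>u = 1\<close> in exchange for less growth in \<open>y\<close>.  The loss \<open>\<eta>\<close> in
  the exponent of \<open>u\<close> pays for the logarithm at \<open>u = 0\<close>.
\<close>

lemma oscillation_bound:
  fixes r0 :: complex and \<mu> \<delta> \<eta> :: real
  assumes u: "0 < u" "u < 1" and \<delta>: "0 < \<delta>" "\<delta> \<le> 1" and \<eta>: "0 < \<eta>" "\<eta> \<le> 1" and \<mu>: "\<mu> > 0"
  shows "norm (of_real u powr (r0 - \<i> * of_real (\<mu> * y)) - of_real u powr r0)
      \<le> 2 * (\<mu> / \<eta>) powr \<delta> * (1 + \<bar>y\<bar>) powr \<delta> * (u powr (Re r0 - \<eta>) * (1 - u) powr \<delta>)"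
proof -
  define x where "x = - (\<mu> * y * ln u)"
  have "of_real u powr (r0 - \<i> * of_real (\<mu> * y)) = of_real u powr r0 * exp (\<i> * of_real x)"
  proof -
    have "Ln (of_real u) = of_real (ln u)" using u by (subst Ln_of_real) auto
    thus ?thesis using u by (simp add: powr_def x_def algebra_simps flip: exp_add)
  qed
  hence "of_real u powr (r0 - \<i> * of_real (\<mu> * y)) - of_real u powr r0 = of_real u powr r0 * (exp (\<i> * of_real x) - 1)"
    by (simp add: algebra_simps)
  hence "norm (of_real u powr (r0 - \<i> * of_real (\<mu> * y)) - of_real u powr r0) = u powr Re r0 * norm (exp (\<i> * of_real x) - 1)"
    using u by (simp add: norm_mult norm_of_real_powr)
  also have "\<dots> \<le> u powr Re r0 * (2 * \<bar>x\<bar> powr \<delta>)" by (intro mult_left_mono norm_cis_minus_one_le \<delta>) auto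
  also have "\<dots> \<le> u powr Re r0 * (2 * ((\<mu> / \<eta>) * (1 + \<bar>y\<bar>) * (u powr (- \<eta>) * (1 - u))) powr \<delta>)"
  proof (intro mult_left_mono powr_mono2)
    have "\<bar>x\<bar> = \<mu> * \<bar>y\<bar> * \<bar>ln u\<bar>" using \<mu> by (simp add: x_def abs_mult)
    also have "\<dots> \<le> \<mu> * (1 + \<bar>y\<bar>) * (u powr (- \<eta>) * (1 - u) / \<eta>)"
      using \<mu> by (intro mult_mono abs_ln_le u \<eta>) auto
    finally show "\<bar>x\<bar> \<le> (\<mu> / \<eta>) * (1 + \<bar>y\<bar>) * (u powr (- \<eta>) * (1 - u))" by simp
  qed (use \<delta> in auto)
  also have "((\<mu> / \<eta>) * (1 + \<bar>y\<bar>) * (u powr (- \<eta>) * (1 - u))) powr \<delta> = (\<mu> / \<eta>) powr \<delta> * (1 + \<bar>y\<bar>) powr \<delta> * (u powr (- \<eta> * \<delta>) * (1 - u) powr \<delta>)"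
    by (simp only: powr_mult powr_powr)
  also have "u powr Re r0 * (2 * ((\<mu> / \<eta>) powr \<delta> * (1 + \<bar>y\<bar>) powr \<delta> * (u powr (- \<eta> * \<delta>) * (1 - u) powr \<delta>)))
     = 2 * (\<mu> / \<eta>) powr \<delta> * (1 + \<bar>y\<bar>) powr \<delta> * ((u powr Re r0 * u powr (- \<eta> * \<delta>)) * (1 - u) powr \<delta>)" by (simp only: mult_ac)
  also have "\<dots> \<le> 2 * (\<mu> / \<eta>) powr \<delta> * (1 + \<bar>y\<bar>) powr \<delta> * (u powr (Re r0 - \<eta>) * (1 - u) powr \<delta>)"
  proof (intro mult_left_mono mult_right_mono)
    have "u powr Re r0 * u powr (- \<eta> * \<delta>) = u powr (Re r0 - \<eta> * \<delta>)" by (simp flip: powr_add)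
    also have "\<dots> \<le> u powr (Re r0 - \<eta>)"
      using u \<delta> \<eta> mult_left_mono[of \<delta> 1 \<eta>] by (intro powr_mono') auto
    finally show "u powr Re r0 * u powr (- \<eta> * \<delta>) \<le> u powr (Re r0 - \<eta>)" .
  qed auto
  finally show ?thesis by simp
qed

text \<open>
  Formally \<open>F\<close> is differentiated under the integral sign and the order of integration exchanged.  The
  weight \<open>W\<close> does not allow this directly, as \<open>\<bar>y\<bar> W(y)\<close> need not be integrable.  Instead
  \<open>D u = F u - F(1) u powr r0\<close> is integrated by parts against the kernel, the exchange is made for the
  product of \<open>D\<close> with the differentiated kernel, and for each \<open>y\<close> the integration by parts is undone.
  The condition \<open>\<delta> + Re g > 1\<close> is what makes \<open>(1 - u) powr (Re g - 2)\<close>, the size of the differentiated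
  kernel, integrable against \<open>(1 - u) powr \<delta>\<close>.
\<close>

theorem kernel_integral_of_derivative:
  fixes W :: "real \<Rightarrow> complex" and F \<phi> :: "real \<Rightarrow> complex" and r0 e g :: complex
  assumes t: "tempered c (r + Re e)" and g: "Re g > 0" and r0: "Re r0 > r" and \<mu>: "\<mu> > 0"
    and \<delta>: "0 < \<delta>" "\<delta> \<le> 1" "\<delta> + Re g - 1 > 0"
    and Wm[measurable]: "W \<in> borel_measurable borel" 
    and W: "integrable lborel (\<lambda>y. of_real ((1 + \<bar>y\<bar>) powr \<delta>) * W y)"
    and F: "\<And>u. 0 < u \<Longrightarrow> u < 1 \<Longrightarrow> F u = (LBINT y. W y * of_real u powr (r0 - \<i> * of_real (\<mu> * y)))"
    and \<phi>: "\<And>u. 0 < u \<Longrightarrow> u < 1 \<Longrightarrow> (F has_vector_derivative \<phi> u) (at u)"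
  defines "M \<equiv> \<lambda>\<rho>. (LBINT u:{0<..<1}. ser_kernel e g c u * of_real u powr (\<rho> - 1))"
  shows "((\<lambda>u. ser_kernel e g c u * \<phi> u) has_integral
           (LBINT y. W y * ((r0 - \<i> * of_real (\<mu> * y)) * M (r0 - \<i> * of_real (\<mu> * y))))) {0<..<1}"
proof -
  let ?K = "ser_kernel e g c" and ?K' = "ser_kernel_deriv e g c"
  define z where "z = (\<lambda>y::real. r0 - \<i> * of_real (\<mu> * y))"
  define \<eta> where "\<eta> = min 1 ((Re r0 - r) / 2)"
  have \<eta>: "0 < \<eta>" "\<eta> \<le> 1" "Re r0 - \<eta> > r"
    using r0 by (auto simp: \<eta>_def min_def field_simps)
  define B where "B = 2 * (\<mu> / \<eta>) powr \<delta>"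
  have B: "B \<ge> 0" by (simp add: B_def)
  define \<omega> where "\<omega> = (\<lambda>y. (1 + \<bar>y\<bar>) powr \<delta> * norm (W y))"
  have \<omega>i: "integrable lborel \<omega>" using integrable_norm[OF W] by (simp add: \<omega>_def norm_mult)
  have \<omega>0: "\<omega> y \<ge> 0" for y by (simp add: \<omega>_def)
  have w1: "1 \<le> (1 + \<bar>y\<bar>) powr \<delta>" for y using \<delta> by (intro ge_one_powr_ge_zero) auto
  have W\<omega>: "norm (W y) \<le> \<omega> y" for y
    unfolding \<omega>_def using mult_right_mono[OF w1[of y] norm_ge_zero[of "W y"]] by simp
  have Wi: "integrable lborel W"
    by (rule Bochner_Integration.integrable_bound[OF \<omega>i]) (use W\<omega> \<omega>0 in \<open>auto intro!: AE_I2\<close>)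
  define d where "d = (\<lambda>u y. of_real u powr z y - of_real u powr r0 :: complex)"
  have db: "norm (d u y) \<le> B * (1 + \<bar>y\<bar>) powr \<delta> * (u powr (Re r0 - \<eta>) * (1 - u) powr \<delta>)" if "0 < u" "u < 1" for u y
    unfolding d_def z_def B_def by (rule oscillation_bound[OF that \<delta>(1,2) \<eta>(1,2) \<mu>])
  have pexp: "of_real u powr s = exp (s * of_real (ln u))" if "0 < u" for u :: real and s :: complex
    using that by (simp add: powr_def Ln_of_real)
  have pw: "integrable lborel (\<lambda>y. W y * of_real u powr z y)" if u: "0 < u" for u
  proof (rule Bochner_Integration.integrable_bound)
    show "integrable lborel (\<lambda>y. u powr Re r0 * \<omega> y)" by (intro integrable_mult_right \<omega>i)
    show "(\<lambda>y. W y * of_real u powr z y) \<in> borel_measurable lborel"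
      unfolding pexp[OF u] z_def by measurable
    show "AE y in lborel. norm (W y * of_real u powr z y) \<le> norm (u powr Re r0 * \<omega> y)"
      using W\<omega> \<omega>0 u by (intro AE_I2) (simp add: norm_mult norm_of_real_powr z_def mult.commute mult_left_mono)
  qed
  \<comment> \<open>The value of \<open>F\<close> at \<open>u = 1\<close>.\<close>
  define F1 where "F1 = (LBINT y. W y)"
  define D where "D = (\<lambda>u. F u - F1 * of_real u powr r0)"
  have DW: "D u = (LBINT y. W y * d u y)" if u: "0 < u" "u < 1" for u
  proof -
    have "(LBINT y. W y * d u y) = (LBINT y. W y * of_real u powr z y - W y * of_real u powr r0)"
      by (simp add: d_def algebra_simps)
    also have "\<dots> = (LBINT y. W y * of_real u powr z y) - (LBINT y. W y * of_real u powr r0)"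
      by (intro Bochner_Integration.integral_diff pw u integrable_mult_left Wi)
    finally show ?thesis unfolding D_def F[OF u] F1_def z_def by simp
  qed
  define V where "V = (LBINT y. \<omega> y)"
  have Db: "norm (D u) \<le> (B * V) * (u powr (Re r0 - \<eta>) * (1 - u) powr \<delta>)" if u: "0 < u" "u < 1" for u
  proof -
    let ?p = "u powr (Re r0 - \<eta>) * (1 - u) powr \<delta>"
    have "norm (D u) \<le> (LBINT y. norm (W y * d u y))" unfolding DW[OF u] by (rule integral_norm_bound)
    also have "\<dots> \<le> (LBINT y. (B * ?p) * \<omega> y)"
    proof (rule integral_mono_AE')
      show "integrable lborel (\<lambda>y. (B * ?p) * \<omega> y)" by (intro integrable_mult_right \<omega>i)
      show "AE y in lborel. norm (W y * d u y) \<le> (B * ?p) * \<omega> y"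
      proof (rule AE_I2)
        fix y
        have "norm (W y * d u y) \<le> norm (W y) * (B * (1 + \<bar>y\<bar>) powr \<delta> * ?p)"
          unfolding norm_mult by (intro mult_left_mono db u) auto
        thus "norm (W y * d u y) \<le> (B * ?p) * \<omega> y" by (simp add: \<omega>_def mult_ac)
      qed
      show "AE y in lborel. 0 \<le> (B * ?p) * \<omega> y" using B \<omega>0 by (intro AE_I2) simp
    qed
    also have "\<dots> = (B * V) * ?p" by (simp add: V_def)
    finally show ?thesis .
  qed
  have a: "Re r0 - \<eta> + Re e - (r + Re e) > 0" using \<eta> by simp
  define D' where "D' = (\<lambda>u. \<phi> u - F1 * (r0 * of_real u powr (r0 - 1)))"
  have Dd: "(D has_vector_derivative D' u) (at u)" if "0 < u" "u < 1" for u
    unfolding D_def D'_def using that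
    by (intro has_vector_derivative_diff \<phi> has_vector_derivative_mult_right of_real_powr_has_vector_derivative)
  note parts = ser_kernel_by_parts[OF t a \<delta>(3) Dd Db]
  define m where "m = (\<lambda>s. s * M s)"
  have Mint: "set_integrable lborel {0<..<1} (\<lambda>u. ?K u * of_real u powr (s - 1))" if "Re s > r" for s
    by (rule ser_kernel_Mellin(1)[OF t g]) (use that in simp)
  have Mhas: "((\<lambda>u. ?K u * of_real u powr (s - 1)) has_integral M s) {0<..<1}" if "Re s > r" for s
    using set_borel_integral_eq_integral[OF Mint[OF that]] by (simp add: has_integral_integrable_integral M_def)
  have Rez: "Re (z y) = Re r0" for y by (simp add: z_def)
  have inner: "(LBINT u:{0<..<1}. ?K' u * d u y) = - (m (z y) - m r0)" for y
  proof -
    have dd: "((\<lambda>u. d u y) has_vector_derivative (z y * of_real u powr (z y - 1) - r0 * of_real u powr (r0 - 1))) (at u)" if "0 < u" "u < 1" for u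
      unfolding d_def using that by (intro has_vector_derivative_diff of_real_powr_has_vector_derivative)
    have 1: "((\<lambda>u. ?K u * (z y * of_real u powr (z y - 1) - r0 * of_real u powr (r0 - 1))) has_integral
        - (LBINT u:{0<..<1}. ?K' u * d u y)) {0<..<1}"
      by (rule ser_kernel_by_parts(2)[OF t a \<delta>(3) dd db])
    have "((\<lambda>u. z y * (?K u * of_real u powr (z y - 1)) - r0 * (?K u * of_real u powr (r0 - 1))) has_integral (z y * M (z y) - r0 * M r0)) {0<..<1}"
      by (intro has_integral_diff has_integral_mult_right Mhas) (use r0 Rez in auto)
    hence "((\<lambda>u. ?K u * (z y * of_real u powr (z y - 1) - r0 * of_real u powr (r0 - 1))) has_integral (m (z y) - m r0)) {0<..<1}"
      by (simp add: m_def algebra_simps)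
    from has_integral_unique[OF 1 this] show ?thesis by (metis minus_minus)
  qed
  \<comment> \<open>The joint integrand is dominated by a product of a function of \<open>u\<close> and a function of \<open>y\<close>, which
      is what Fubini's theorem needs.\<close>
  define h where "h = (\<lambda>u y. indicator {0<..<1::real} u *\<^sub>R (?K' u * (W y * d u y)))"
  obtain C where C: "C > 0" and Cb: "\<forall>u. 0 < u \<longrightarrow> u < 1 \<longrightarrow>
    norm (?K u) \<le> C * (u powr (Re e - (r + Re e)) * (1 - u) powr (Re g - 1)) \<and>
    norm (?K' u) \<le> C * (u powr (Re e - (r + Re e) - 1) * (1 - u) powr (Re g - 2))"
    using ser_kernel_bounds[OF t] by blast
  define p where "p = (\<lambda>u. indicator {0<..<1::real} u *\<^sub>R (C * B * (u powr (Re r0 - \<eta> - r - 1) * (1 - u) powr (\<delta> + Re g - 1 - 1))))"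
  have pint: "integrable lborel p"
  proof -
    have "set_integrable lborel {0<..<1} (\<lambda>u. C * B * (u powr (Re r0 - \<eta> - r - 1) * (1 - u) powr (\<delta> + Re g - 1 - 1)))"
      by (intro set_integrable_mult_right impI set_integrable_unit_real) (use \<eta> \<delta> in auto)
    thus ?thesis by (simp add: set_integrable_def p_def)
  qed
  have p0: "p u \<ge> 0" for u using C B by (simp add: p_def)
  have hb: "norm (h u y) \<le> p u * \<omega> y" for u y
  proof (cases "u \<in> {0<..<1}")
    case True
    hence u: "0 < u" "u < 1" by auto
    have "norm (h u y) = norm (?K' u) * (norm (W y) * norm (d u y))" using True by (simp add: h_def norm_mult)
    also have "\<dots> \<le> (C * (u powr (Re e - (r + Re e) - 1) * (1 - u) powr (Re g - 2))) * (norm (W y) * (B * (1 + \<bar>y\<bar>) powr \<delta> * (u powr (Re r0 - \<eta>) * (1 - u) powr \<delta>)))"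
      using Cb u C by (intro mult_mono mult_left_mono db u) auto
    also have "\<dots> = (C * B * ((u powr (Re e - (r + Re e) - 1) * u powr (Re r0 - \<eta>)) * ((1 - u) powr (Re g - 2) * (1 - u) powr \<delta>))) * \<omega> y"
      by (simp only: \<omega>_def mult_ac)
    also have "u powr (Re e - (r + Re e) - 1) * u powr (Re r0 - \<eta>) = u powr (Re r0 - \<eta> - r - 1)"
      unfolding powr_add[symmetric] by (simp add: algebra_simps)
    also have "(1 - u) powr (Re g - 2) * (1 - u) powr \<delta> = (1 - u) powr (\<delta> + Re g - 1 - 1)"
      unfolding powr_add[symmetric] by (simp add: algebra_simps)
    finally show ?thesis using True by (simp add: p_def)
  qed (simp add: h_def p_def)
  have [measurable]: "(\<lambda>u. indicator {0<..<1::real} u *\<^sub>R ?K' u) \<in> borel_measurable borel"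
    using borel_measurable_continuous_on_indicator[OF _ ser_kernel_continuous(2)[OF t]] by simp
  have heq: "h u y = (indicator {0<..<1::real} u *\<^sub>R ?K' u) * (W y * (exp (z y * of_real (ln u)) - exp (r0 * of_real (ln u))))" for u y
  proof (cases "u \<in> {0<..<1}")
    case True
    thus ?thesis by (simp add: h_def d_def pexp)
  qed (simp add: h_def)
  have hm: "(\<lambda>(u, y). h u y) \<in> borel_measurable (lborel \<Otimes>\<^sub>M lborel)"
    unfolding heq z_def by measurable
  have [measurable]: "p \<in> borel_measurable borel" "\<omega> \<in> borel_measurable borel" unfolding p_def \<omega>_def by measurable
  have pq: "integrable (lborel \<Otimes>\<^sub>M lborel) (\<lambda>(u, y). p u * \<omega> y)"
  proof (rule lborel_pair.Fubini_integrable)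
    show "integrable lborel (\<lambda>u. LBINT y. norm (case (u, y) of (u, y) \<Rightarrow> p u * \<omega> y))"
      using pint p0 \<omega>0 by (simp add: abs_mult)
    show "AE u in lborel. integrable lborel (\<lambda>y. case (u, y) of (u, y) \<Rightarrow> p u * \<omega> y)"
      using \<omega>i by (intro AE_I2) simp
  qed measurable
  have hi: "integrable (lborel \<Otimes>\<^sub>M lborel) (\<lambda>(u, y). h u y)"
    by (rule Bochner_Integration.integrable_bound[OF pq hm]) (use hb p0 \<omega>0 in \<open>auto intro!: AE_I2 simp: abs_mult\<close>)
  have hu: "(LBINT y. h u y) = indicator {0<..<1} u *\<^sub>R (?K' u * D u)" for u
  proof (cases "u \<in> {0<..<1}")
    case True
    thus ?thesis by (simp add: h_def DW)
  qed (simp add: h_def)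
  have hy: "(LBINT u. h u y) = W y * - (m (z y) - m r0)" for y
  proof -
    have "(LBINT u. h u y) = (LBINT u. W y * (indicator {0<..<1::real} u *\<^sub>R (?K' u * d u y)))"
      by (intro Bochner_Integration.integral_cong) (auto simp: h_def mult_ac)
    also have "\<dots> = W y * (LBINT u:{0<..<1}. ?K' u * d u y)" by (simp only: integral_mult_right_zero set_lebesgue_integral_def)
    finally show ?thesis by (simp only: inner)
  qed
  have fub: "(LBINT u:{0<..<1}. ?K' u * D u) = (LBINT y. W y * - (m (z y) - m r0))"
    using lborel_pair.Fubini_integral[OF hi] unfolding hu hy by (simp add: set_lebesgue_integral_def)
  have iy: "integrable lborel (\<lambda>y. W y * - (m (z y) - m r0))"
    using lborel_pair.integrable_snd[OF hi] unfolding hy .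
  have "((\<lambda>u. ?K u * D' u + F1 * (r0 * (?K u * of_real u powr (r0 - 1)))) has_integral
     (- (LBINT u:{0<..<1}. ?K' u * D u) + F1 * (r0 * M r0))) {0<..<1}"
    by (intro has_integral_add parts(2) has_integral_mult_right Mhas r0)
  moreover have "?K u * D' u + F1 * (r0 * (?K u * of_real u powr (r0 - 1))) = ?K u * \<phi> u" for u
    by (simp add: D'_def algebra_simps)
  moreover have "- (LBINT u:{0<..<1}. ?K' u * D u) + F1 * (r0 * M r0) = (LBINT y. W y * m (z y))"
  proof -
    have "(LBINT y. W y * m (z y)) = (LBINT y. W y * m r0 - W y * - (m (z y) - m r0))"
      by (simp add: algebra_simps)
    also have "\<dots> = (LBINT y. W y * m r0) - (LBINT y. W y * - (m (z y) - m r0))"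
      by (intro Bochner_Integration.integral_diff iy integrable_mult_left Wi)
    also have "(LBINT y. W y * m r0) = F1 * m r0" by (simp add: F1_def)
    finally show ?thesis unfolding fub m_def by simp
  qed
  ultimately show ?thesis unfolding m_def z_def by simp
qed

section \<open>Differentiation of a superposition of powers\<close>

lemma has_vector_derivative_complexI:
  fixes q :: "real \<Rightarrow> complex"
  assumes "((\<lambda>t. (q t - q t0) / of_real (t - t0)) \<longlongrightarrow> d) (at t0)"
  shows "(q has_vector_derivative d) (at t0)"
  unfolding has_vector_derivative_complex_iff has_field_derivative_iff
  using tendsto_Re[OF assms] tendsto_Im[OF assms] by (simp del: of_real_diff)

lemma powr_difference_bound:
  fixes s0 :: complex
  assumes t0: "t0 > 0"
  obtains C where "C \<ge> 0"
    "\<And>t \<zeta>. t \<in> {t0 / 2..2 * t0} \<Longrightarrow> Re \<zeta> = Re s0 \<Longrightarrow>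
       norm (of_real t powr \<zeta> - of_real t0 powr \<zeta>) \<le> C * norm \<zeta> * \<bar>t - t0\<bar>"
proof -
  have "continuous_on {t0 / 2..2 * t0} (\<lambda>t. t powr (Re s0 - 1))"
    by (intro continuous_intros) (use t0 in auto)
  hence "bounded ((\<lambda>t. t powr (Re s0 - 1)) ` {t0 / 2..2 * t0})"
    using compact_continuous_image compact_imp_bounded compact_Icc by blast
  then obtain C where C: "\<forall>x\<in>(\<lambda>t. t powr (Re s0 - 1)) ` {t0 / 2..2 * t0}. norm x \<le> C" unfolding bounded_iff by blast
  have Cb: "t powr (Re s0 - 1) \<le> C" if "t \<in> {t0 / 2..2 * t0}" for t using C that by fastforce
  have C0: "C \<ge> 0" using Cb[of t0] t0 powr_ge_zero[of t0 "Re s0 - 1"] by (simp del: powr_ge_zero)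
  show ?thesis
  proof (rule that[OF C0])
    fix t :: real and \<zeta> :: complex assume t: "t \<in> {t0 / 2..2 * t0}" and \<zeta>: "Re \<zeta> = Re s0"
    have "norm (of_real t powr \<zeta> - of_real t0 powr \<zeta>) \<le> (norm \<zeta> * C) * norm (t - t0)"
    proof (rule differentiable_bound[where S = "{t0 / 2..2 * t0}" and f' = "\<lambda>x h. h *\<^sub>R (\<zeta> * of_real x powr (\<zeta> - 1))"])
      fix x assume x: "x \<in> {t0 / 2..2 * t0}"
      show "((\<lambda>t. of_real t powr \<zeta>) has_derivative (\<lambda>h. h *\<^sub>R (\<zeta> * of_real x powr (\<zeta> - 1)))) (at x within {t0 / 2..2 * t0})"
        using of_real_powr_has_vector_derivative[of x \<zeta> "{t0 / 2..2 * t0}"] x t0 by (simp add: has_vector_derivative_def)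
      show "onorm (\<lambda>h. h *\<^sub>R (\<zeta> * of_real x powr (\<zeta> - 1))) \<le> norm \<zeta> * C"
      proof (rule onorm_le)
        fix h :: real
        have "norm (of_real x powr (\<zeta> - 1)) \<le> C" using Cb[OF x] x t0 \<zeta> by (simp add: norm_of_real_powr)
        hence "\<bar>h\<bar> * (norm \<zeta> * norm (of_real x powr (\<zeta> - 1))) \<le> \<bar>h\<bar> * (norm \<zeta> * C)" by (intro mult_left_mono) auto
        thus "norm (h *\<^sub>R (\<zeta> * of_real x powr (\<zeta> - 1))) \<le> norm \<zeta> * C * norm h" by (simp add: norm_mult mult_ac)
      qed
    qed (use t t0 in auto)
    thus "norm (of_real t powr \<zeta> - of_real t0 powr \<zeta>) \<le> C * norm \<zeta> * \<bar>t - t0\<bar>" by (simp add: mult_ac)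
  qed
qed

lemma powr_measurable_exponent:
  assumes "t > 0"
  shows "(\<lambda>y. of_real t powr (s0 - \<i> * of_real (\<mu> * y)) :: complex) \<in> borel_measurable borel"
proof -
  have "(\<lambda>y. of_real t powr (s0 - \<i> * of_real (\<mu> * y)) :: complex) = (\<lambda>y. exp ((s0 - \<i> * of_real (\<mu> * y)) * of_real (ln t)))"
    using assms by (simp add: powr_def Ln_of_real)
  thus ?thesis by (simp only:) measurable
qed

text \<open>
  Dominated convergence of the difference quotients; near \<open>t0\<close> they are bounded by a constant multiple of
  the modulus of the exponent, which is \<open>O(1 + \<bar>y\<bar>)\<close>.
\<close>

lemma power_integral_has_vector_derivative:
  fixes V :: "real \<Rightarrow> complex" and s0 :: complex
  assumes Vm[measurable]: "V \<in> borel_measurable borel"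
    and V: "integrable lborel (\<lambda>y. of_real (1 + \<bar>y\<bar>) * V y)" and t0: "t0 > 0" and \<mu>: "\<mu> > 0"
  shows "((\<lambda>t. LBINT y. V y * of_real t powr (s0 - \<i> * of_real (\<mu> * y))) has_vector_derivative
      (LBINT y. V y * (s0 - \<i> * of_real (\<mu> * y)) * of_real t0 powr (s0 - 1 - \<i> * of_real (\<mu> * y)))) (at t0)"
proof (rule has_vector_derivative_complexI)
  define z where "z = (\<lambda>y. s0 - \<i> * of_real (\<mu> * y))"
  have zm1: "s0 - 1 - \<i> * of_real (\<mu> * y) = z y - 1" for y by (simp add: z_def)
  define v where "v = (\<lambda>y. (1 + \<bar>y\<bar>) * norm (V y))"
  have v: "integrable lborel v" 
  proof -
    have "norm (of_real (1 + \<bar>y\<bar>) * V y) = v y" for y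
      unfolding v_def norm_mult norm_of_real by simp
    thus ?thesis using integrable_norm[OF V] by (simp only:)
  qed
  have v0: "v y \<ge> 0" for y by (simp add: v_def)
  have Vv: "norm (V y) \<le> v y" for y unfolding v_def by (simp add: algebra_simps)
  have pm[measurable]: "(\<lambda>y. of_real t powr z y :: complex) \<in> borel_measurable borel" if "t > 0" for t
    unfolding z_def using powr_measurable_exponent[OF that] .
  have pm1: "(\<lambda>y. of_real t powr (z y - 1) :: complex) \<in> borel_measurable borel" if "t > 0" for t
    unfolding zm1[symmetric] using powr_measurable_exponent[OF that] .
  have zmeas[measurable]: "z \<in> borel_measurable borel" unfolding z_def by measurable
  have int: "integrable lborel (\<lambda>y. V y * of_real t powr z y)" if t: "t > 0" for t
  proof (rule Bochner_Integration.integrable_bound)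
    show "integrable lborel (\<lambda>y. t powr Re s0 * v y)" by (intro integrable_mult_right v)
    show "(\<lambda>y. V y * of_real t powr z y) \<in> borel_measurable lborel" using pm[OF t] by measurable
    show "AE y in lborel. norm (V y * of_real t powr z y) \<le> norm (t powr Re s0 * v y)"
      using Vv v0 t by (intro AE_I2) (simp add: norm_mult norm_of_real_powr z_def mult.commute mult_left_mono)
  qed
  obtain C where C: "C \<ge> 0" and Cb:
    "\<And>t \<zeta>. t \<in> {t0 / 2..2 * t0} \<Longrightarrow> Re \<zeta> = Re s0 \<Longrightarrow> norm (of_real t powr \<zeta> - of_real t0 powr \<zeta>) \<le> C * norm \<zeta> * \<bar>t - t0\<bar>"
    by (rule powr_difference_bound[OF t0, of s0]) (rule that)
  let ?q = "\<lambda>t. LBINT y. V y * of_real t powr z y"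
  have at: "at t0 = at t0 within {t0 / 2..2 * t0}" using t0 by (intro at_within_interior[symmetric]) simp
  have "((\<lambda>t. (?q t - ?q t0) / of_real (t - t0)) \<longlongrightarrow> (LBINT y. V y * z y * of_real t0 powr (z y - 1))) (at t0)"
    unfolding at tendsto_at_iff_sequentially
  proof (intro allI impI)
    fix X assume X: "\<forall>i. X i \<in> {t0 / 2..2 * t0} - {t0}" "X \<longlonglongrightarrow> t0"
    have Xp: "X i > 0" "X i \<noteq> t0" "X i \<in> {t0 / 2..2 * t0}" for i using X(1)[rule_format, of i] t0 by auto
    define k where "k = (\<lambda>i y. V y * ((of_real (X i) powr z y - of_real t0 powr z y) / of_real (X i - t0)))"
    have eq: "(?q (X i) - ?q t0) / of_real (X i - t0) = (LBINT y. k i y)" for i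
    proof -
      have "?q (X i) - ?q t0 = (LBINT y. V y * of_real (X i) powr z y - V y * of_real t0 powr z y)"
        by (intro Bochner_Integration.integral_diff[symmetric] int Xp t0)
      hence "(?q (X i) - ?q t0) / of_real (X i - t0) = (LBINT y. (V y * of_real (X i) powr z y - V y * of_real t0 powr z y) / of_real (X i - t0))"
        by (simp only: integral_divide_zero)
      thus ?thesis by (simp only: k_def right_diff_distrib times_divide_eq_right)
    qed
    have "(\<lambda>i. LBINT y. k i y) \<longlonglongrightarrow> (LBINT y. V y * z y * of_real t0 powr (z y - 1))"
    proof (rule integral_dominated_convergence[where w = "\<lambda>y. C * (norm s0 + \<mu>) * v y"])
      show "(\<lambda>y. V y * z y * of_real t0 powr (z y - 1)) \<in> borel_measurable lborel"
        using pm1[OF t0] by measurable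
      show "k i \<in> borel_measurable lborel" for i
        unfolding k_def using pm[OF t0] pm[OF Xp(1)[of i]] by measurable
      show "integrable lborel (\<lambda>y. C * (norm s0 + \<mu>) * v y)" by (intro integrable_mult_right v)
      show "AE y in lborel. (\<lambda>i. k i y) \<longlonglongrightarrow> V y * z y * of_real t0 powr (z y - 1)"
      proof (rule AE_I2)
        fix y
        have d: "((\<lambda>t. of_real t powr z y) has_vector_derivative z y * of_real t0 powr (z y - 1)) (at t0)"
          by (rule of_real_powr_has_vector_derivative[OF t0])
        have "((\<lambda>t. (of_real t powr z y - of_real t0 powr z y) / of_real (t - t0)) \<longlongrightarrow> z y * of_real t0 powr (z y - 1)) (at t0)"
          using d unfolding has_vector_derivative_complex_iff has_field_derivative_iff tendsto_complex_iff
          by (simp del: of_real_diff)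
        hence "((\<lambda>t. (of_real t powr z y - of_real t0 powr z y) / of_real (t - t0)) \<circ> X) \<longlonglongrightarrow> z y * of_real t0 powr (z y - 1)"
          unfolding tendsto_at_iff_sequentially using X Xp(2) by auto
        hence "(\<lambda>i. V y * ((of_real (X i) powr z y - of_real t0 powr z y) / of_real (X i - t0))) \<longlonglongrightarrow> V y * (z y * of_real t0 powr (z y - 1))"
          unfolding o_def by (rule tendsto_mult_left)
        thus "(\<lambda>i. k i y) \<longlonglongrightarrow> V y * z y * of_real t0 powr (z y - 1)" by (simp only: k_def mult.assoc)
      qed
      show "AE y in lborel. norm (k i y) \<le> C * (norm s0 + \<mu>) * v y" for i
      proof (rule AE_I2)
        fix y
        have nz: "norm (z y) \<le> (norm s0 + \<mu>) * (1 + \<bar>y\<bar>)"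
        proof -
          have "norm (z y) \<le> norm s0 + \<mu> * \<bar>y\<bar>"
            unfolding z_def using \<mu> by (intro order_trans[OF norm_triangle_ineq4]) (simp add: norm_mult abs_mult)
          also have "\<dots> \<le> (norm s0 + \<mu>) * (1 + \<bar>y\<bar>)" using \<mu> by (simp add: algebra_simps)
          finally show ?thesis .
        qed
        have pos: "\<bar>X i - t0\<bar> > 0" using Xp(2)[of i] by simp
        have "norm (of_real (X i) powr z y - of_real t0 powr z y) \<le> C * norm (z y) * \<bar>X i - t0\<bar>"
          by (intro Cb Xp) (simp add: z_def)
        hence "norm (of_real (X i) powr z y - of_real t0 powr z y) / \<bar>X i - t0\<bar> \<le> C * norm (z y)"
          using pos by (simp only: pos_divide_le_eq)
        also have "\<dots> \<le> C * ((norm s0 + \<mu>) * (1 + \<bar>y\<bar>))" using C by (intro mult_left_mono nz)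
        finally have "norm (V y) * (norm (of_real (X i) powr z y - of_real t0 powr z y) / \<bar>X i - t0\<bar>) \<le> norm (V y) * (C * ((norm s0 + \<mu>) * (1 + \<bar>y\<bar>)))"
          by (intro mult_left_mono) auto
        thus "norm (k i y) \<le> C * (norm s0 + \<mu>) * v y"
          unfolding k_def norm_mult norm_divide norm_of_real v_def by (simp only: mult_ac)
      qed
    qed
    thus "((\<lambda>t. (?q t - ?q t0) / of_real (t - t0)) \<circ> X) \<longlonglongrightarrow> (LBINT y. V y * z y * of_real t0 powr (z y - 1))"
      unfolding o_def eq .
  qed
  thus "((\<lambda>t. ((LBINT y. V y * of_real t powr (s0 - \<i> * of_real (\<mu> * y))) - (LBINT y. V y * of_real t0 powr (s0 - \<i> * of_real (\<mu> * y)))) / of_real (t - t0))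
     \<longlongrightarrow> (LBINT y. V y * (s0 - \<i> * of_real (\<mu> * y)) * of_real t0 powr (s0 - 1 - \<i> * of_real (\<mu> * y)))) (at t0)"
    unfolding zm1 unfolding z_def .
qed

text \<open>
  The falling factorial of \<open>\<rho> - 1 - \<i> \<mu> y\<close>, which is the factor produced by \<open>j\<close> differentiations of
  \<open>t powr (\<rho> - 1 - \<i> \<mu> y)\<close>.
\<close>

definition falling :: "complex \<Rightarrow> real \<Rightarrow> nat \<Rightarrow> real \<Rightarrow> complex" where
  "falling \<rho> \<mu> j y = (\<Prod>i<j. \<rho> - 1 - of_nat i - \<i> * of_real (\<mu> * y))"

lemma falling_bound:
  assumes \<mu>: "\<mu> > 0"
  obtains C where "C > 0" "\<And>y. norm (falling \<rho> \<mu> j y) \<le> C * (1 + \<bar>y\<bar>) ^ j"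
proof -
  define B where "B = norm \<rho> + 1 + real j + \<mu>"
  have B: "B > 0" using \<mu> by (simp add: B_def add_nonneg_pos)
  have "norm (falling \<rho> \<mu> j y) \<le> B ^ j * (1 + \<bar>y\<bar>) ^ j" for y
  proof -
    have "norm (falling \<rho> \<mu> j y) \<le> (\<Prod>i<j. B * (1 + \<bar>y\<bar>))"
      unfolding falling_def prod_norm[symmetric]
    proof (intro prod_mono conjI norm_ge_zero)
      fix i assume i: "i \<in> {..<j}"
      have "norm (\<rho> - 1 - of_nat i - \<i> * of_real (\<mu> * y)) \<le> norm (\<rho> - 1 - of_nat i) + norm (\<i> * of_real (\<mu> * y))" by (rule norm_triangle_ineq4)
      also have "\<dots> \<le> (norm (\<rho> - 1) + norm (of_nat i :: complex)) + norm (\<i> * of_real (\<mu> * y))" by (intro add_right_mono norm_triangle_ineq4)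
      also have "\<dots> \<le> ((norm \<rho> + norm (1::complex)) + norm (of_nat i :: complex)) + norm (\<i> * of_real (\<mu> * y))" by (intro add_right_mono norm_triangle_ineq4)
      also have "\<dots> \<le> (norm \<rho> + 1 + real j) + \<mu> * \<bar>y\<bar>" using i \<mu> by (simp add: norm_mult abs_mult)
      also have "\<dots> \<le> B * (1 + \<bar>y\<bar>)" using \<mu> unfolding B_def by (simp add: algebra_simps)
      finally show "norm (\<rho> - 1 - of_nat i - \<i> * of_real (\<mu> * y)) \<le> B * (1 + \<bar>y\<bar>)" .
    qed
    thus ?thesis by (simp add: power_mult_distrib)
  qed
  thus ?thesis using that[of "B ^ j"] B by simp
qed

lemma falling_Gamma:
  assumes "Re \<rho> > real j"
  shows "falling \<rho> \<mu> j y * Gamma (\<rho> - of_nat j - \<i> * of_real (\<mu> * y)) = Gamma (\<rho> - \<i> * of_real (\<mu> * y))"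
  using assms
proof (induction j)
  case (Suc j)
  define s where "s = \<rho> - of_nat (Suc j) - \<i> * of_real (\<mu> * y)"
  have "s \<notin> \<int>\<^sub>\<le>\<^sub>0" by (rule Re_pos_not_nonpos_Int) (use Suc.prems in \<open>simp add: s_def\<close>)
  hence "Gamma (s + 1) = s * Gamma s" by (rule Gamma_plus1)
  moreover have "s + 1 = \<rho> - of_nat j - \<i> * of_real (\<mu> * y)" by (simp add: s_def)
  moreover have "falling \<rho> \<mu> (Suc j) y = falling \<rho> \<mu> j y * s" by (simp add: falling_def s_def algebra_simps)
  moreover have "falling \<rho> \<mu> j y * Gamma (\<rho> - of_nat j - \<i> * of_real (\<mu> * y)) = Gamma (\<rho> - \<i> * of_real (\<mu> * y))"
    by (rule Suc.IH) (use Suc.prems in simp)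
  ultimately show ?case unfolding s_def[symmetric] by (simp only: mult.assoc)
qed (simp add: falling_def)

lemma falling_measurable[measurable]: "falling \<rho> \<mu> j \<in> borel_measurable borel"
  unfolding falling_def[abs_def] by measurable

lemma falling_weight_integrable:
  fixes H :: "real \<Rightarrow> complex"
  assumes Hm[measurable]: "H \<in> borel_measurable borel" and \<mu>: "\<mu> > 0"
    and H: "integrable lborel (\<lambda>y. of_real ((1 + \<bar>y\<bar>) powr s) * H y)" and le: "real j + d \<le> s"
  shows "integrable lborel (\<lambda>y. of_real ((1 + \<bar>y\<bar>) powr d) * (H y * falling \<rho> \<mu> j y))"
proof -
  obtain C where C: "C > 0" "\<And>y. norm (falling \<rho> \<mu> j y) \<le> C * (1 + \<bar>y\<bar>) ^ j" using falling_bound[OF \<mu>] by blast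
  show ?thesis
  proof (rule Bochner_Integration.integrable_bound)
    show "integrable lborel (\<lambda>y. of_real C * (of_real ((1 + \<bar>y\<bar>) powr s) * H y))" by (intro integrable_mult_right H)
    show "AE y in lborel. norm (of_real ((1 + \<bar>y\<bar>) powr d) * (H y * falling \<rho> \<mu> j y)) \<le> norm (of_real C * (of_real ((1 + \<bar>y\<bar>) powr s) * H y))"
    proof (rule AE_I2)
      fix y :: real
      have "(1 + \<bar>y\<bar>) powr d * (1 + \<bar>y\<bar>) ^ j = (1 + \<bar>y\<bar>) powr (d + j)" by (simp add: powr_add powr_realpow)
      also have "\<dots> \<le> (1 + \<bar>y\<bar>) powr s" using le by (intro powr_mono) auto
      finally have p: "(1 + \<bar>y\<bar>) powr d * (1 + \<bar>y\<bar>) ^ j \<le> (1 + \<bar>y\<bar>) powr s" .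
      have "norm (of_real ((1 + \<bar>y\<bar>) powr d) * (H y * falling \<rho> \<mu> j y)) = (1 + \<bar>y\<bar>) powr d * (norm (H y) * norm (falling \<rho> \<mu> j y))"
        by (simp add: norm_mult)
      also have "\<dots> \<le> (1 + \<bar>y\<bar>) powr d * (norm (H y) * (C * (1 + \<bar>y\<bar>) ^ j))" by (intro mult_left_mono C) auto
      also have "\<dots> = C * norm (H y) * ((1 + \<bar>y\<bar>) powr d * (1 + \<bar>y\<bar>) ^ j)" by (simp only: mult_ac)
      also have "\<dots> \<le> C * norm (H y) * (1 + \<bar>y\<bar>) powr s" using C(1) by (intro mult_left_mono p) auto
      finally show "norm (of_real ((1 + \<bar>y\<bar>) powr d) * (H y * falling \<rho> \<mu> j y)) \<le> norm (of_real C * (of_real ((1 + \<bar>y\<bar>) powr s) * H y))"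
        using C(1) by (simp add: norm_mult mult_ac)
    qed
  qed measurable
qed

lemma nth_deriv_Suc: "nth_deriv (Suc k) f t = vector_derivative (nth_deriv k f) (at t)"
  by (simp add: nth_deriv_def)

text \<open>
  The derivatives are known only for \<open>t > 0\<close>; since this set is open, that determines the next derivative
  on it.
\<close>

lemma nth_deriv_power_integral:
  fixes H :: "real \<Rightarrow> complex"
  assumes Hm[measurable]: "H \<in> borel_measurable borel" and \<mu>: "\<mu> > 0"
    and f: "\<And>t. t > 0 \<Longrightarrow> f t = (LBINT y. H y * of_real t powr (\<rho> - 1 - \<i> * of_real (\<mu> * y)))"
    and H: "integrable lborel (\<lambda>y. of_real ((1 + \<bar>y\<bar>) powr s) * H y)" and j: "real j \<le> s"
  shows "(\<forall>t>0. nth_deriv j f t = (LBINT y. H y * falling \<rho> \<mu> j y * of_real t powr (\<rho> - 1 - of_nat j - \<i> * of_real (\<mu> * y)))) \<and>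
     (\<forall>k<j. \<forall>t>0. nth_deriv k f differentiable (at t))"
  using j
proof (induction j)
  case 0
  thus ?case using f by (simp add: nth_deriv_def falling_def)
next
  case (Suc j)
  let ?s0 = "\<rho> - 1 - of_nat j"
  have IH: "nth_deriv j f t = (LBINT y. (H y * falling \<rho> \<mu> j y) * of_real t powr (?s0 - \<i> * of_real (\<mu> * y)))" if "t > 0" for t
    using Suc that by simp
  have "integrable lborel (\<lambda>y. of_real ((1 + \<bar>y\<bar>) powr 1) * (H y * falling \<rho> \<mu> j y))"
    by (rule falling_weight_integrable[OF Hm \<mu> H]) (use Suc.prems in simp)
  hence V: "integrable lborel (\<lambda>y. of_real (1 + \<bar>y\<bar>) * (H y * falling \<rho> \<mu> j y))" by (simp del: of_real_add)
  have D: "(nth_deriv j f has_vector_derivative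
      (LBINT y. (H y * falling \<rho> \<mu> j y) * (?s0 - \<i> * of_real (\<mu> * y)) * of_real t powr (?s0 - 1 - \<i> * of_real (\<mu> * y)))) (at t)" if t: "t > 0" for t
  proof -
    have "((\<lambda>t. LBINT y. (H y * falling \<rho> \<mu> j y) * of_real t powr (?s0 - \<i> * of_real (\<mu> * y))) has_vector_derivative
      (LBINT y. (H y * falling \<rho> \<mu> j y) * (?s0 - \<i> * of_real (\<mu> * y)) * of_real t powr (?s0 - 1 - \<i> * of_real (\<mu> * y)))) (at t)"
      by (rule power_integral_has_vector_derivative[OF _ V t \<mu>]) measurable
    thus ?thesis
      by (rule has_vector_derivative_transform_within_open[where S = "{0<..}"]) (use t IH in auto)
  qed
  have "nth_deriv (Suc j) f t = (LBINT y. H y * falling \<rho> \<mu> (Suc j) y * of_real t powr (\<rho> - 1 - of_nat (Suc j) - \<i> * of_real (\<mu> * y)))" if t: "t > 0" for t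
  proof -
    have e: "?s0 - 1 - \<i> * of_real (\<mu> * y) = \<rho> - 1 - of_nat (Suc j) - \<i> * of_real (\<mu> * y)" for y by simp
    have fs: "(H y * falling \<rho> \<mu> j y) * (?s0 - \<i> * of_real (\<mu> * y)) = H y * falling \<rho> \<mu> (Suc j) y" for y
      by (simp add: falling_def mult.assoc)
    show ?thesis unfolding nth_deriv_Suc using vector_derivative_at[OF D[OF t]] unfolding e fs .
  qed
  moreover have "nth_deriv k f differentiable (at t)" if "k < Suc j" "t > 0" for k t
  proof (cases "k = j")
    case True
    thus ?thesis using D[OF that(2)] differentiableI_vector by blast
  next
    case False
    thus ?thesis using Suc that by simp
  qed
  ultimately show ?case by blast
qed

lemma I_fun_power:
  assumes a: "a \<noteq> 0" and t: "t > 0"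
  shows "of_real t powr (\<rho> - 1) * I_fun G m n up lo (a * of_real (t powr \<mu>)) \<theta> =
    (LBINT y. (axis_weight G m n up lo a \<theta> y / of_real (2 * pi)) * of_real t powr (\<rho> - 1 - \<i> * of_real (\<mu> * y)))"
proof -
  have ln: "ln (cmod (a * of_real (t powr \<mu>))) = ln (cmod a) + \<mu> * ln t"
    using a t by (simp add: norm_mult ln_mult ln_powr)
  have e: "of_real t powr (\<rho> - 1) * (1 / (2 * of_real pi * \<i>) * (I_chi G m n up lo (\<i> * of_real y) *
       exp (- (\<i> * of_real y) * (of_real (ln (cmod (a * of_real (t powr \<mu>)))) + \<i> * of_real \<theta>)) * \<i>))
     = (axis_weight G m n up lo a \<theta> y / of_real (2 * pi)) * of_real t powr (\<rho> - 1 - \<i> * of_real (\<mu> * y))" for y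
  proof -
    have "exp (- (\<i> * of_real y) * (of_real (ln (cmod (a * of_real (t powr \<mu>)))) + \<i> * of_real \<theta>))
      = exp (- (\<i> * of_real y) * (of_real (ln (cmod a)) + \<i> * of_real \<theta>)) * exp (- (\<i> * of_real (\<mu> * y)) * of_real (ln t))"
      unfolding ln exp_add[symmetric] by (simp add: algebra_simps)
    moreover have "of_real t powr (\<rho> - 1 - \<i> * of_real (\<mu> * y)) = of_real t powr (\<rho> - 1) * exp (- (\<i> * of_real (\<mu> * y)) * of_real (ln t))"
    proof -
      have "Ln (of_real t) = of_real (ln t)" using t by (subst Ln_of_real) auto
      thus ?thesis using t by (simp add: powr_def algebra_simps flip: exp_add)
    qed
    ultimately show ?thesis by (simp add: axis_weight_def)
  qed
  show ?thesis unfolding I_fun_def integral_mult_right_zero[symmetric] e ..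
qed

section \<open>The Caputo-type derivative of the I-function\<close>

text \<open>
  For \<open>\<kappa> = 1\<close> the branch is immaterial and \<open>G\<close> is the Gamma function itself, including the value 0 at
  the poles, so the new factors of the denominator are values of the reciprocal Gamma function.
\<close>

lemma I_chi_extend:
  assumes branch: "Gamma_power_branch G" and m: "m \<le> length lo" and s: "Re s = 0"
  shows "I_chi G m (n + 3) ([(u1, \<mu>, 1), (u2, \<mu>, 1), (u3, \<mu>, 1)] @ up) (lo @ [(l1, \<mu>, 1), (l2, \<mu>, 1), (l3, \<mu>, 1)]) s =
    I_chi G m n up lo s *
      (Gamma (1 - u1 - of_real \<mu> * s) * Gamma (1 - u2 - of_real \<mu> * s) * Gamma (1 - u3 - of_real \<mu> * s)) *
      (rGamma (1 - l1 - of_real \<mu> * s) * rGamma (1 - l2 - of_real \<mu> * s) * rGamma (1 - l3 - of_real \<mu> * s))"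
proof -
  have G: "G (1 - c, - \<mu>, 1) s = Gamma (1 - c - of_real \<mu> * s)" for c
    using branch_one[OF branch s, of "1 - c" "- \<mu>"] by simp
  have t: "take (n + 3) ([(u1, \<mu>, 1), (u2, \<mu>, 1), (u3, \<mu>, 1)] @ up) = [(u1, \<mu>, 1), (u2, \<mu>, 1), (u3, \<mu>, 1)] @ take n up"
    "drop (n + 3) ([(u1, \<mu>, 1), (u2, \<mu>, 1), (u3, \<mu>, 1)] @ up) = drop n up"
    by (simp_all add: numeral_3_eq_3)
  show ?thesis
    using m unfolding I_chi_def t by (simp add: G rGamma_inverse_Gamma field_simps)
qed

lemma I_Delta_extend:
  assumes m: "m \<le> length lo"
  shows "I_Delta m (n + 3) ([(u1, \<mu>, 1), (u2, \<mu>, 1), (u3, \<mu>, 1)] @ up) (lo @ [(l1, \<mu>, 1), (l2, \<mu>, 1), (l3, \<mu>, 1)]) = I_Delta m n up lo"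
proof -
  have t: "take (n + 3) ([(u1, \<mu>, 1), (u2, \<mu>, 1), (u3, \<mu>, 1)] @ up) = [(u1, \<mu>, 1), (u2, \<mu>, 1), (u3, \<mu>, 1)] @ take n up"
    "drop (n + 3) ([(u1, \<mu>, 1), (u2, \<mu>, 1), (u3, \<mu>, 1)] @ up) = drop n up" for u1 u2 u3 :: complex and \<mu> :: real
    by (simp_all add: numeral_3_eq_3)
  show ?thesis using m unfolding I_Delta_def t by simp
qed

lemma I_Omega_extend:
  "I_Omega ([(u1, \<mu>, 1), (u2, \<mu>, 1), (u3, \<mu>, 1)] @ up) (lo @ [(l1, \<mu>, 1), (l2, \<mu>, 1), (l3, \<mu>, 1)])
     = I_Omega up lo + Re (l1 + l2 + l3 - u1 - u2 - u3)"
  by (simp add: I_Omega_def)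

lemma has_integral_scale_unit:
  fixes f :: "real \<Rightarrow> complex"
  assumes "(g has_integral I) {0<..<1}" and x: "x > 0" and eq: "\<And>u. 0 < u \<Longrightarrow> u < 1 \<Longrightarrow> f (x * u) = g u"
  shows "(f has_integral (of_real x * I)) {0<..<x}"
proof -
  have "((\<lambda>u. f (x * u)) has_integral I) {0<..<1}"
    by (rule has_integral_eq[rotated, OF assms(1)]) (use eq in auto)
  hence "((\<lambda>u. f (x * u)) has_integral I) (cbox 0 1)" by (simp add: has_integral_Icc_iff_Ioo)
  from has_integral_affinity'[OF this, of "1 / x" 0] x
  have "(f has_integral (x *\<^sub>R I)) {0..x}" by simp
  thus ?thesis by (simp add: has_integral_Icc_iff_Ioo scaleR_conv_of_real)
qed

theorem theorem5p1:
  fixes \<alpha> \<alpha>' \<beta> \<beta>' \<gamma> \<rho> a :: complex and \<mu> \<theta> x :: real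
    and m n N :: nat and up lo :: "triple list"
    and G :: "triple \<Rightarrow> complex \<Rightarrow> complex"
    and f :: "real \<Rightarrow> complex" and U L :: "triple list"
  defines "N \<equiv> caputo_order \<gamma>"
    and "f \<equiv> \<lambda>t. of_real t powr (\<rho> - 1) * I_fun G m n up lo (a * of_real (t powr \<mu>)) \<theta>"
    and "U \<equiv> [(1 - \<rho>, \<mu>, 1),
              (1 - \<alpha> + \<beta> - \<rho> + of_nat N, \<mu>, 1),
              (1 - \<alpha> - \<alpha>' - \<beta>' + \<gamma> - \<rho> + of_nat N, \<mu>, 1)] @ up"
    and "L \<equiv> lo @ [(1 + \<beta> - \<rho> + of_nat N, \<mu>, 1),
              (1 - \<alpha> - \<alpha>' + \<gamma> - \<rho>, \<mu>, 1),
              (1 - \<alpha> - \<beta>' + \<gamma> - \<rho> + of_nat N, \<mu>, 1)]"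
  assumes branch: "Gamma_power_branch G"
    and params: "I_params m n up lo" and sep: "I_separated m n up lo"
    and a: "a \<noteq> 0" and arg: "is_Arg a \<theta>"
    and conv: "I_conv m n up lo \<theta>" and conv': "I_conv m (n + 3) U L \<theta>"
    and gamma: "Re \<gamma> > 0" and mu: "\<mu> > 0"
    and rho: "Re \<rho> - real N > Max {0, Re (- \<alpha> + \<beta>), Re (- \<alpha> - \<alpha>' - \<beta>' + \<gamma>)}"
    and diff: "I_conv_interior m n up lo \<theta> \<or> times_differentiable_pos N f"
    and x: "x > 0"
  shows "caputo_MSM_exists \<alpha> \<alpha>' \<beta> \<beta>' \<gamma> f x \<and>
         caputo_MSM \<alpha> \<alpha>' \<beta> \<beta>' \<gamma> f x =
           of_real x powr (\<alpha> + \<alpha>' - \<gamma> + \<rho> - 1) *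
           I_fun G m (n + 3) U L (a * of_real (x powr \<mu>)) \<theta>"
proof -
  have m: "m \<le> length lo" using params by (simp add: I_params_def)
  define A A' B B' g where "A = - \<alpha>'" and "A' = - \<alpha>" and "B = - \<beta>' + of_nat N" and "B' = - \<beta>" and "g = - \<gamma> + of_nat N"
  note ops = A_def A'_def B_def B'_def g_def
  define r0 where "r0 = \<rho> - of_nat N"
  obtain k where k: "N = Suc k" by (simp add: N_def caputo_order_def)
  have Nk: "real k \<le> Re \<gamma>" "Re \<gamma> < real N"
  proof -
    have "k = nat \<lfloor>Re \<gamma>\<rfloor>" using k by (simp add: N_def caputo_order_def)
    moreover have "0 \<le> \<lfloor>Re \<gamma>\<rfloor>" using gamma by simp
    ultimately have "real k = of_int \<lfloor>Re \<gamma>\<rfloor>" by simp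
    thus "real k \<le> Re \<gamma>" "Re \<gamma> < real N" unfolding k by linarith+
  qed
  have g: "Re g > 0" "Re g \<le> 1" using Nk by (auto simp: g_def k)
  have gn: "Gamma g \<noteq> 0" using Re_pos_not_nonpos_Int[OF g(1)] by (simp add: Gamma_eq_zero_iff)
  \<comment> \<open>\<open>R\<close> bounds the real parts of the poles of the Mellin transform of the kernel; the midpoint \<open>r\<close> lies
      strictly to the right of them and to the left of \<open>Re (\<rho> - N)\<close>.\<close>
  define R where "R = Max {0, Re (- \<alpha> + \<beta>), Re (- \<alpha> - \<alpha>' - \<beta>' + \<gamma>)}"
  define r where "r = (R + Re r0) / 2"
  have mx: "R \<ge> 0" "R \<ge> Re (- \<alpha> + \<beta>)" "R \<ge> Re (- \<alpha> - \<alpha>' - \<beta>' + \<gamma>)"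
    unfolding R_def by (intro Max_ge; simp)+
  have Rer0: "Re r0 = Re \<rho> - real N" by (simp add: r0_def)
  have r: "r > 0" "r > Re (A' - B')" "r > Re (A + A' + B - g)" "Re r0 > r"
  proof -
    have e: "Re (A' - B') = Re (- \<alpha> + \<beta>)" "Re (A + A' + B - g) = Re (- \<alpha> - \<alpha>' - \<beta>' + \<gamma>)" by (simp_all add: ops)
    have mid: "p < (q + w) / 2 \<and> (q + w) / 2 < w" if "p \<le> q" "q < w" for p q w :: real
      using that by (simp add: field_simps)
    note b = rho[folded R_def Rer0]
    show "r > 0" "Re r0 > r" using mid[OF mx(1) b] unfolding r_def by blast+
    show "r > Re (A' - B')" using mid[OF mx(2) b] unfolding e r_def by blast
    show "r > Re (A + A' + B - g)" using mid[OF mx(3) b] unfolding e r_def by blast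
  qed
  have Re\<rho>: "Re \<rho> > real N" using r(1,4) Rer0 by linarith
  define H where "H = (\<lambda>y. axis_weight G m n up lo a \<theta> y / of_real (2 * pi))"
  have Hm[measurable]: "H \<in> borel_measurable borel"
    unfolding H_def using axis_weight_measurable[OF branch] by measurable
  have Delta: "I_Delta m (n + 3) U L = I_Delta m n up lo" unfolding U_def L_def by (rule I_Delta_extend[OF m])
  have Omega: "I_Omega U L = I_Omega up lo + Re \<gamma>" unfolding U_def L_def I_Omega_extend by simp
  have weight: "integrable lborel (\<lambda>y. of_real ((1 + \<bar>y\<bar>) powr s) * H y)"
    if "I_conv_interior m n up lo \<theta> \<or> \<bar>\<theta>\<bar> = pi / 2 * I_Delta m n up lo \<and> I_Omega up lo + s < -1" for s
  proof -
    have "integrable lborel (\<lambda>y. (of_real ((1 + \<bar>y\<bar>) powr s) * axis_weight G m n up lo a \<theta> y) / of_real (2 * pi))"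
      by (intro integrable_divide axis_weight_integrable branch params sep that)
    thus ?thesis by (simp add: H_def)
  qed
  obtain \<epsilon> where \<epsilon>: "0 < \<epsilon>" "\<epsilon> \<le> Re g" and H\<epsilon>: "integrable lborel (\<lambda>y. of_real ((1 + \<bar>y\<bar>) powr (Re \<gamma> + \<epsilon>)) * H y)"
  proof (cases "I_conv_interior m n up lo \<theta>")
    case True
    thus ?thesis using that[of "Re g"] g weight[of "Re \<gamma> + Re g"] by auto
  next
    case False
    hence b: "\<bar>\<theta>\<bar> = pi / 2 * I_Delta m n up lo" "I_Omega up lo + Re \<gamma> < -1"
      using conv' unfolding I_conv_def I_conv_interior_def I_conv_boundary_def Delta Omega by (auto simp: Let_def)
    \<comment> \<open>Half of the gap in the strict convergence condition; the minimum with \<open>Re g\<close> keeps \<open>\<delta> \<le> 1\<close>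
        below.\<close>
    define \<epsilon> where "\<epsilon> = min (Re g) ((-1 - (I_Omega up lo + Re \<gamma>)) / 2)"
    have "0 < \<epsilon>" "\<epsilon> \<le> Re g" "I_Omega up lo + (Re \<gamma> + \<epsilon>) < -1"
      using g b(2) unfolding \<epsilon>_def min_def by (auto simp: field_simps split: if_splits)
    thus ?thesis using b(1) by (intro that[of \<epsilon>] weight) auto
  qed
  \<comment> \<open>As \<open>Re g = k + 1 - Re \<gamma>\<close>, this is \<open>1 - Re g + \<epsilon>\<close>; it is what the weight has left after \<open>k = N - 1\<close>
      differentiations.\<close>
  define \<delta> where "\<delta> = Re \<gamma> + \<epsilon> - real k"
  have \<delta>: "0 < \<delta>" "\<delta> \<le> 1" "\<delta> + Re g - 1 > 0"
    using Nk \<epsilon> by (auto simp: \<delta>_def g_def k)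
  have f: "f t = (LBINT y. H y * of_real t powr (\<rho> - 1 - \<i> * of_real (\<mu> * y)))" if "t > 0" for t
    unfolding f_def H_def by (rule I_fun_power[OF a that])
  have fk: "nth_deriv k f t = (LBINT y. H y * falling \<rho> \<mu> k y * of_real t powr (\<rho> - 1 - of_nat k - \<i> * of_real (\<mu> * y)))" if "t > 0" for t
    using nth_deriv_power_integral[OF Hm mu f H\<epsilon>, of k] Nk \<epsilon> that by auto
  have tdiff: "times_differentiable_pos N f"
  proof (cases "I_conv_interior m n up lo \<theta>")
    case True
    from nth_deriv_power_integral[OF Hm mu f weight[of "real N"], of N] True
    show ?thesis by (auto simp: times_differentiable_pos_def)
  qed (use diff in simp)
  have fN: "(nth_deriv k f has_vector_derivative nth_deriv N f t) (at t)" if "t > 0" for t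
  proof -
    have "nth_deriv k f differentiable (at t)" using tdiff that k by (auto simp: times_differentiable_pos_def)
    thus ?thesis unfolding k nth_deriv_Suc by (simp add: vector_derivative_works)
  qed
  obtain e c where
    ker: "\<And>u. 0 < u \<Longrightarrow> u < 1 \<Longrightarrow> ser_kernel 0 g (f3_coeff A A' B B' g) u = ser_kernel e g c u"
    and t: "tempered c (r + Re e)"
    and M: "\<And>\<rho>. Re \<rho> > r \<Longrightarrow> (LBINT u:{0<..<1}. ser_kernel e g c u * of_real u powr (\<rho> - 1)) =
       Gamma g * (Gamma \<rho> * Gamma (\<rho> + B' - A') * Gamma (\<rho> + g - A - A' - B)) *
         (rGamma (\<rho> + B') * rGamma (\<rho> + g - A - A') * rGamma (\<rho> + g - A' - B))"
    by (rule f3_kernel_representation[OF g(1) r(1-3)]) (rule that)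
  define z where "z = (\<lambda>y. r0 - \<i> * of_real (\<mu> * y))"
  define W where "W = (\<lambda>y. H y * falling \<rho> \<mu> k y * of_real x powr z y)"
  define F where "F = (\<lambda>u. nth_deriv k f (x * u))"
  define \<phi> where "\<phi> = (\<lambda>u. of_real x * nth_deriv N f (x * u))"
  have Wm[measurable]: "W \<in> borel_measurable borel"
    unfolding W_def z_def using powr_measurable_exponent[OF x] by measurable
  have W: "integrable lborel (\<lambda>y. of_real ((1 + \<bar>y\<bar>) powr \<delta>) * W y)"
  proof (rule Bochner_Integration.integrable_bound)
    show "integrable lborel (\<lambda>y. of_real (x powr Re r0) * (of_real ((1 + \<bar>y\<bar>) powr \<delta>) * (H y * falling \<rho> \<mu> k y)))"
      by (intro integrable_mult_right falling_weight_integrable[OF Hm mu H\<epsilon>]) (simp add: \<delta>_def)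
    show "AE y in lborel. norm (of_real ((1 + \<bar>y\<bar>) powr \<delta>) * W y) \<le>
       norm (of_real (x powr Re r0) * (of_real ((1 + \<bar>y\<bar>) powr \<delta>) * (H y * falling \<rho> \<mu> k y)))"
      using x by (intro AE_I2) (simp add: W_def norm_mult norm_of_real_powr z_def mult_ac)
  qed measurable
  have FW: "F u = (LBINT y. W y * of_real u powr (r0 - \<i> * of_real (\<mu> * y)))" if u: "0 < u" "u < 1" for u
  proof -
    have "of_real (x * u) powr (\<rho> - 1 - of_nat k - \<i> * of_real (\<mu> * y)) = of_real x powr z y * of_real u powr z y" for y
    proof -
      have "\<rho> - 1 - of_nat k - \<i> * of_real (\<mu> * y) = z y" by (simp add: z_def r0_def k)
      thus ?thesis using u x by (simp only: of_real_mult) (rule powr_times_real; simp)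
    qed
    thus ?thesis using u x by (simp add: F_def fk W_def z_def mult.assoc)
  qed
  have F\<phi>: "(F has_vector_derivative \<phi> u) (at u)" if u: "0 < u" "u < 1" for u
  proof -
    have "((\<lambda>u. x * u) has_vector_derivative x) (at u)" by (auto intro!: derivative_eq_intros)
    moreover have "(nth_deriv k f has_vector_derivative nth_deriv N f (x * u)) (at (x * u))" by (rule fN) (use u x in simp)
    ultimately have "(nth_deriv k f \<circ> (\<lambda>u. x * u) has_vector_derivative x *\<^sub>R nth_deriv N f (x * u)) (at u)"
      by (rule vector_diff_chain_at)
    thus ?thesis by (simp add: F_def \<phi>_def o_def scaleR_conv_of_real)
  qed
  define I where "I = (LBINT y. W y * ((r0 - \<i> * of_real (\<mu> * y)) *
       (LBINT u:{0<..<1}. ser_kernel e g c u * of_real u powr ((r0 - \<i> * of_real (\<mu> * y)) - 1))))"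
  have main: "((\<lambda>u. ser_kernel e g c u * \<phi> u) has_integral I) {0<..<1}"
    unfolding I_def by (rule kernel_integral_of_derivative[OF t g(1) r(4) mu \<delta> Wm W FW F\<phi>])
  \<comment> \<open>Substituting \<open>t = x u\<close>; the power of \<open>x\<close> collects the homogeneity of the kernel, and one factor \<open>x\<close>
      is absorbed by the chain rule in \<open>\<phi>\<close>.\<close>
  define X where "X = of_real x powr (g - 2 - A')"
  have int: "(MSM_integrand A A' B B' g (nth_deriv N f) x has_integral (of_real x * (X * I))) {0<..<x}"
  proof (rule has_integral_scale_unit[OF _ x])
    show "((\<lambda>u. X * (ser_kernel e g c u * \<phi> u)) has_integral (X * I)) {0<..<1}"
      by (intro has_integral_mult_right main)
    fix u :: real assume u: "0 < u" "u < 1"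
    have 1: "of_real (x - x * u) powr (g - 1) = of_real x powr (g - 1) * (of_real (1 - u) powr (g - 1) :: complex)"
    proof -
      have "x - x * u = x * (1 - u)" by (simp add: algebra_simps)
      thus ?thesis using u x by (simp only: of_real_mult) (rule powr_times_real; simp)
    qed
    have 2: "of_real (x * u) powr (- A') = of_real x powr (- A') * (of_real u powr (- A') :: complex)"
      using u x by (simp only: of_real_mult) (rule powr_times_real; simp)
    have 3: "1 - (x * u) / x = 1 - u" "1 - x / (x * u) = 1 - 1 / u" using x u by auto
    have 4: "of_real x powr (g - 1) * of_real x powr (- A') = X * of_real x"
    proof -
      have "X * of_real x = of_real x powr (g - 2 - A') * of_real x powr 1" using x by (simp add: X_def)
      thus ?thesis unfolding powr_add[symmetric] by (simp add: algebra_simps)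
    qed
    have "MSM_integrand A A' B B' g (nth_deriv N f) x (x * u) =
       (of_real x powr (g - 1) * of_real x powr (- A')) *
       (of_real (1 - u) powr (g - 1) * of_real u powr (- A') * appell_F3 A A' B B' g (of_real (1 - u)) (of_real (1 - 1 / u))) * nth_deriv N f (x * u)"
      unfolding MSM_integrand_def 1 2 3 by (simp only: mult_ac)
    also have "\<dots> = (X * of_real x) * ser_kernel e g c u * nth_deriv N f (x * u)"
      unfolding 4 f3_kernel_eq_appell[OF g(1) u] ker[OF u] ..
    finally show "MSM_integrand A A' B B' g (nth_deriv N f) x (x * u) = X * (ser_kernel e g c u * \<phi> u)"
      by (simp add: \<phi>_def mult_ac)
  qed
  have ex: "caputo_MSM_exists \<alpha> \<alpha>' \<beta> \<beta>' \<gamma> f x"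
    unfolding caputo_MSM_exists_def Let_def N_def[symmetric] ops[symmetric]
    using tdiff int by (auto simp: integrable_on_def)
  have "caputo_MSM \<alpha> \<alpha>' \<beta> \<beta>' \<gamma> f x = of_real x powr (- A) / Gamma g * (of_real x * (X * I))"
    unfolding caputo_MSM_def MSM_integral_def Let_def N_def[symmetric] ops[symmetric]
    using int by (simp add: integral_unique)
  also have "\<dots> = of_real x powr (- A) * of_real x * X * (I / Gamma g)" by simp
  also have "I / Gamma g = (LBINT y. (axis_weight G m (n + 3) U L a \<theta> y / of_real (2 * pi)) * of_real x powr z y)"
  proof -
    have pt: "W y * ((r0 - \<i> * of_real (\<mu> * y)) *
       (LBINT u:{0<..<1}. ser_kernel e g c u * of_real u powr ((r0 - \<i> * of_real (\<mu> * y)) - 1))) / Gamma g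
        = (axis_weight G m (n + 3) U L a \<theta> y / of_real (2 * pi)) * of_real x powr z y" for y
    proof -
      let ?s = "\<i> * of_real y"
      have Rez: "Re (z y) > r" using r(4) by (simp add: z_def)
      have fallN: "falling \<rho> \<mu> k y * z y * Gamma (z y) = Gamma (\<rho> - \<i> * of_real (\<mu> * y))"
      proof -
        have "falling \<rho> \<mu> N y = falling \<rho> \<mu> k y * z y" by (simp add: falling_def k z_def r0_def)
        moreover have "z y = \<rho> - of_nat N - \<i> * of_real (\<mu> * y)" by (simp add: z_def r0_def)
        ultimately show ?thesis using falling_Gamma[OF Re\<rho>, of \<mu> y] by simp
      qed
      define Q where "Q = (Gamma (z y + B' - A') * Gamma (z y + g - A - A' - B)) * (rGamma (z y + B') * rGamma (z y + g - A - A') * rGamma (z y + g - A' - B))"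
      have chi: "I_chi G m (n + 3) U L ?s = I_chi G m n up lo ?s * (Gamma (\<rho> - \<i> * of_real (\<mu> * y)) * Q)"
      proof -
        have e: "1 - (1 - \<rho>) - of_real \<mu> * ?s = \<rho> - \<i> * of_real (\<mu> * y)"
          "1 - (1 - \<alpha> + \<beta> - \<rho> + of_nat N) - of_real \<mu> * ?s = z y + B' - A'"
          "1 - (1 - \<alpha> - \<alpha>' - \<beta>' + \<gamma> - \<rho> + of_nat N) - of_real \<mu> * ?s = z y + g - A - A' - B"
          "1 - (1 + \<beta> - \<rho> + of_nat N) - of_real \<mu> * ?s = z y + B'"
          "1 - (1 - \<alpha> - \<alpha>' + \<gamma> - \<rho>) - of_real \<mu> * ?s = z y + g - A - A'"
          "1 - (1 - \<alpha> - \<beta>' + \<gamma> - \<rho> + of_nat N) - of_real \<mu> * ?s = z y + g - A' - B"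
          by (simp_all add: z_def r0_def ops algebra_simps)
        have s0: "Re ?s = 0" by simp
        show ?thesis unfolding U_def L_def I_chi_extend[OF branch m s0] e Q_def by (simp only: mult_ac)
      qed
      have "W y * (z y * (LBINT u:{0<..<1}. ser_kernel e g c u * of_real u powr (z y - 1))) / Gamma g
         = H y * (falling \<rho> \<mu> k y * z y * Gamma (z y)) * Q * of_real x powr z y"
        unfolding M[OF Rez] W_def Q_def using gn by simp
      also have "\<dots> = H y * (Gamma (\<rho> - \<i> * of_real (\<mu> * y)) * Q) * of_real x powr z y"
        unfolding fallN by (simp only: mult.assoc)
      also have "H y * (Gamma (\<rho> - \<i> * of_real (\<mu> * y)) * Q) = axis_weight G m (n + 3) U L a \<theta> y / of_real (2 * pi)"
        unfolding H_def axis_weight_def chi by (simp add: mult_ac)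
      finally show ?thesis unfolding z_def .
    qed
    show ?thesis unfolding I_def integral_divide_zero[symmetric] pt ..
  qed
  also have "of_real x powr (- A) * of_real x * X * (LBINT y. (axis_weight G m (n + 3) U L a \<theta> y / of_real (2 * pi)) * of_real x powr z y)
     = of_real x powr (\<alpha> + \<alpha>' - \<gamma> + \<rho> - 1) * I_fun G m (n + 3) U L (a * of_real (x powr \<mu>)) \<theta>"
  proof -
    let ?p = "\<alpha> + \<alpha>' - \<gamma> + \<rho> - 1"
    have "of_real x powr (- A) * of_real x * X * ((axis_weight G m (n + 3) U L a \<theta> y / of_real (2 * pi)) * of_real x powr z y)
       = (axis_weight G m (n + 3) U L a \<theta> y / of_real (2 * pi)) * of_real x powr ((?p + 1) - 1 - \<i> * of_real (\<mu> * y))" for y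
    proof -
      have "of_real x powr (- A) * of_real x * X * of_real x powr z y = of_real x powr (- A) * of_real x powr 1 * X * of_real x powr z y"
        using x by simp
      also have "\<dots> = of_real x powr (- A + 1 + (g - 2 - A') + z y)" unfolding X_def powr_add[symmetric] ..
      also have "- A + 1 + (g - 2 - A') + z y = (?p + 1) - 1 - \<i> * of_real (\<mu> * y)"
        by (simp add: z_def r0_def ops algebra_simps)
      finally have E: "of_real x powr (- A) * of_real x * X * of_real x powr z y = of_real x powr ((?p + 1) - 1 - \<i> * of_real (\<mu> * y))" .
      show ?thesis unfolding E[symmetric] by (simp only: mult_ac)
    qed
    hence "of_real x powr (- A) * of_real x * X * (LBINT y. (axis_weight G m (n + 3) U L a \<theta> y / of_real (2 * pi)) * of_real x powr z y)
      = (LBINT y. (axis_weight G m (n + 3) U L a \<theta> y / of_real (2 * pi)) * of_real x powr ((?p + 1) - 1 - \<i> * of_real (\<mu> * y)))"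
      by (simp only: integral_mult_right_zero[symmetric])
    also have "\<dots> = of_real x powr ((?p + 1) - 1) * I_fun G m (n + 3) U L (a * of_real (x powr \<mu>)) \<theta>"
      by (rule I_fun_power[OF a x, symmetric])
    finally show ?thesis by (simp only: add_diff_cancel_right')
  qed
  finally show ?thesis using ex by blast
qed

end
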